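(* Let $n,m$ be positive integers, let $C\in M_n(\mathbb{Z}_+\cup\{\infty\})$ and let $C'\in M_m(\mathbb{Z}_+\cup\{\infty\})$. (1) If the algebras $\mathcal{T}_+(C)$ and $\mathcal{T}_+(C')$ are isometrically isomorphic, then $n=m$ and there is a permutation $\tau\in S_n$ such that $C'_{ij}=C_{\tau(i)\tau(j)}$ for all $i,j$. (2) If the algebras $H^\infty(C)$ and $H^\infty(C')$ are isometrically isomorphic via an isomorphism that is $w^*$-bicontinuous, then $n=m$ and there is a permutation $\tau\in S_n$ such that $C'_{ij}=C_{\tau(i)\tau(j)}$ for all $i,j$.
   Context: $\mathbb{Z}_+$ is the set of non-negative integers; $\infty$ stands for countable infinity, $\mathbb{C}^\infty=\ell_2$ and $\mathbb{C}^0=\{0\}$. Inner products are linear in the second variable. The correspondence $E(C)$. Let $C$ be an $n\times n$ matrix ($n<\infty$) with entries in $\mathbb{Z}_+\cup\{\infty\}$ and let $A=D_n$ be the algebra of diagonal complex $n\times n$ matrices. For each $i,j$ let $E(C)_{ij}=\mathbb{C}^{C_{ij}}$, a Hilbert space of dimension $C_{ij}$. $E(C)$ is the vector space of $n\times n$ matrices $\xi$ whose $(i,j)$ entry $\xi_{ij}$ is a vector in $E(C)_{ij}$. For $D=\mathrm{diag}(d_1,\ldots,d_n)\in A$, the right and left actions are $(\xi D)_{ij}=\xi_{ij}d_j$ and $(\varphi(D)\xi)_{ij}=d_i\xi_{ij}$, and the $A$-valued inner product is the diagonal matrix $\langle\xi,\eta\rangle$ with $j$-th diagonal entry $\sum_{i=1}^n\langle\xi_{ij},\eta_{ij}\rangle$.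 This makes $E(C)$ a W*-correspondence over $A$ (a self-dual right Hilbert $C^*$-module with left action given by a normal $*$-homomorphism $\varphi:A\to\mathcal{L}(E(C))$ into the adjointable operators). The algebras. For a W*-correspondence $E$ over $A$, the full Fock space is $\mathcal{F}(E)=A\oplus E\oplus E^{\otimes 2}\oplus\cdots$ (internal tensor products over $A$). $A$ acts on the left by $\varphi_\infty(a)=\mathrm{diag}(a,\varphi(a),\varphi^{(2)}(a),\ldots)$, where $\varphi^{(k)}(a)(\xi_1\otimes\cdots\otimes\xi_k)=\varphi(a)\xi_1\otimes\xi_2\otimes\cdots\otimes\xi_k$. For $\xi\in E$ the creation operator is $T_\xi(\xi_1\otimes\cdots\otimes\xi_k)=\xi\otimes\xi_1\otimes\cdots\otimes\xi_k$ (and $T_\xi a=\xi a$ for $a\in A$). $\mathcal{T}_+(E)$ is the norm-closed subalgebra of $\mathcal{L}(\mathcal{F}(E))$ generated by $\{T_\xi:\xi\in E\}$ and $\varphi_\infty(A)$. The algebra $\mathcal{L}(\mathcal{F}(E))$ is a von Neumann algebra, and $H^\infty(E)$ is the $w^*$-closure of $\mathcal{T}_+(E)$ in it. Write $\mathcal{T}_+(C)=\mathcal{T}_+(E(C))$ and $H^\infty(C)=H^\infty(E(C))$. *)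

theory Defs
  imports
    "HOL-Analysis.Analysis"
    "HOL-Library.Function_Algebras"
    "HOL-Library.Extended_Nat"
    "HOL-Combinatorics.Permutations"
begin

text \<open>
  Matrices have rows and columns indexed by \<open>{..<n}\<close>. A diagonal matrix is given by its diagonal, a
  sequence that vanishes from \<open>n\<close> on, so that sums and products of diagonal matrices are the
  pointwise ones of \<^theory>\<open>HOL-Library.Function_Algebras\<close>.
\<close>

type_synonym diag = "nat \<Rightarrow> complex"

definition diag_alg :: "nat \<Rightarrow> diag set" where
  "diag_alg n = {d. \<forall>i\<ge>n. d i = 0}"

definition diag_scalar :: "nat \<Rightarrow> complex \<Rightarrow> diag" where
  "diag_scalar n c = (\<lambda>i. if i < n then c else 0)"

definition diag_adj :: "diag \<Rightarrow> diag" where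
  "diag_adj d = (\<lambda>i. cnj (d i))"

definition diag_norm :: "nat \<Rightarrow> diag \<Rightarrow> real" where
  "diag_norm n d = Max ((\<lambda>i. cmod (d i)) ` {..<n})"


section \<open>Hilbert modules over the diagonal algebra\<close>

record 'x hmod =
  carr :: "'x set"
  rmul :: "'x \<Rightarrow> diag \<Rightarrow> 'x"
  ip :: "'x \<Rightarrow> 'x \<Rightarrow> diag"

record 'x corr = "'x hmod" +
  lmul :: "diag \<Rightarrow> 'x \<Rightarrow> 'x"

text \<open>The complex vector space structure of a module is the one given by the scalar matrices.\<close>

definition csc :: "nat \<Rightarrow> ('x, 'r) hmod_scheme \<Rightarrow> complex \<Rightarrow> 'x \<Rightarrow> 'x" where
  "csc n X c x = rmul X x (diag_scalar n c)"

definition mnorm :: "nat \<Rightarrow> ('x, 'r) hmod_scheme \<Rightarrow> 'x \<Rightarrow> real" where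
  "mnorm n X x = sqrt (diag_norm n (ip X x x))"

definition mconv :: "nat \<Rightarrow> ('x::ab_group_add, 'r) hmod_scheme \<Rightarrow> (nat \<Rightarrow> 'x) \<Rightarrow> 'x \<Rightarrow> bool" where
  "mconv n X s x \<longleftrightarrow> (\<lambda>k. mnorm n X (s k - x)) \<longlonglongrightarrow> 0"

text \<open>
  As the diagonal algebra is finite-dimensional, every Hilbert module over it is self-dual, every
  \<open>*\<close>-homomorphism defined on it is normal, and norm-convergent and ultraweak direct sums agree.
\<close>

locale hilbert_module =
  fixes n :: nat and X :: "('x::ab_group_add, 'r) hmod_scheme"
  assumes zero_closed: "0 \<in> carr X"
    and add_closed: "\<lbrakk>x \<in> carr X; y \<in> carr X\<rbrakk> \<Longrightarrow> x + y \<in> carr X"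
    and rmul_closed: "\<lbrakk>x \<in> carr X; a \<in> diag_alg n\<rbrakk> \<Longrightarrow> rmul X x a \<in> carr X"
    and rmul_add_left: "\<lbrakk>x \<in> carr X; y \<in> carr X; a \<in> diag_alg n\<rbrakk>
          \<Longrightarrow> rmul X (x + y) a = rmul X x a + rmul X y a"
    and rmul_add_right: "\<lbrakk>x \<in> carr X; a \<in> diag_alg n; b \<in> diag_alg n\<rbrakk>
          \<Longrightarrow> rmul X x (a + b) = rmul X x a + rmul X x b"
    and rmul_rmul: "\<lbrakk>x \<in> carr X; a \<in> diag_alg n; b \<in> diag_alg n\<rbrakk>
          \<Longrightarrow> rmul X (rmul X x a) b = rmul X x (a * b)"
    and rmul_unit: "x \<in> carr X \<Longrightarrow> rmul X x (diag_scalar n 1) = x"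
    and ip_closed: "\<lbrakk>x \<in> carr X; y \<in> carr X\<rbrakk> \<Longrightarrow> ip X x y \<in> diag_alg n"
    and ip_add_right: "\<lbrakk>x \<in> carr X; y \<in> carr X; z \<in> carr X\<rbrakk>
          \<Longrightarrow> ip X x (y + z) = ip X x y + ip X x z"
    and ip_rmul_right: "\<lbrakk>x \<in> carr X; y \<in> carr X; a \<in> diag_alg n\<rbrakk>
          \<Longrightarrow> ip X x (rmul X y a) = ip X x y * a"
    and ip_adj: "\<lbrakk>x \<in> carr X; y \<in> carr X\<rbrakk> \<Longrightarrow> ip X y x = diag_adj (ip X x y)"
    and ip_pos: "x \<in> carr X \<Longrightarrow> 0 \<le> Re (ip X x x j)"
    and ip_definite: "\<lbrakk>x \<in> carr X; ip X x x = 0\<rbrakk> \<Longrightarrow> x = 0"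
    and complete: "\<lbrakk>\<And>k. s k \<in> carr X;
            \<And>e. 0 < e \<Longrightarrow> \<exists>N. \<forall>k\<ge>N. \<forall>l\<ge>N. mnorm n X (s k - s l) < e\<rbrakk>
          \<Longrightarrow> \<exists>x\<in>carr X. mconv n X s x"

definition closed_submodule :: "nat \<Rightarrow> ('x::ab_group_add, 'r) hmod_scheme \<Rightarrow> 'x set \<Rightarrow> bool" where
  "closed_submodule n X S \<longleftrightarrow> S \<subseteq> carr X \<and> 0 \<in> S
     \<and> (\<forall>x\<in>S. \<forall>y\<in>S. x + y \<in> S) \<and> (\<forall>x\<in>S. \<forall>a\<in>diag_alg n. rmul X x a \<in> S)
     \<and> (\<forall>s. \<forall>x\<in>carr X. (\<forall>k. s k \<in> S) \<and> mconv n X s x \<longrightarrow> x \<in> S)"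


section \<open>The correspondence of a matrix\<close>

text \<open>\<open>\<complex>\<^sup>d\<close>, with \<open>\<complex>\<^sup>\<infinity> = \<ell>\<^sub>2\<close>, as a space of sequences.\<close>

definition hilb :: "enat \<Rightarrow> (nat \<Rightarrow> complex) set" where
  "hilb d = {v. (\<forall>k. d \<le> enat k \<longrightarrow> v k = 0) \<and> summable (\<lambda>k. (cmod (v k))\<^sup>2)}"

definition hilb_ip :: "(nat \<Rightarrow> complex) \<Rightarrow> (nat \<Rightarrow> complex) \<Rightarrow> complex" where
  "hilb_ip v w = (\<Sum>k. cnj (v k) * w k)"

definition matrix_corr :: "nat \<Rightarrow> (nat \<Rightarrow> nat \<Rightarrow> enat) \<Rightarrow> (nat \<Rightarrow> nat \<Rightarrow> nat \<Rightarrow> complex) corr" where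
  "matrix_corr n C =
    \<lparr> carr = {\<xi>. (\<forall>i<n. \<forall>j<n. \<xi> i j \<in> hilb (C i j)) \<and> (\<forall>i j. \<not> (i < n \<and> j < n) \<longrightarrow> \<xi> i j = 0)},
      rmul = (\<lambda>\<xi> d i j k. \<xi> i j k * d j),
      ip = (\<lambda>\<xi> \<eta> j. \<Sum>i<n. hilb_ip (\<xi> i j) (\<eta> i j)),
      lmul = (\<lambda>d \<xi> i j k. d i * \<xi> i j k) \<rparr>"


section \<open>Fock spaces\<close>

text \<open>
  The inner product of two elementary tensors of the same length \<open>\<ge> 1\<close> in an internal tensor power:
  \<open>\<langle>\<xi> \<otimes> x, \<eta> \<otimes> y\<rangle> = \<langle>x, \<phi>(\<langle>\<xi>, \<eta>\<rangle>) y\<rangle>\<close>, where \<open>\<phi>(a)\<close> acts on the first factor of \<open>y\<close>.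
\<close>

fun tensor_ip :: "('e, 'r) corr_scheme \<Rightarrow> 'e list \<Rightarrow> 'e list \<Rightarrow> diag" where
  "tensor_ip E [\<xi>] [\<eta>] = ip E \<xi> \<eta>"
| "tensor_ip E (\<xi> # \<xi>' # \<xi>s) (\<eta> # \<eta>' # \<eta>s) =
     tensor_ip E (\<xi>' # \<xi>s) (lmul E (ip E \<xi> \<eta>) \<eta>' # \<eta>s)"
| "tensor_ip E _ _ = 0"

text \<open>
  A Fock space of \<open>E\<close> is a Hilbert module together with the embedding \<open>vac\<close> of the summand \<open>A\<close> and,
  for \<open>k \<ge> 1\<close>, the elementary tensors \<open>ten [\<xi>\<^sub>1, \<dots>, \<xi>\<^sub>k] = \<xi>\<^sub>1 \<otimes> \<cdots> \<otimes> \<xi>\<^sub>k\<close> of the summand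
  \<open>E\<^sup>\<otimes>\<^sup>k\<close>. It is the completion of the algebraic direct sum of the algebraic tensor powers for the
  inner product below. That elementary tensors are additive in each factor and balanced, and that
  \<open>rmul\<close> acts on the last factor, follows from the inner product formula, since the inner product
  is definite. These data are unique up to a unique unitary, and \<open>fock_space_exists\<close> below shows
  that there is one for every matrix correspondence.
\<close>

record ('e, 'x) fock = "'x hmod" +
  vac :: "diag \<Rightarrow> 'x"
  ten :: "'e list \<Rightarrow> 'x"

definition words :: "('e, 'r) hmod_scheme \<Rightarrow> 'e list set" where
  "words E = {\<xi>s. \<xi>s \<noteq> [] \<and> set \<xi>s \<subseteq> carr E}"

definition fock_space ::
  "nat \<Rightarrow> ('e, 'r) corr_scheme \<Rightarrow> ('e, 'x::ab_group_add, 's) fock_scheme \<Rightarrow> bool" where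
  "fock_space n E F \<longleftrightarrow>
     hilbert_module n F
     \<and> vac F ` diag_alg n \<subseteq> carr F \<and> ten F ` words E \<subseteq> carr F
     \<and> (\<forall>a\<in>diag_alg n. \<forall>b\<in>diag_alg n. ip F (vac F a) (vac F b) = diag_adj a * b)
     \<and> (\<forall>a\<in>diag_alg n. \<forall>\<xi>s\<in>words E. ip F (vac F a) (ten F \<xi>s) = 0)
     \<and> (\<forall>\<xi>s\<in>words E. \<forall>\<eta>s\<in>words E. ip F (ten F \<xi>s) (ten F \<eta>s) =
           (if length \<xi>s = length \<eta>s then tensor_ip E \<xi>s \<eta>s else 0))
     \<and> closed_submodule n F hull (vac F ` diag_alg n \<union> ten F ` words E) = carr F"


section \<open>Adjointable operators\<close>

text \<open>
  Operators are extended by \<open>0\<close> off the carrier, so that equality, sums and composition of functions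
  are those of operators.
\<close>

definition adjointable :: "('x::ab_group_add, 'r) hmod_scheme \<Rightarrow> ('x \<Rightarrow> 'x) set" where
  "adjointable X = {T. (\<forall>x\<in>carr X. T x \<in> carr X) \<and> (\<forall>x. x \<notin> carr X \<longrightarrow> T x = 0)
     \<and> (\<exists>S. \<forall>x\<in>carr X. S x \<in> carr X \<and> (\<forall>y\<in>carr X. ip X (S x) y = ip X x (T y)))}"

definition op_norm :: "nat \<Rightarrow> ('x, 'r) hmod_scheme \<Rightarrow> ('x \<Rightarrow> 'x) \<Rightarrow> real" where
  "op_norm n X T = Sup {mnorm n X (T x) | x. x \<in> carr X \<and> mnorm n X x \<le> 1}"

definition op_scale :: "nat \<Rightarrow> ('x, 'r) hmod_scheme \<Rightarrow> complex \<Rightarrow> ('x \<Rightarrow> 'x) \<Rightarrow> 'x \<Rightarrow> 'x" where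
  "op_scale n X c T = (\<lambda>x. csc n X c (T x))"

definition closed_subalgebra :: "nat \<Rightarrow> ('x::ab_group_add, 'r) hmod_scheme \<Rightarrow> ('x \<Rightarrow> 'x) set \<Rightarrow> bool" where
  "closed_subalgebra n X B \<longleftrightarrow> B \<subseteq> adjointable X \<and> 0 \<in> B
     \<and> (\<forall>S\<in>B. \<forall>T\<in>B. S + T \<in> B \<and> S \<circ> T \<in> B) \<and> (\<forall>c. \<forall>T\<in>B. op_scale n X c T \<in> B)
     \<and> (\<forall>s. \<forall>T\<in>adjointable X. (\<forall>k. s k \<in> B) \<and> (\<lambda>k. op_norm n X (s k - T)) \<longlonglongrightarrow> 0 \<longrightarrow> T \<in> B)"

text \<open>
  The \<open>w*\<close>-topology of the von Neumann algebra of adjointable operators is its ultraweak topology on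
  the Hilbert space that is the module with the inner product \<open>\<Sum>j. \<langle>x, y\<rangle>\<^sub>j\<close>. (This is the tensor
  product of the module over \<open>A\<close> with the identity representation of \<open>A\<close> on \<open>\<complex>\<^sup>n\<close>, on which the
  adjointable operators are the commutant of the right action.)
\<close>

definition trace_ip :: "nat \<Rightarrow> ('x, 'r) hmod_scheme \<Rightarrow> 'x \<Rightarrow> 'x \<Rightarrow> complex" where
  "trace_ip n X x y = (\<Sum>j<n. ip X x y j)"

definition sq_summable :: "nat \<Rightarrow> ('x, 'r) hmod_scheme \<Rightarrow> (nat \<Rightarrow> 'x) set" where
  "sq_summable n X = {x. (\<forall>k. x k \<in> carr X) \<and> summable (\<lambda>k. Re (trace_ip n X (x k) (x k)))}"

definition wstar_topology :: "nat \<Rightarrow> ('x::ab_group_add, 'r) hmod_scheme \<Rightarrow> ('x \<Rightarrow> 'x) topology" where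
  "wstar_topology n X = topology_generated_by
     {{T \<in> adjointable X. (\<Sum>k. trace_ip n X (x k) (T (y k))) \<in> U} | x y U.
        x \<in> sq_summable n X \<and> y \<in> sq_summable n X \<and> open U}"


section \<open>Tensor algebras and Hardy algebras\<close>

definition diag_op :: "nat \<Rightarrow> ('e, 'r) corr_scheme \<Rightarrow> ('e, 'x::ab_group_add, 's) fock_scheme \<Rightarrow>
    diag \<Rightarrow> 'x \<Rightarrow> 'x" where
  "diag_op n E F a = (THE T. T \<in> adjointable F
     \<and> (\<forall>b\<in>diag_alg n. T (vac F b) = vac F (a * b))
     \<and> (\<forall>\<xi> \<xi>s. \<xi> # \<xi>s \<in> words E \<longrightarrow> T (ten F (\<xi> # \<xi>s)) = ten F (lmul E a \<xi> # \<xi>s)))"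

definition creation :: "nat \<Rightarrow> ('e, 'r) corr_scheme \<Rightarrow> ('e, 'x::ab_group_add, 's) fock_scheme \<Rightarrow>
    'e \<Rightarrow> 'x \<Rightarrow> 'x" where
  "creation n E F \<xi> = (THE T. T \<in> adjointable F
     \<and> (\<forall>b\<in>diag_alg n. T (vac F b) = ten F [rmul E \<xi> b])
     \<and> (\<forall>\<xi>s\<in>words E. T (ten F \<xi>s) = ten F (\<xi> # \<xi>s)))"

definition tensor_algebra :: "nat \<Rightarrow> ('e, 'r) corr_scheme \<Rightarrow> ('e, 'x::ab_group_add, 's) fock_scheme \<Rightarrow>
    ('x \<Rightarrow> 'x) set" where
  "tensor_algebra n E F =
     closed_subalgebra n F hull (creation n E F ` carr E \<union> diag_op n E F ` diag_alg n)"

definition hardy_algebra :: "nat \<Rightarrow> ('e, 'r) corr_scheme \<Rightarrow> ('e, 'x::ab_group_add, 's) fock_scheme \<Rightarrow>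
    ('x \<Rightarrow> 'x) set" where
  "hardy_algebra n E F = wstar_topology n F closure_of tensor_algebra n E F"

definition isometric_isomorphism ::
  "nat \<Rightarrow> ('x::ab_group_add, 'r) hmod_scheme \<Rightarrow> ('x \<Rightarrow> 'x) set \<Rightarrow>
   nat \<Rightarrow> ('y::ab_group_add, 's) hmod_scheme \<Rightarrow> ('y \<Rightarrow> 'y) set \<Rightarrow>
   (('x \<Rightarrow> 'x) \<Rightarrow> ('y \<Rightarrow> 'y)) \<Rightarrow> bool" where
  "isometric_isomorphism n X B m Y D \<alpha> \<longleftrightarrow> bij_betw \<alpha> B D
     \<and> (\<forall>S\<in>B. \<forall>T\<in>B. \<alpha> (S + T) = \<alpha> S + \<alpha> T \<and> \<alpha> (S \<circ> T) = \<alpha> S \<circ> \<alpha> T)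
     \<and> (\<forall>c. \<forall>T\<in>B. \<alpha> (op_scale n X c T) = op_scale m Y c (\<alpha> T))
     \<and> (\<forall>T\<in>B. op_norm m Y (\<alpha> T) = op_norm n X T)"

definition wstar_bicontinuous ::
  "nat \<Rightarrow> ('x::ab_group_add, 'r) hmod_scheme \<Rightarrow> ('x \<Rightarrow> 'x) set \<Rightarrow>
   nat \<Rightarrow> ('y::ab_group_add, 's) hmod_scheme \<Rightarrow> ('y \<Rightarrow> 'y) set \<Rightarrow>
   (('x \<Rightarrow> 'x) \<Rightarrow> ('y \<Rightarrow> 'y)) \<Rightarrow> bool" where
  "wstar_bicontinuous n X B m Y D \<alpha> \<longleftrightarrow>
     homeomorphic_map (subtopology (wstar_topology n X) B) (subtopology (wstar_topology m Y) D) \<alpha>"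

section \<open>Existence of Fock spaces\<close>

text \<open>
  Not used in any definition above: the \<open>\<ell>\<^sub>2\<close>-space of the paths of the quiver with \<open>C i j\<close> edges
  between \<open>i\<close> and \<open>j\<close> is a Fock space of the correspondence of \<open>C\<close>. A path is a list of pairs
  (first vertex of an edge, number of the edge) together with the vertex at which it ends.
\<close>

definition l2 :: "('a \<Rightarrow> complex) \<Rightarrow> bool" where
  "l2 f \<longleftrightarrow> (\<lambda>p. (cmod (f p))\<^sup>2) summable_on UNIV"

definition l2_sq :: "('a \<Rightarrow> complex) \<Rightarrow> real" where
  "l2_sq f = (\<Sum>\<^sub>\<infinity>p. (cmod (f p))\<^sup>2)"

definition l2_ip :: "('a \<Rightarrow> complex) \<Rightarrow> ('a \<Rightarrow> complex) \<Rightarrow> complex" where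
  "l2_ip f g = (\<Sum>\<^sub>\<infinity>p. cnj (f p) * g p)"

lemma l2_prod: "l2 f \<Longrightarrow> l2 g \<Longrightarrow> (\<lambda>p. norm (cnj (f p) * g p)) summable_on UNIV"
  by (rule abs_summable_product)
     (auto simp: l2_def norm_mult power2_eq_square)

lemma l2_prod': "l2 f \<Longrightarrow> l2 g \<Longrightarrow> (\<lambda>p. cnj (f p) * g p) summable_on UNIV"
  by (rule Infinite_Sum.abs_summable_summable[OF l2_prod])

lemma l2_comparison:
  assumes "l2 f" "\<And>p. cmod (g p) \<le> c * cmod (f p)" shows "l2 g"
  unfolding l2_def
proof (rule summable_on_comparison_test)
  show "(\<lambda>p. c\<^sup>2 * (cmod (f p))\<^sup>2) summable_on UNIV"
    using assms(1) by (auto simp: l2_def intro: summable_on_cmult_right)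
  fix p
  show "(cmod (g p))\<^sup>2 \<le> c\<^sup>2 * (cmod (f p))\<^sup>2"
    using power_mono[OF assms(2)[of p], of 2] by (simp add: power_mult_distrib)
qed auto

lemma l2_add:
  assumes "l2 f" "l2 g" shows "l2 (\<lambda>p. f p + g p)"
  unfolding l2_def
proof (rule summable_on_comparison_test)
  show "(\<lambda>p. 2 * (cmod (f p))\<^sup>2 + 2 * (cmod (g p))\<^sup>2) summable_on UNIV"
    using assms by (auto simp: l2_def intro!: summable_on_add summable_on_cmult_right)
  fix p
  have "(cmod (f p + g p))\<^sup>2 \<le> (cmod (f p) + cmod (g p))\<^sup>2"
    by (intro power_mono norm_triangle_ineq) auto
  also have "\<dots> \<le> 2 * (cmod (f p))\<^sup>2 + 2 * (cmod (g p))\<^sup>2"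
    using sum_squares_bound[of "cmod (f p)" "cmod (g p)"] by (simp add: power2_sum)
  finally show "(cmod (f p + g p))\<^sup>2 \<le> 2 * (cmod (f p))\<^sup>2 + 2 * (cmod (g p))\<^sup>2" .
qed auto

lemma l2_cmult: "l2 f \<Longrightarrow> l2 (\<lambda>p. f p * c)"
  by (erule l2_comparison[where c="cmod c"]) (simp add: norm_mult)

lemma l2_diff: "l2 f \<Longrightarrow> l2 g \<Longrightarrow> l2 (\<lambda>p. f p - g p)"
  using l2_add[of f "\<lambda>p. g p * (-1)"] l2_cmult[of g "-1"] by simp

lemma l2_ip_self:
  assumes "l2 f" shows "l2_ip f f = of_real (l2_sq f)"
proof -
  have "((\<lambda>p. complex_of_real ((cmod (f p))\<^sup>2)) has_sum of_real (l2_sq f)) UNIV"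
    using assms unfolding l2_def l2_sq_def by (intro has_sum_of_real has_sum_infsum)
  moreover have "(\<lambda>p. complex_of_real ((cmod (f p))\<^sup>2)) = (\<lambda>p. cnj (f p) * f p)"
    by (simp only: complex_norm_square mult.commute)
  ultimately show ?thesis by (simp add: l2_ip_def infsumI)
qed

lemma l2_ip_cnj: "l2_ip g f = cnj (l2_ip f g)"
proof -
  have "l2_ip g f = (\<Sum>\<^sub>\<infinity>p. cnj (cnj (f p) * g p))"
    unfolding l2_ip_def by (intro infsum_cong) (simp add: mult.commute)
  thus ?thesis
    unfolding l2_ip_def infsum_cnj .
qed

lemma l2_sq_nonneg: "0 \<le> l2_sq f"
  unfolding l2_sq_def by (rule infsum_nonneg) auto

lemma l2_sq_point: "l2 f \<Longrightarrow> (cmod (f p))\<^sup>2 \<le> l2_sq f"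
  using finite_sum_le_infsum[of "\<lambda>p. (cmod (f p))\<^sup>2" UNIV "{p}"] by (simp add: l2_def l2_sq_def)

lemma l2_complete:
  fixes s :: "nat \<Rightarrow> 'a \<Rightarrow> complex"
  assumes l2: "\<And>k. l2 (s k)"
    and Cauchy: "\<And>e. 0 < e \<Longrightarrow> \<exists>N. \<forall>k\<ge>N. \<forall>l\<ge>N. l2_sq (\<lambda>p. s k p - s l p) < e"
  shows "\<exists>f. l2 f \<and> (\<forall>p. (\<lambda>k. s k p) \<longlonglongrightarrow> f p)
           \<and> (\<forall>e>0. \<exists>N. \<forall>k\<ge>N. l2_sq (\<lambda>p. s k p - f p) \<le> e)"
proof -
  have "\<exists>z. (\<lambda>k. s k p) \<longlonglongrightarrow> z" for p
  proof -
    have "Cauchy (\<lambda>k. s k p)"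
      unfolding Cauchy_def
    proof (intro allI impI)
      fix e :: real assume "0 < e"
      then obtain N where N: "\<And>k l. k \<ge> N \<Longrightarrow> l \<ge> N \<Longrightarrow> l2_sq (\<lambda>p. s k p - s l p) < e\<^sup>2"
        using Cauchy[of "e\<^sup>2"] by auto
      have "dist (s k p) (s l p) < e" if "k \<ge> N" "l \<ge> N" for k l
      proof -
        have "(cmod (s k p - s l p))\<^sup>2 < e\<^sup>2"
          using l2_sq_point[OF l2_diff[OF l2 l2], where p=p] N[OF that] by (rule le_less_trans)
        thus ?thesis
          using \<open>0 < e\<close> by (simp add: dist_norm power2_less_imp_less)
      qed
      thus "\<exists>N. \<forall>k\<ge>N. \<forall>l\<ge>N. dist (s k p) (s l p) < e" by blast
    qed
    thus ?thesis
      by (simp add: Cauchy_convergent_iff convergent_def)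
  qed
  then obtain f where f: "\<And>p. (\<lambda>k. s k p) \<longlonglongrightarrow> f p" by metis
  have key: "l2 (\<lambda>p. s k p - f p) \<and> l2_sq (\<lambda>p. s k p - f p) \<le> e"
    if N: "\<And>l. l \<ge> N \<Longrightarrow> l2_sq (\<lambda>p. s k p - s l p) < e" for N k e
  proof -
    have fin: "(\<Sum>p\<in>A. (cmod (s k p - f p))\<^sup>2) \<le> e" if "finite A" for A
    proof (rule LIMSEQ_le_const2)
      show "(\<lambda>l. \<Sum>p\<in>A. (cmod (s k p - s l p))\<^sup>2) \<longlonglongrightarrow> (\<Sum>p\<in>A. (cmod (s k p - f p))\<^sup>2)"
        by (intro tendsto_intros f)
      show "\<exists>N. \<forall>l\<ge>N. (\<Sum>p\<in>A. (cmod (s k p - s l p))\<^sup>2) \<le> e"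
      proof (intro exI allI impI)
        fix l assume "l \<ge> N"
        have "(\<Sum>p\<in>A. (cmod (s k p - s l p))\<^sup>2) \<le> l2_sq (\<lambda>p. s k p - s l p)"
          unfolding l2_sq_def using l2_diff[OF l2 l2, of k l] \<open>finite A\<close>
          by (intro finite_sum_le_infsum) (auto simp: l2_def)
        also have "\<dots> \<le> e" using N[OF \<open>l \<ge> N\<close>] by simp
        finally show "(\<Sum>p\<in>A. (cmod (s k p - s l p))\<^sup>2) \<le> e" .
      qed
    qed
    have "l2 (\<lambda>p. s k p - f p)"
      unfolding l2_def
      by (rule nonneg_bdd_above_summable_on) (auto intro!: bdd_aboveI2 fin)
    moreover have "l2_sq (\<lambda>p. s k p - f p) \<le> e"
      unfolding l2_sq_def
      by (rule infsum_le_finite_sums) (use calculation fin in \<open>auto simp: l2_def\<close>)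
    ultimately show ?thesis ..
  qed
  obtain N where N: "\<And>k l. k \<ge> N \<Longrightarrow> l \<ge> N \<Longrightarrow> l2_sq (\<lambda>p. s k p - s l p) < 1"
    using Cauchy[of 1] by auto
  have "l2 (\<lambda>p. s N p - f p)" using key[of N N 1] N by blast
  hence "l2 f" using l2_diff[OF l2[of N], of "\<lambda>p. s N p - f p"] by simp
  moreover have "\<exists>N. \<forall>k\<ge>N. l2_sq (\<lambda>p. s k p - f p) \<le> e" if "e > 0" for e
    using Cauchy[OF that] key by meson
  ultimately show ?thesis using f by blast
qed

lemma l2_truncate:
  assumes "l2 f" "0 < e"
  shows "\<exists>A. finite A \<and> l2_sq (\<lambda>p. (if p \<in> A then f p else 0) - f p) \<le> e"
proof -
  let ?g = "\<lambda>p. (cmod (f p))\<^sup>2"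
  have sm: "?g summable_on UNIV" using assms by (simp add: l2_def)
  obtain A where A: "finite A" "dist (sum ?g A) (infsum ?g UNIV) \<le> e"
    using infsum_finite_approximation[OF sm assms(2)] by auto
  have smc: "?g summable_on (- A)" using sm by (rule summable_on_subset_banach) auto
  have "infsum ?g UNIV = infsum ?g A + infsum ?g (- A)"
    using infsum_Un_disjoint[of ?g A "- A"] A(1) smc by simp
  moreover have "l2_sq (\<lambda>p. (if p \<in> A then f p else 0) - f p) = infsum ?g (- A)"
    unfolding l2_sq_def by (rule infsum_cong_neutral) auto
  ultimately show ?thesis using A by (intro exI[of _ A]) (auto simp: dist_real_def)
qed


fun src :: "(nat \<times> nat) list \<Rightarrow> nat \<Rightarrow> nat" where
  "src [] j = j"
| "src (e # p) j = fst e"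

fun quiver_path :: "nat \<Rightarrow> (nat \<Rightarrow> nat \<Rightarrow> enat) \<Rightarrow> (nat \<times> nat) list \<Rightarrow> nat \<Rightarrow> bool" where
  "quiver_path n C [] j \<longleftrightarrow> j < n"
| "quiver_path n C (e # p) j \<longleftrightarrow> fst e < n \<and> enat (snd e) < C (fst e) (src p j) \<and> quiver_path n C p j"

definition path_cons :: "(nat \<Rightarrow> nat \<Rightarrow> nat \<Rightarrow> complex) \<Rightarrow> ((nat \<times> nat) list \<Rightarrow> nat \<Rightarrow> complex) \<Rightarrow>
    (nat \<times> nat) list \<Rightarrow> nat \<Rightarrow> complex" where
  "path_cons \<xi> f = (\<lambda>p j. case p of [] \<Rightarrow> 0 | e # q \<Rightarrow> \<xi> (fst e) (src q j) (snd e) * f q j)"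

definition path_vac :: "diag \<Rightarrow> (nat \<times> nat) list \<Rightarrow> nat \<Rightarrow> complex" where
  "path_vac a = (\<lambda>p j. if p = [] then a j else 0)"

definition path_fock :: "nat \<Rightarrow> (nat \<Rightarrow> nat \<Rightarrow> enat) \<Rightarrow>
    (nat \<Rightarrow> nat \<Rightarrow> nat \<Rightarrow> complex, (nat \<times> nat) list \<Rightarrow> nat \<Rightarrow> complex) fock" where
  "path_fock n C =
    \<lparr> carr = {f. (\<forall>p j. \<not> quiver_path n C p j \<longrightarrow> f p j = 0) \<and> (\<forall>j. l2 (\<lambda>p. f p j))},
      rmul = (\<lambda>f d p j. f p j * d j),
      ip = (\<lambda>f g j. l2_ip (\<lambda>p. f p j) (\<lambda>p. g p j)),
      vac = path_vac,
      ten = (\<lambda>\<xi>s. foldr path_cons \<xi>s (path_vac (diag_scalar n 1))) \<rparr>"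

lemma src_less: "quiver_path n C p j \<Longrightarrow> src p j < n"
  by (cases p) auto

lemma path_end: "quiver_path n C p j \<Longrightarrow> j < n"
  by (induction p) auto

lemma infsum_nat_suminf:
  fixes v :: "nat \<Rightarrow> complex"
  shows "v summable_on UNIV \<Longrightarrow> (\<Sum>\<^sub>\<infinity>k. v k) = suminf v"
  by (metis has_sum_imp_sums has_sum_infsum sums_unique)

lemma hilb_l2: "v \<in> hilb d \<Longrightarrow> l2 v"
  by (auto simp: hilb_def l2_def intro: norm_summable_imp_summable_on)

lemma corr_hilb:
  assumes "\<xi> \<in> carr (matrix_corr n C)"
  shows "l2 (\<xi> i j)"
proof (cases "i < n \<and> j < n")
  case True
  thus ?thesis using assms hilb_l2 by (auto simp: matrix_corr_def)
next
  case False
  hence "\<xi> i j = (\<lambda>_. 0)" using assms by (auto simp: matrix_corr_def zero_fun_def)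
  thus ?thesis by (simp add: l2_def)
qed

lemma corr_zero:
  assumes "\<xi> \<in> carr (matrix_corr n C)" "\<not> (i < n \<and> j < n \<and> enat k < C i j)"
  shows "\<xi> i j k = 0"
proof (cases "i < n \<and> j < n")
  case True
  thus ?thesis using assms by (auto simp: matrix_corr_def hilb_def)
next
  case False
  thus ?thesis using assms by (auto simp: matrix_corr_def)
qed

lemma corr_col_l2:
  assumes "\<xi> \<in> carr (matrix_corr n C)"
  shows "l2 (\<lambda>e. \<xi> (fst e) j (snd e))"
proof -
  let ?f = "\<lambda>e. (cmod (\<xi> (fst e) j (snd e)))\<^sup>2"
  have "(\<lambda>e. norm (?f e)) summable_on Sigma UNIV (\<lambda>_. UNIV)"
    unfolding Infinite_Sum.abs_summable_on_Sigma_iff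
  proof (intro conjI ballI)
    show "(\<lambda>k. norm (?f (i, k))) summable_on UNIV" for i
      using corr_hilb[OF assms] by (simp add: l2_def)
    show "(\<lambda>i. norm (\<Sum>\<^sub>\<infinity>k. norm (?f (i, k)))) summable_on UNIV"
    proof (rule finite_nonzero_values_imp_summable_on)
      show "finite {i \<in> UNIV. norm (\<Sum>\<^sub>\<infinity>k. norm (?f (i, k))) \<noteq> 0}"
        by (rule finite_subset[of _ "{..<n}"]) (auto simp: corr_zero[OF assms] not_le[symmetric] intro: ccontr)
    qed
  qed
  thus ?thesis by (simp add: l2_def)
qed

lemma corr_col_ip:
  assumes "\<xi> \<in> carr (matrix_corr n C)" "\<eta> \<in> carr (matrix_corr n C)"
  shows "l2_ip (\<lambda>e. \<xi> (fst e) j (snd e)) (\<lambda>e. \<eta> (fst e) j (snd e)) = ip (matrix_corr n C) \<xi> \<eta> j"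
proof -
  let ?f = "\<lambda>e. cnj (\<xi> (fst e) j (snd e)) * \<eta> (fst e) j (snd e)"
  have "?f summable_on Sigma UNIV (\<lambda>_. UNIV)"
    using l2_prod'[OF corr_col_l2[OF assms(1)] corr_col_l2[OF assms(2)], of j j] by simp
  from infsum_Sigma_banach[OF this]
  have "infsum ?f UNIV = (\<Sum>\<^sub>\<infinity>i. \<Sum>\<^sub>\<infinity>k. ?f (i, k))" by simp
  also have "\<dots> = (\<Sum>\<^sub>\<infinity>i\<in>{..<n}. \<Sum>\<^sub>\<infinity>k. ?f (i, k))"
    by (rule infsum_cong_neutral) (auto simp: corr_zero[OF assms(1)])
  also have "\<dots> = (\<Sum>i<n. \<Sum>\<^sub>\<infinity>k. ?f (i, k))" by simp
  also have "\<dots> = (\<Sum>i<n. hilb_ip (\<xi> i j) (\<eta> i j))"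
    unfolding hilb_ip_def
    using l2_prod'[OF corr_hilb[OF assms(1)] corr_hilb[OF assms(2)]]
    by (intro sum.cong refl) (simp add: infsum_nat_suminf)
  finally show ?thesis by (simp add: l2_ip_def matrix_corr_def)
qed

lemma cons_bij: "bij_betw (\<lambda>(q, e). e # q) UNIV (- {[]})"
  by (rule bij_betwI[where g="\<lambda>p. (tl p, hd p)"]) auto

lemma infsum_lists:
  fixes u :: "'a list \<Rightarrow> 'b::{comm_monoid_add,t2_space}"
  assumes "u [] = 0"
  shows "infsum u UNIV = (\<Sum>\<^sub>\<infinity>(q, e). u (e # q))"
proof -
  have "infsum u UNIV = infsum u (- {[]})"
    by (rule infsum_cong_neutral) (auto simp: assms)
  also have "\<dots> = (\<Sum>\<^sub>\<infinity>x. u ((\<lambda>(q, e). e # q) x))"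
    by (rule infsum_reindex_bij_betw[OF cons_bij, symmetric])
  finally show ?thesis unfolding case_prod_unfold .
qed

lemma summable_lists:
  fixes u :: "'a list \<Rightarrow> 'b::{comm_monoid_add,t2_space}"
  assumes "u [] = 0"
  shows "u summable_on UNIV \<longleftrightarrow> (\<lambda>(q, e). u (e # q)) summable_on UNIV"
proof -
  have "u summable_on UNIV \<longleftrightarrow> u summable_on (- {[]})"
    by (rule summable_on_cong_neutral) (auto simp: assms)
  also have "\<dots> \<longleftrightarrow> (\<lambda>x. u ((\<lambda>(q, e). e # q) x)) summable_on UNIV"
    by (rule summable_on_reindex_bij_betw[OF cons_bij, symmetric])
  finally show ?thesis unfolding case_prod_unfold .
qed

lemma cons_l2:
  assumes \<xi>: "\<xi> \<in> carr (matrix_corr n C)" and f: "f \<in> carr (path_fock n C)"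
  shows "l2 (\<lambda>p. path_cons \<xi> f p j)"
proof -
  let ?f = "\<lambda>x. (cmod (\<xi> (fst (snd x)) (src (fst x) j) (snd (snd x)) * f (fst x) j))\<^sup>2"
  define M where "M = (\<Sum>t<n. l2_sq (\<lambda>e. \<xi> (fst e) t (snd e)))"
  have M: "l2_sq (\<lambda>e. \<xi> (fst e) t (snd e)) \<le> M" for t
  proof (cases "t < n")
    case True
    thus ?thesis unfolding M_def by (intro member_le_sum) (auto simp: l2_sq_nonneg)
  next
    case False
    hence "l2_sq (\<lambda>e. \<xi> (fst e) t (snd e)) = 0"
      by (simp add: l2_sq_def corr_zero[OF \<xi>])
    thus ?thesis unfolding M_def by (simp add: sum_nonneg l2_sq_nonneg)
  qed
  have fl2: "l2 (\<lambda>p. f p j)" using f by (auto simp: path_fock_def)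
  have "(\<lambda>x. norm (?f x)) summable_on Sigma UNIV (\<lambda>_. UNIV)"
    unfolding Infinite_Sum.abs_summable_on_Sigma_iff
  proof (intro conjI ballI)
    show "(\<lambda>e. norm (?f (q, e))) summable_on UNIV" for q
      using corr_col_l2[OF \<xi>, of "src q j"]
      by (auto simp: l2_def norm_mult power_mult_distrib intro!: summable_on_cmult_left)
    have eq: "(\<Sum>\<^sub>\<infinity>e. norm (?f (q, e))) = l2_sq (\<lambda>e. \<xi> (fst e) (src q j) (snd e)) * (cmod (f q j))\<^sup>2" for q
      by (simp add: l2_sq_def norm_mult power_mult_distrib infsum_cmult_left')
    show "(\<lambda>q. norm (\<Sum>\<^sub>\<infinity>e. norm (?f (q, e)))) summable_on UNIV"
    proof (rule summable_on_comparison_test)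
      show "(\<lambda>q. M * (cmod (f q j))\<^sup>2) summable_on UNIV"
        using fl2 by (auto simp: l2_def intro: summable_on_cmult_right)
      fix q
      show "norm (\<Sum>\<^sub>\<infinity>e. norm (?f (q, e))) \<le> M * (cmod (f q j))\<^sup>2"
        unfolding eq by (simp add: l2_sq_nonneg M mult_right_mono)
    qed simp
  qed
  hence "?f summable_on UNIV" by simp
  thus ?thesis
    unfolding l2_def by (subst summable_lists) (simp_all add: path_cons_def case_prod_unfold)
qed

lemma cons_closed:
  assumes \<xi>: "\<xi> \<in> carr (matrix_corr n C)" and f: "f \<in> carr (path_fock n C)"
  shows "path_cons \<xi> f \<in> carr (path_fock n C)"
proof -
  have "path_cons \<xi> f p j = 0" if "\<not> quiver_path n C p j" for p j
  proof (cases p)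
    case (Cons e q)
    show ?thesis
    proof (cases "quiver_path n C q j")
      case True
      hence "\<not> (fst e < n \<and> src q j < n \<and> enat (snd e) < C (fst e) (src q j))"
        using that Cons by auto
      thus ?thesis using corr_zero[OF \<xi>] Cons by (simp add: path_cons_def)
    next
      case False
      thus ?thesis using f Cons by (simp add: path_cons_def path_fock_def)
    qed
  qed (simp add: path_cons_def)
  thus ?thesis using cons_l2[OF assms] by (simp add: path_fock_def)
qed

lemma cons_ip:
  assumes \<xi>: "\<xi> \<in> carr (matrix_corr n C)" and \<eta>: "\<eta> \<in> carr (matrix_corr n C)"
    and f: "f \<in> carr (path_fock n C)" and g: "g \<in> carr (path_fock n C)"
  shows "ip (path_fock n C) (path_cons \<xi> f) (path_cons \<eta> g) =
    ip (path_fock n C) f (\<lambda>p j. ip (matrix_corr n C) \<xi> \<eta> (src p j) * g p j)"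
proof
  fix j
  let ?u = "\<lambda>p. cnj (path_cons \<xi> f p j) * path_cons \<eta> g p j"
  let ?v = "\<lambda>x. cnj (\<xi> (fst (snd x)) (src (fst x) j) (snd (snd x)) * f (fst x) j)
                 * (\<eta> (fst (snd x)) (src (fst x) j) (snd (snd x)) * g (fst x) j)"
  have u0: "?u [] = 0" by (simp add: path_cons_def)
  have uv: "(\<lambda>(q, e). ?u (e # q)) = ?v" by (auto simp: path_cons_def)
  have "?u summable_on UNIV" by (rule l2_prod'[OF cons_l2[OF \<xi> f] cons_l2[OF \<eta> g]])
  hence "?v summable_on Sigma UNIV (\<lambda>_. UNIV)"
    using summable_lists[of ?u, OF u0] uv by simp
  from infsum_Sigma_banach[OF this]
  have "infsum ?v UNIV = (\<Sum>\<^sub>\<infinity>q. \<Sum>\<^sub>\<infinity>e. ?v (q, e))" by simp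
  also have "\<dots> = (\<Sum>\<^sub>\<infinity>q. cnj (f q j) * (ip (matrix_corr n C) \<xi> \<eta> (src q j) * g q j))"
  proof (rule infsum_cong)
    fix q
    have "(\<Sum>\<^sub>\<infinity>e. ?v (q, e)) = (\<Sum>\<^sub>\<infinity>e. (cnj (\<xi> (fst e) (src q j) (snd e)) * \<eta> (fst e) (src q j) (snd e))
        * (cnj (f q j) * g q j))"
      by (intro infsum_cong) simp
    also have "\<dots> = ip (matrix_corr n C) \<xi> \<eta> (src q j) * (cnj (f q j) * g q j)"
      using corr_col_ip[OF \<xi> \<eta>, of "src q j"] by (simp add: infsum_cmult_left' l2_ip_def)
    finally show "(\<Sum>\<^sub>\<infinity>e. ?v (q, e)) = cnj (f q j) * (ip (matrix_corr n C) \<xi> \<eta> (src q j) * g q j)"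
      by (simp add: mult_ac)
  qed
  finally have "infsum ?u UNIV = \<dots>"
    using infsum_lists[of ?u, OF u0] uv by simp
  thus "ip (path_fock n C) (path_cons \<xi> f) (path_cons \<eta> g) j =
    ip (path_fock n C) f (\<lambda>p j. ip (matrix_corr n C) \<xi> \<eta> (src p j) * g p j) j"
    by (simp add: path_fock_def l2_ip_def)
qed


lemma path_carr:
  "f \<in> carr (path_fock n C) \<longleftrightarrow> (\<forall>p j. \<not> quiver_path n C p j \<longrightarrow> f p j = 0) \<and> (\<forall>j. l2 (\<lambda>p. f p j))"
  by (simp add: path_fock_def)

lemma path_ip: "ip (path_fock n C) f g j = l2_ip (\<lambda>p. f p j) (\<lambda>p. g p j)"
  by (simp add: path_fock_def)

lemma path_rmul: "rmul (path_fock n C) f d = (\<lambda>p j. f p j * d j)"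
  by (simp add: path_fock_def)

lemma path_mnorm_less:
  assumes "0 < n" "x \<in> carr (path_fock n C)" "0 < e"
  shows "mnorm n (path_fock n C) x < e \<longleftrightarrow> (\<forall>j<n. l2_sq (\<lambda>p. x p j) < e\<^sup>2)"
proof -
  have "(\<lambda>i. cmod (ip (path_fock n C) x x i)) = (\<lambda>j. l2_sq (\<lambda>p. x p j))"
    using assms(2) by (auto simp: path_ip path_carr l2_ip_self l2_sq_nonneg)
  hence "mnorm n (path_fock n C) x = sqrt (Max ((\<lambda>j. l2_sq (\<lambda>p. x p j)) ` {..<n}))"
    unfolding mnorm_def diag_norm_def by (simp only:)
  moreover have "sqrt y < e \<longleftrightarrow> y < e\<^sup>2" for y
    using real_sqrt_less_iff[of y "e\<^sup>2"] assms(3) by simp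
  moreover have "Max ((\<lambda>j. l2_sq (\<lambda>p. x p j)) ` {..<n}) < e\<^sup>2 \<longleftrightarrow> (\<forall>j<n. l2_sq (\<lambda>p. x p j) < e\<^sup>2)"
    using assms(1) by (subst Max_less_iff) auto
  ultimately show ?thesis by simp
qed

lemma path_mnorm_nonneg:
  assumes "0 < n" shows "0 \<le> mnorm n (path_fock n C) x"
proof -
  have "0 \<le> cmod (ip (path_fock n C) x x 0)" by simp
  also have "\<dots> \<le> diag_norm n (ip (path_fock n C) x x)"
    unfolding diag_norm_def using assms by (intro Max_ge) auto
  finally show ?thesis by (simp add: mnorm_def)
qed

lemma path_diff:
  "f \<in> carr (path_fock n C) \<Longrightarrow> g \<in> carr (path_fock n C) \<Longrightarrow> f - g \<in> carr (path_fock n C)"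
  by (auto simp: path_carr intro: l2_diff)

lemma path_mconvI:
  assumes n: "0 < n" and s: "\<And>k. s k \<in> carr (path_fock n C)" and x: "x \<in> carr (path_fock n C)"
    and conv: "\<And>e j. 0 < e \<Longrightarrow> j < n \<Longrightarrow> \<exists>N. \<forall>k\<ge>N. l2_sq (\<lambda>p. s k p j - x p j) \<le> e"
  shows "mconv n (path_fock n C) s x"
  unfolding mconv_def tendsto_iff
proof (intro allI impI)
  fix e :: real assume "0 < e"
  have "eventually (\<lambda>k. \<forall>j\<in>{..<n}. l2_sq (\<lambda>p. s k p j - x p j) \<le> e\<^sup>2 / 2) sequentially"
    using conv[of "e\<^sup>2 / 2"] \<open>0 < e\<close>
    by (intro eventually_ball_finite) (auto simp: eventually_sequentially)
  thus "eventually (\<lambda>k. dist (mnorm n (path_fock n C) (s k - x)) 0 < e) sequentially"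
  proof (rule eventually_mono)
    fix k assume *: "\<forall>j\<in>{..<n}. l2_sq (\<lambda>p. s k p j - x p j) \<le> e\<^sup>2 / 2"
    have "\<forall>j<n. l2_sq (\<lambda>p. (s k - x) p j) < e\<^sup>2"
    proof (intro allI impI)
      fix j assume "j < n"
      hence "l2_sq (\<lambda>p. (s k - x) p j) \<le> e\<^sup>2 / 2" using * by simp
      also have "\<dots> < e\<^sup>2" using \<open>0 < e\<close> by simp
      finally show "l2_sq (\<lambda>p. (s k - x) p j) < e\<^sup>2" .
    qed
    thus "dist (mnorm n (path_fock n C) (s k - x)) 0 < e"
      using path_mnorm_less[OF n path_diff[OF s x] \<open>0 < e\<close>] path_mnorm_nonneg[OF n] by simp
  qed
qed

lemma path_complete:
  assumes n: "0 < n" and s: "\<And>k. s k \<in> carr (path_fock n C)"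
    and Cauchy: "\<And>e. 0 < e \<Longrightarrow> \<exists>N. \<forall>k\<ge>N. \<forall>l\<ge>N. mnorm n (path_fock n C) (s k - s l) < e"
  shows "\<exists>x\<in>carr (path_fock n C). mconv n (path_fock n C) s x"
proof -
  have sl2: "l2 (\<lambda>p. s k p j)" and s0: "\<not> quiver_path n C p j \<Longrightarrow> s k p j = 0" for k p j
    using s[of k] by (auto simp: path_carr)
  have "\<exists>f. l2 f \<and> (\<forall>p. (\<lambda>k. s k p j) \<longlonglongrightarrow> f p)
           \<and> (\<forall>e>0. \<exists>N. \<forall>k\<ge>N. l2_sq (\<lambda>p. s k p j - f p) \<le> e)" for j
  proof (cases "j < n")
    case True
    show ?thesis
    proof (rule l2_complete)
      fix e :: real assume "0 < e"
      obtain N where N: "\<And>k l. k \<ge> N \<Longrightarrow> l \<ge> N \<Longrightarrow> mnorm n (path_fock n C) (s k - s l) < sqrt e"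
        using Cauchy[of "sqrt e"] \<open>0 < e\<close> by auto
      have "l2_sq (\<lambda>p. s k p j - s l p j) < e" if "k \<ge> N" "l \<ge> N" for k l
        using N[OF that] path_mnorm_less[OF n path_diff[OF s s], of "sqrt e"] \<open>0 < e\<close> True by simp
      thus "\<exists>N. \<forall>k\<ge>N. \<forall>l\<ge>N. l2_sq (\<lambda>p. s k p j - s l p j) < e" by blast
    qed (rule sl2)
  next
    case False
    hence "s k p j = 0" for k p using s0 path_end by blast
    thus ?thesis by (intro exI[of _ "\<lambda>_. 0"]) (auto simp: l2_def l2_sq_def)
  qed
  then obtain f where f: "\<And>j. l2 (f j)" "\<And>j p. (\<lambda>k. s k p j) \<longlonglongrightarrow> f j p"
    and conv: "\<And>j e. 0 < e \<Longrightarrow> \<exists>N. \<forall>k\<ge>N. l2_sq (\<lambda>p. s k p j - f j p) \<le> e"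
    by metis
  define x where "x = (\<lambda>p j. f j p)"
  have "x \<in> carr (path_fock n C)"
  proof -
    have "f j p = 0" if "\<not> quiver_path n C p j" for p j
      using f(2)[where p=p and j=j] s0[OF that] by (simp add: LIMSEQ_const_iff)
    thus ?thesis using f(1) by (auto simp: path_carr x_def)
  qed
  moreover from n s this have "mconv n (path_fock n C) s x"
    by (rule path_mconvI) (simp add: x_def conv)
  ultimately show ?thesis by blast
qed

lemma path_hilbert_module:
  assumes n: "0 < n"
  shows "hilbert_module n (path_fock n C)"
proof (unfold_locales, goal_cases)
  case 1
  show ?case by (simp add: path_carr l2_def)
next
  case (2 x y)
  thus ?case by (auto simp: path_carr intro: l2_add)
next
  case (3 x a)
  thus ?case by (auto simp: path_carr path_rmul intro: l2_cmult)
next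
  case (7 x)
  have "x p j * diag_scalar n 1 j = x p j" for p j
    using 7 path_end[of n C p j] by (cases "quiver_path n C p j") (auto simp: path_carr diag_scalar_def)
  thus ?case by (simp add: path_rmul fun_eq_iff)
next
  case (8 x y)
  have "ip (path_fock n C) x y j = 0" if "j \<ge> n" for j
  proof -
    have "x p j = 0" for p using 8(1) that path_end[of n C p j] by (auto simp: path_carr)
    thus ?thesis by (simp add: path_ip l2_ip_def)
  qed
  thus ?case by (simp add: diag_alg_def)
next
  case (9 x y z)
  have "ip (path_fock n C) x (y + z) j = ip (path_fock n C) x y j + ip (path_fock n C) x z j" for j
    using 9 infsum_add[OF l2_prod' l2_prod', of "\<lambda>p. x p j" "\<lambda>p. y p j" "\<lambda>p. x p j" "\<lambda>p. z p j"]
    by (simp add: path_ip path_carr l2_ip_def distrib_left)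
  thus ?case by (auto simp: fun_eq_iff)
next
  case (10 x y a)
  have "ip (path_fock n C) x (rmul (path_fock n C) y a) j = ip (path_fock n C) x y j * a j" for j
    by (simp add: path_ip path_rmul l2_ip_def infsum_cmult_left' flip: mult.assoc)
  thus ?case by (auto simp: fun_eq_iff)
next
  case (11 x y)
  show ?case unfolding fun_eq_iff path_ip diag_adj_def by (intro allI l2_ip_cnj)
next
  case (12 x j)
  thus ?case by (simp add: path_ip path_carr l2_ip_self l2_sq_nonneg)
next
  case (13 x)
  have "x p j = 0" for p j
  proof -
    have l2: "l2 (\<lambda>p. x p j)" using 13 by (simp add: path_carr)
    have "l2_ip (\<lambda>p. x p j) (\<lambda>p. x p j) = 0"
      using fun_cong[OF 13(2), of j] by (simp add: path_ip)
    thus ?thesis using l2_sq_point[OF l2, of p] by (simp add: l2_ip_self[OF l2])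
  qed
  thus ?case by (simp add: fun_eq_iff)
next
  case (14 s)
  show ?case by (rule path_complete[OF n 14])
qed (auto simp: path_rmul fun_eq_iff algebra_simps)

lemma path_vac_closed: "a \<in> diag_alg n \<Longrightarrow> path_vac a \<in> carr (path_fock n C)"
  by (auto simp: path_carr path_vac_def diag_alg_def l2_def not_less
      intro!: finite_nonzero_values_imp_summable_on finite_subset[of _ "{[]}"] split: if_splits)

lemma diag_scalar_closed: "diag_scalar n c \<in> diag_alg n"
  by (simp add: diag_scalar_def diag_alg_def)

lemma path_ten_nil: "ten (path_fock n C) [] = path_vac (diag_scalar n 1)"
  and path_ten_cons: "ten (path_fock n C) (\<xi> # \<xi>s) = path_cons \<xi> (ten (path_fock n C) \<xi>s)"
  and path_vac: "vac (path_fock n C) = path_vac"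
  by (simp_all add: path_fock_def)

lemma path_ten_closed:
  "set \<xi>s \<subseteq> carr (matrix_corr n C) \<Longrightarrow> ten (path_fock n C) \<xi>s \<in> carr (path_fock n C)"
  by (induction \<xi>s)
     (auto simp: path_ten_nil path_ten_cons path_vac_closed diag_scalar_closed cons_closed)

lemma path_ten_length: "length p \<noteq> length \<xi>s \<Longrightarrow> ten (path_fock n C) \<xi>s p j = 0"
proof (induction \<xi>s arbitrary: p)
  case Nil
  thus ?case by (simp add: path_ten_nil path_vac_def)
next
  case (Cons \<xi> \<xi>s)
  thus ?case by (auto simp: path_ten_cons path_cons_def split: list.splits)
qed

lemma lmul_closed:
  assumes "\<xi> \<in> carr (matrix_corr n C)"
  shows "lmul (matrix_corr n C) d \<xi> \<in> carr (matrix_corr n C)"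
proof -
  have "summable (\<lambda>k. (cmod (d i * \<xi> i j k))\<^sup>2)" if "summable (\<lambda>k. (cmod (\<xi> i j k))\<^sup>2)" for i j
    using summable_mult[OF that, of "(cmod (d i))\<^sup>2"] by (simp add: norm_mult power_mult_distrib)
  thus ?thesis using assms by (auto simp: matrix_corr_def hilb_def fun_eq_iff)
qed

lemma corr_ip_closed:
  assumes "\<xi> \<in> carr (matrix_corr n C)"
  shows "ip (matrix_corr n C) \<xi> \<eta> \<in> diag_alg n"
  using assms by (auto simp: matrix_corr_def diag_alg_def hilb_ip_def)

lemma path_vac_ip:
  "ip (path_fock n C) (path_vac a) g j = cnj (a j) * g [] j"
proof -
  have "(\<Sum>\<^sub>\<infinity>p. cnj (path_vac a p j) * g p j) = (\<Sum>\<^sub>\<infinity>p\<in>{[]}. cnj (path_vac a p j) * g p j)"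
    by (rule infsum_cong_neutral) (auto simp: path_vac_def)
  thus ?thesis by (simp add: path_ip l2_ip_def path_vac_def)
qed

lemma path_ten_ip:
  assumes "length \<xi>s = length \<eta>s" "\<xi>s \<in> words (matrix_corr n C)" "\<eta>s \<in> words (matrix_corr n C)"
  shows "ip (path_fock n C) (ten (path_fock n C) \<xi>s) (ten (path_fock n C) \<eta>s)
           = tensor_ip (matrix_corr n C) \<xi>s \<eta>s"
  using assms
proof (induction "matrix_corr n C" \<xi>s \<eta>s rule: tensor_ip.induct)
  case (1 \<xi> \<eta>)
  hence c: "\<xi> \<in> carr (matrix_corr n C)" "\<eta> \<in> carr (matrix_corr n C)" by (auto simp: words_def)
  have v: "path_vac (diag_scalar n 1) \<in> carr (path_fock n C)"
    by (intro path_vac_closed diag_scalar_closed)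
  have "ip (path_fock n C) (ten (path_fock n C) [\<xi>]) (ten (path_fock n C) [\<eta>]) j
           = ip (matrix_corr n C) \<xi> \<eta> j" for j
    using corr_ip_closed[OF c(1), of \<eta>]
    unfolding path_ten_cons path_ten_nil cons_ip[OF c v v] path_vac_ip
    by (auto simp: path_vac_def diag_scalar_def diag_alg_def)
  thus ?case by (simp add: fun_eq_iff)
next
  case (2 \<xi> \<xi>' \<xi>s \<eta> \<eta>' \<eta>s)
  let ?E = "matrix_corr n C" and ?F = "path_fock n C"
  let ?d = "ip ?E \<xi> \<eta>"
  have c: "\<xi> \<in> carr ?E" "\<eta> \<in> carr ?E" "\<eta>' \<in> carr ?E" "set (\<xi>' # \<xi>s) \<subseteq> carr ?E" "set (\<eta>' # \<eta>s) \<subseteq> carr ?E"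
    using 2 by (auto simp: words_def)
  have "(\<lambda>p j. ?d (src p j) * ten ?F (\<eta>' # \<eta>s) p j) = ten ?F (lmul ?E ?d \<eta>' # \<eta>s)"
    by (auto simp: fun_eq_iff path_ten_cons path_cons_def matrix_corr_def split: list.splits)
  hence "ip ?F (ten ?F (\<xi> # \<xi>' # \<xi>s)) (ten ?F (\<eta> # \<eta>' # \<eta>s))
      = ip ?F (ten ?F (\<xi>' # \<xi>s)) (ten ?F (lmul ?E ?d \<eta>' # \<eta>s))"
    using cons_ip[OF c(1,2) path_ten_closed[OF c(4)] path_ten_closed[OF c(5)]]
    by (simp add: path_ten_cons)
  also have "\<dots> = tensor_ip ?E (\<xi>' # \<xi>s) (lmul ?E ?d \<eta>' # \<eta>s)"
    using 2 c by (intro 2(1)) (auto simp: words_def lmul_closed)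
  finally show ?case by simp
qed (auto simp: words_def)

lemma path_ten_orthogonal:
  assumes "length \<xi>s \<noteq> length \<eta>s"
  shows "ip (path_fock n C) (ten (path_fock n C) \<xi>s) (ten (path_fock n C) \<eta>s) = 0"
proof -
  have "cnj (ten (path_fock n C) \<xi>s p j) * ten (path_fock n C) \<eta>s p j = 0" for p j
    using path_ten_length[of p \<xi>s] path_ten_length[of p \<eta>s] assms by fastforce
  hence "(\<lambda>p. cnj (ten (path_fock n C) \<xi>s p j) * ten (path_fock n C) \<eta>s p j) = (\<lambda>_. 0)" for j
    by blast
  thus ?thesis by (simp only: fun_eq_iff path_ip l2_ip_def) simp
qed

definition unit_edge :: "nat \<Rightarrow> nat \<Rightarrow> nat \<Rightarrow> nat \<Rightarrow> nat \<Rightarrow> nat \<Rightarrow> complex" where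
  "unit_edge i t k = (\<lambda>i' t' k'. if i' = i \<and> t' = t \<and> k' = k then 1 else 0)"

lemma unit_edge_closed:
  assumes "i < n" "t < n" "enat k < C i t"
  shows "unit_edge i t k \<in> carr (matrix_corr n C)"
proof -
  have "summable (\<lambda>k'. (cmod (unit_edge i t k i' t' k'))\<^sup>2)" for i' t'
    by (rule summable_finite[of "{k}"]) (auto simp: unit_edge_def)
  thus ?thesis using assms by (auto simp: matrix_corr_def hilb_def unit_edge_def fun_eq_iff)
qed

definition unit_path :: "(nat \<times> nat) list \<Rightarrow> nat \<Rightarrow> (nat \<times> nat) list \<Rightarrow> nat \<Rightarrow> complex" where
  "unit_path p j = (\<lambda>p' j'. if p' = p \<and> j' = j then 1 else 0)"

lemma unit_path_word:
  assumes "quiver_path n C p j" "p \<noteq> []"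
  shows "\<exists>\<xi>s\<in>words (matrix_corr n C). ten (path_fock n C) \<xi>s = unit_path p j"
  using assms
proof (induction p)
  case (Cons e q)
  let ?\<xi> = "unit_edge (fst e) (src q j) (snd e)"
  have \<xi>: "?\<xi> \<in> carr (matrix_corr n C)"
    using Cons.prems src_less by (intro unit_edge_closed) auto
  show ?case
  proof (cases "q = []")
    case True
    have "ten (path_fock n C) [?\<xi>] = unit_path (e # q) j"
      using Cons.prems True
      by (auto simp: fun_eq_iff path_ten_cons path_ten_nil path_cons_def path_vac_def
          unit_edge_def unit_path_def diag_scalar_def prod_eq_iff split: list.splits)
    thus ?thesis using \<xi> by (intro bexI[of _ "[?\<xi>]"]) (auto simp: words_def)
  next
    case False
    then obtain \<xi>s where \<xi>s: "\<xi>s \<in> words (matrix_corr n C)" "ten (path_fock n C) \<xi>s = unit_path q j"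
      using Cons by auto
    have "ten (path_fock n C) (?\<xi> # \<xi>s) = unit_path (e # q) j"
      by (auto simp: fun_eq_iff path_ten_cons \<xi>s(2) path_cons_def
          unit_edge_def unit_path_def prod_eq_iff split: list.splits)
    thus ?thesis using \<xi> \<xi>s by (intro bexI[of _ "?\<xi> # \<xi>s"]) (auto simp: words_def)
  qed
qed simp

lemma path_total:
  assumes n: "0 < n"
    and S: "closed_submodule n (path_fock n C) S"
    and gen: "path_vac ` diag_alg n \<union> ten (path_fock n C) ` words (matrix_corr n C) \<subseteq> S"
  shows "carr (path_fock n C) \<subseteq> S"
proof
  fix x assume x: "x \<in> carr (path_fock n C)"
  have unit: "unit_path p j \<in> S" if path: "quiver_path n C p j" for p j
  proof (cases "p = []")
    case True
    have "path_vac (\<lambda>i. if i = j then 1 else 0) = unit_path p j"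
      using True by (auto simp: path_vac_def unit_path_def fun_eq_iff)
    moreover have "(\<lambda>i. if i = j then 1 else 0) \<in> diag_alg n"
      using path True by (auto simp: diag_alg_def)
    ultimately have "unit_path p j \<in> path_vac ` diag_alg n" by (metis image_eqI)
    thus ?thesis using gen by blast
  next
    case False
    then obtain \<xi>s where \<xi>s: "\<xi>s \<in> words (matrix_corr n C)" "ten (path_fock n C) \<xi>s = unit_path p j"
      using unit_path_word[OF path] by blast
    have "ten (path_fock n C) \<xi>s \<in> S" using gen \<xi>s(1) by blast
    thus ?thesis by (simp add: \<xi>s(2))
  qed
  have fin: "(\<lambda>p j. if (p, j) \<in> A then x p j else 0) \<in> S" if "finite A" for A
    using that
  proof (induction A)
    case empty
    thus ?case using S by (simp add: closed_submodule_def zero_fun_def)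
  next
    case (insert a A)
    obtain p j where a: "a = (p, j)" by (cases a)
    let ?x = "\<lambda>A p j. if (p, j) \<in> A then x p j else 0"
    show ?case
    proof (cases "quiver_path n C p j")
      case True
      have "?x (insert a A) = ?x A + rmul (path_fock n C) (unit_path p j) (diag_scalar n (x p j))"
        using insert.hyps(2) a path_end[OF True]
        by (auto simp: fun_eq_iff path_rmul unit_path_def diag_scalar_def)
      thus ?thesis
        using insert.IH unit[OF True] S diag_scalar_closed by (simp add: closed_submodule_def)
    next
      case False
      hence "x p j = 0" using x by (simp add: path_carr)
      hence "?x (insert a A) = ?x A" using a by (auto simp: fun_eq_iff)
      thus ?thesis using insert.IH by simp
    qed
  qed
  have xl2: "l2 (\<lambda>p. x p j)" for j using x by (simp add: path_carr)
  define A where "A j k = (SOME A. finite A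
    \<and> l2_sq (\<lambda>p. (if p \<in> A then x p j else 0) - x p j) \<le> 1 / (real k + 1))" for j k
  have A: "finite (A j k)"
    "l2_sq (\<lambda>p. (if p \<in> A j k then x p j else 0) - x p j) \<le> 1 / (real k + 1)" for j k
  proof -
    have "0 < 1 / (real k + 1)" by simp
    from someI_ex[OF l2_truncate[OF xl2 this], of j]
    show "finite (A j k)"
      "l2_sq (\<lambda>p. (if p \<in> A j k then x p j else 0) - x p j) \<le> 1 / (real k + 1)"
      unfolding A_def by blast+
  qed
  define s where "s k = (\<lambda>p j. if (p, j) \<in> (\<Union>j<n. A j k \<times> {j}) then x p j else 0)" for k
  have s: "s k \<in> S" for k unfolding s_def by (rule fin) (simp add: A(1))
  have "mconv n (path_fock n C) s x"
  proof (rule path_mconvI[OF n _ x])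
    show "s k \<in> carr (path_fock n C)" for k
      using s S by (auto simp: closed_submodule_def)
    fix e :: real and j assume "0 < e" "j < n"
    obtain N :: nat where N: "1 / e < real N" using reals_Archimedean2 by blast
    have "l2_sq (\<lambda>p. s k p j - x p j) \<le> e" if "k \<ge> N" for k
    proof -
      have "(\<lambda>p. s k p j - x p j) = (\<lambda>p. (if p \<in> A j k then x p j else 0) - x p j)"
        using \<open>j < n\<close> by (auto simp: s_def)
      hence "l2_sq (\<lambda>p. s k p j - x p j) \<le> 1 / (real k + 1)" using A(2)[of j k] by simp
      also have "\<dots> \<le> e"
      proof -
        have "1 / e \<le> real k + 1" using N that by linarith
        thus ?thesis using \<open>0 < e\<close> by (simp add: field_simps)
      qed
      finally show ?thesis .
    qed
    thus "\<exists>N. \<forall>k\<ge>N. l2_sq (\<lambda>p. s k p j - x p j) \<le> e" by blast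
  qed
  thus "x \<in> S" using s x S unfolding closed_submodule_def by blast
qed

theorem fock_space_exists:
  assumes n: "0 < n"
  shows "fock_space n (matrix_corr n C) (path_fock n C)"
proof -
  let ?F = "path_fock n C" and ?E = "matrix_corr n C"
  have hm: "hilbert_module n ?F" by (rule path_hilbert_module[OF n])
  have carr: "closed_submodule n ?F (carr ?F)"
    using hilbert_module.zero_closed[OF hm] hilbert_module.add_closed[OF hm]
      hilbert_module.rmul_closed[OF hm]
    by (auto simp: closed_submodule_def)
  have gen: "path_vac ` diag_alg n \<union> ten ?F ` words ?E \<subseteq> carr ?F"
    by (auto simp: words_def path_vac_closed intro!: path_ten_closed)
  have "closed_submodule n ?F hull (path_vac ` diag_alg n \<union> ten ?F ` words ?E) = carr ?F"
  proof
    show "closed_submodule n ?F hull (path_vac ` diag_alg n \<union> ten ?F ` words ?E) \<subseteq> carr ?F"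
      unfolding hull_def using gen carr by blast
    show "carr ?F \<subseteq> closed_submodule n ?F hull (path_vac ` diag_alg n \<union> ten ?F ` words ?E)"
      unfolding hull_def using path_total[OF n] by blast
  qed
  moreover have "ip ?F (path_vac a) (path_vac b) = diag_adj a * b" for a b
    unfolding fun_eq_iff path_vac_ip by (simp add: diag_adj_def path_vac_def)
  moreover have "ip ?F (path_vac a) (ten ?F \<xi>s) = 0" if "\<xi>s \<in> words ?E" for a \<xi>s
    using that by (auto simp: fun_eq_iff path_vac_ip path_ten_length words_def)
  ultimately show ?thesis
    using hm gen path_ten_ip path_ten_orthogonal
    by (auto simp: fock_space_def path_vac)
qed

end

theory Submission
  imports Defs "HOL-Combinatorics.Cycles"
begin

text \<open>
  Coefficients of the operators in both algebras are lower triangular with respect to the path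
  basis of the Fock space. Hence the vacuum coefficient at a vertex is a character, and the
  coefficient of an edge from \<open>k\<close> to \<open>l\<close> is a derivation with respect to the characters at \<open>k\<close> and
  \<open>l\<close>. An isomorphism \<open>\<alpha>\<close> pulls the characters of the second algebra back to characters of the
  first; each of them is \<open>1\<close> at exactly one vertex projection, which gives a map \<open>\<sigma>\<close> of vertices. It
  is onto, since an idempotent at which all vacuum coefficients vanish is \<open>0\<close>. The pulled back
  derivations, corrected by inner ones so as to vanish on the diagonal, are determined by their
  values at the edges from \<open>\<sigma> k\<close> to \<open>\<sigma> l\<close>; as they are linearly independent, \<open>C' k l \<le> C (\<sigma> k) (\<sigma> l)\<close>.
  Applied to \<open>\<alpha>\<close> and to its inverse, this shows that the two matrices agree up to a permutation. That
  \<open>\<alpha>\<close> may move the vacuum character to another character over the same vertex does no harm, and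
  isometry is used only through continuity.
\<close>

section \<open>Operators on Hilbert modules\<close>

text \<open>The isomorphism need not respect the grading by path length, so nothing can be
  transported degree by degree; what survives is information of lowest order. Multiplicities are
  compared by contradiction: if \<open>C' k l\<close> were not below
  \<open>C (\<sigma> k) (\<sigma> l)\<close>, the latter would be a finite number \<open>d\<close>,
  and \<open>d + 1\<close> edge derivations would face only \<open>d\<close> edge values, so that a
  nontrivial combination of them vanishes. Hence no infinite-dimensional count occurs, and infinite
  entries need no separate treatment. Two kinds of closure stand between the generators and the
  algebras: norm limits for the tensor algebra and ultraweak limits for the Hardy algebra. All
  functionals are therefore kept continuous in both senses; this is what boundedness of adjointable
  operators and the reading of coordinates as vector functionals are for. The Fock space is an
  arbitrary one, known only through its inner products, and reaches the space of paths through a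
  unitary that respects the generators.\<close>

locale pos_hilbert_module = hilbert_module n X for n :: nat and X :: "('x::ab_group_add, 'r) hmod_scheme" +
  assumes n_pos: "0 < n"
begin

section \<open>Vector space structure, inner product and norm\<close>

lemma diag_alg_zero: "0 \<in> diag_alg n"
  by (simp add: diag_alg_def)

lemma rmul_zero: assumes "x \<in> carr X" shows "rmul X x 0 = 0"
  using rmul_add_right[OF assms diag_alg_zero diag_alg_zero] by simp

lemma scalar_closed: "x \<in> carr X \<Longrightarrow> csc n X c x \<in> carr X"
  unfolding csc_def by (intro rmul_closed diag_scalar_closed)

lemma csc_neg: assumes "x \<in> carr X" shows "csc n X (-1) x = - x"
proof -
  have "diag_scalar n 1 + diag_scalar n (-1) = 0"
    by (auto simp: diag_scalar_def fun_eq_iff)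
  hence "rmul X x (diag_scalar n 1) + rmul X x (diag_scalar n (-1)) = 0"
    using rmul_add_right[OF assms diag_scalar_closed diag_scalar_closed] rmul_zero[OF assms] by metis
  thus ?thesis
    unfolding csc_def using rmul_unit[OF assms] by (metis minus_unique)
qed

lemma uminus_closed: "x \<in> carr X \<Longrightarrow> - x \<in> carr X"
  using scalar_closed csc_neg by metis

lemma diff_closed: "x \<in> carr X \<Longrightarrow> y \<in> carr X \<Longrightarrow> x - y \<in> carr X"
  using add_closed[of x "- y"] uminus_closed by simp

lemma ip_zero_right: "x \<in> carr X \<Longrightarrow> ip X x 0 = 0"
  using ip_add_right[of x 0 0] zero_closed by simp

lemma ip_zero_left: "x \<in> carr X \<Longrightarrow> ip X 0 x = 0"
  using ip_adj[of x 0] zero_closed by (simp add: ip_zero_right diag_adj_def fun_eq_iff)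

lemma ip_cnj: "x \<in> carr X \<Longrightarrow> y \<in> carr X \<Longrightarrow> ip X y x j = cnj (ip X x y j)"
  using ip_adj[of x y] by (simp add: diag_adj_def)

lemma ip_csc_right: assumes "x \<in> carr X" "y \<in> carr X"
  shows "ip X x (csc n X c y) j = c * ip X x y j"
proof -
  have "ip X x (csc n X c y) = ip X x y * diag_scalar n c"
    unfolding csc_def by (rule ip_rmul_right[OF assms diag_scalar_closed])
  thus ?thesis using ip_closed[OF assms] by (auto simp: diag_scalar_def diag_alg_def)
qed

lemma ip_csc_left: assumes "x \<in> carr X" "y \<in> carr X"
  shows "ip X (csc n X c y) x j = cnj c * ip X y x j"
  using assms ip_cnj[of x "csc n X c y"] ip_cnj[of x y] by (simp add: ip_csc_right scalar_closed)

lemma ip_rmul_left: assumes "x \<in> carr X" "y \<in> carr X" "a \<in> diag_alg n"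
  shows "ip X (rmul X x a) y = diag_adj a * ip X x y"
  using assms ip_adj[of y "rmul X x a"] ip_adj[of y x]
  by (simp add: rmul_closed ip_rmul_right diag_adj_def fun_eq_iff)

lemma ip_add_left: "x \<in> carr X \<Longrightarrow> y \<in> carr X \<Longrightarrow> z \<in> carr X \<Longrightarrow> ip X (x + y) z = ip X x z + ip X y z"
  using ip_adj[of z "x + y"] ip_adj[of z x] ip_adj[of z y]
  by (simp add: add_closed ip_add_right diag_adj_def fun_eq_iff)

lemma ip_uminus_right: "x \<in> carr X \<Longrightarrow> y \<in> carr X \<Longrightarrow> ip X x (- y) = - ip X x y"
  using ip_csc_right[of x y "-1"] by (simp add: csc_neg fun_eq_iff)

lemma ip_uminus_left: "x \<in> carr X \<Longrightarrow> y \<in> carr X \<Longrightarrow> ip X (- y) x = - ip X y x"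
  using ip_csc_left[of x y "-1"] by (simp add: csc_neg fun_eq_iff)

lemma ip_diff_right: "x \<in> carr X \<Longrightarrow> y \<in> carr X \<Longrightarrow> z \<in> carr X \<Longrightarrow> ip X x (y - z) = ip X x y - ip X x z"
  using ip_add_right[of x y "- z"] by (simp add: uminus_closed ip_uminus_right)

lemma ip_diff_left: "x \<in> carr X \<Longrightarrow> y \<in> carr X \<Longrightarrow> z \<in> carr X \<Longrightarrow> ip X (y - z) x = ip X y x - ip X z x"
  using ip_add_left[of y "- z" x] by (simp add: uminus_closed ip_uminus_left)

lemma ip_self: "x \<in> carr X \<Longrightarrow> ip X x x j = of_real (Re (ip X x x j))"
  using ip_cnj[of x x j] by (simp add: complex_eq_iff)

text \<open>Each diagonal entry of the inner product is a positive semidefinite form, so the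
  classical argument applies for fixed \<open>j\<close>. The form may be degenerate, hence the case
  \<open>B = 0\<close>.\<close>

lemma Cauchy_Schwarz: assumes x: "x \<in> carr X" and y: "y \<in> carr X"
  shows "(cmod (ip X x y j))\<^sup>2 \<le> Re (ip X x x j) * Re (ip X y y j)"
proof -
  define z A B where "z = ip X x y j" and "A = Re (ip X x x j)" and "B = Re (ip X y y j)"
  have pos: "0 \<le> A - 2 * t * (cmod z)\<^sup>2 + t\<^sup>2 * (cmod z)\<^sup>2 * B" for t :: real
  proof -
    \<comment> \<open>The factor \<open>cnj z\<close> makes the two cross terms real and equal,
      which leaves a real quadratic in \<open>t\<close>.\<close>
    define c where "c = - (of_real t * cnj z)"
    have yc: "csc n X c y \<in> carr X" by (rule scalar_closed[OF y])
    have "ip X (x + csc n X c y) (x + csc n X c y) j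
        = ip X x x j + c * z + cnj c * cnj z + cnj c * c * ip X y y j"
      using x y yc
      by (simp add: add_closed ip_add_left ip_add_right ip_csc_left ip_csc_right z_def algebra_simps
          ip_cnj[of x y])
    moreover have "c * z = - of_real (t * (cmod z)\<^sup>2)" "cnj c * cnj z = - of_real (t * (cmod z)\<^sup>2)"
      unfolding c_def using complex_norm_square[of z] by (simp_all add: mult_ac)
    moreover have "cnj c * c = of_real (t\<^sup>2 * (cmod z)\<^sup>2)"
      unfolding c_def using complex_norm_square[of z] by (simp add: mult_ac power2_eq_square)
    ultimately have "Re (ip X (x + csc n X c y) (x + csc n X c y) j) = A - 2 * t * (cmod z)\<^sup>2 + t\<^sup>2 * (cmod z)\<^sup>2 * B"
      unfolding A_def B_def by simp
    thus ?thesis using ip_pos[OF add_closed[OF x yc], of j] by simp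
  qed
  have A: "0 \<le> A" and B: "0 \<le> B" unfolding A_def B_def by (simp_all add: ip_pos x y)
  have "(cmod z)\<^sup>2 \<le> A * B"
  proof (cases "B = 0")
    case True
    have "z = 0"
    proof (rule ccontr)
      assume "z \<noteq> 0"
      hence "0 < (cmod z)\<^sup>2" by simp
      hence "A - 2 * ((A + 1) / (cmod z)\<^sup>2) * (cmod z)\<^sup>2 = A - 2 * (A + 1)" by simp
      \<comment> \<open>For \<open>B = 0\<close> the quadratic is linear in \<open>t\<close>, and
        this \<open>t\<close> gives it the value \<open>- A - 2\<close>.\<close>
      thus False using pos[of "(A + 1) / (cmod z)\<^sup>2"] True A by simp
    qed
    thus ?thesis using True by simp
  next
    case False
    hence "0 < B" using B by simp
    \<comment> \<open>\<open>1/B\<close> is the minimizer of the quadratic.\<close>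
    hence "A - 2 * (1/B) * (cmod z)\<^sup>2 + (1/B)\<^sup>2 * (cmod z)\<^sup>2 * B = A - (cmod z)\<^sup>2 / B"
      by (simp add: field_simps power2_eq_square)
    hence "(cmod z)\<^sup>2 / B \<le> A" using pos[of "1/B"] by simp
    thus ?thesis using \<open>0 < B\<close> by (simp add: field_simps)
  qed
  thus ?thesis unfolding z_def A_def B_def .
qed

text \<open>Positivity of \<open>n\<close> enters because \<open>diag_norm\<close> is a maximum over
  \<open>{..<n}\<close>, whose value is unspecified for an empty index set.\<close>

lemma mnorm_nonneg: "0 \<le> mnorm n X x"
proof -
  have "0 \<le> cmod (ip X x x 0)" by simp
  also have "\<dots> \<le> diag_norm n (ip X x x)"
    unfolding diag_norm_def using n_pos by (intro Max_ge) auto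
  finally show ?thesis by (simp add: mnorm_def)
qed

lemma ip_le_mnorm: assumes "x \<in> carr X" shows "Re (ip X x x j) \<le> (mnorm n X x)\<^sup>2"
proof (cases "j < n")
  case True
  have "cmod (ip X x x j) \<le> diag_norm n (ip X x x)"
    unfolding diag_norm_def using True by (intro Max_ge) auto
  moreover from this have "0 \<le> diag_norm n (ip X x x)" by (rule order_trans[OF norm_ge_zero])
  ultimately have "cmod (ip X x x j) \<le> (mnorm n X x)\<^sup>2" unfolding mnorm_def by simp
  thus ?thesis using complex_Re_le_cmod order_trans by blast
next
  case False
  thus ?thesis using ip_closed[OF assms assms] by (simp add: diag_alg_def)
qed

lemma mnorm_leI: assumes x: "x \<in> carr X" and "0 \<le> e" "\<And>j. j < n \<Longrightarrow> Re (ip X x x j) \<le> e\<^sup>2"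
  shows "mnorm n X x \<le> e"
proof -
  have "cmod (ip X x x j) = Re (ip X x x j)" for j
    by (subst ip_self[OF x]) (simp add: ip_pos[OF x])
  hence "diag_norm n (ip X x x) \<le> e\<^sup>2"
    unfolding diag_norm_def using n_pos assms(3) by (subst Max_le_iff) auto
  hence "mnorm n X x \<le> sqrt (e\<^sup>2)" unfolding mnorm_def by (rule real_sqrt_le_mono)
  thus ?thesis using assms(2) by simp
qed

text \<open>A maximum over finitely many entries is a scalar quantity at a single index; this turns
  lower bounds for norms into scalar estimates.\<close>

lemma mnorm_attained: assumes x: "x \<in> carr X"
  shows "\<exists>j<n. cmod (ip X x x j) = (mnorm n X x)\<^sup>2"
proof -
  have "diag_norm n (ip X x x) \<in> (\<lambda>i. cmod (ip X x x i)) ` {..<n}"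
    unfolding diag_norm_def using n_pos by (intro Max_in) auto
  then obtain j where "j < n" and j: "diag_norm n (ip X x x) = cmod (ip X x x j)" by auto
  thus ?thesis unfolding mnorm_def by auto
qed

lemma ip_bound: assumes "x \<in> carr X" "y \<in> carr X"
  shows "cmod (ip X x y j) \<le> mnorm n X x * mnorm n X y"
proof -
  have "(cmod (ip X x y j))\<^sup>2 \<le> Re (ip X x x j) * Re (ip X y y j)" by (rule Cauchy_Schwarz[OF assms])
  also have "\<dots> \<le> (mnorm n X x)\<^sup>2 * (mnorm n X y)\<^sup>2"
    by (intro mult_mono ip_le_mnorm ip_pos assms) simp
  finally have "(cmod (ip X x y j))\<^sup>2 \<le> (mnorm n X x * mnorm n X y)\<^sup>2"
    by (simp add: power_mult_distrib)
  thus ?thesis by (rule power2_le_imp_le) (simp add: mnorm_nonneg)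
qed

lemma mnorm_csc: assumes x: "x \<in> carr X" shows "mnorm n X (csc n X c x) = cmod c * mnorm n X x"
proof -
  have "cmod (ip X (csc n X c x) (csc n X c x) j) = (cmod c)\<^sup>2 * cmod (ip X x x j)" for j
    using x by (simp add: ip_csc_left ip_csc_right scalar_closed norm_mult power2_eq_square)
  hence "diag_norm n (ip X (csc n X c x) (csc n X c x)) = (cmod c)\<^sup>2 * diag_norm n (ip X x x)"
    unfolding diag_norm_def using n_pos
    by (subst mono_Max_commute[of "\<lambda>t. (cmod c)\<^sup>2 * t"])
       (auto simp: image_image mono_def mult_left_mono)
  thus ?thesis unfolding mnorm_def by (simp add: real_sqrt_mult)
qed

lemma mnorm_uminus: "x \<in> carr X \<Longrightarrow> mnorm n X (- x) = mnorm n X x"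
  using mnorm_csc[of x "-1"] by (simp add: csc_neg)

lemma mnorm_minus_commute: "x \<in> carr X \<Longrightarrow> y \<in> carr X \<Longrightarrow> mnorm n X (x - y) = mnorm n X (y - x)"
  using mnorm_uminus[of "y - x"] by (simp add: diff_closed)

lemma mnorm_zero: "mnorm n X 0 = 0"
  using mnorm_csc[OF zero_closed, of 0] rmul_zero[OF zero_closed]
  by (simp add: csc_def diag_scalar_def zero_fun_def cong: if_cong)

lemma mnorm_triangle: assumes x: "x \<in> carr X" and y: "y \<in> carr X"
  shows "mnorm n X (x + y) \<le> mnorm n X x + mnorm n X y"
proof (rule mnorm_leI[OF add_closed[OF x y]])
  fix j
  have "Re (ip X x y j) \<le> mnorm n X x * mnorm n X y" "Re (ip X y x j) \<le> mnorm n X y * mnorm n X x"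
    using ip_bound[OF x y] ip_bound[OF y x] complex_Re_le_cmod order_trans by blast+
  thus "Re (ip X (x + y) (x + y) j) \<le> (mnorm n X x + mnorm n X y)\<^sup>2"
    using ip_le_mnorm[OF x, of j] ip_le_mnorm[OF y, of j]
    by (simp add: ip_add_left ip_add_right add_closed x y power2_sum algebra_simps)
qed (simp add: mnorm_nonneg)

lemma mnorm_triangle_diff: assumes "x \<in> carr X" "y \<in> carr X" "z \<in> carr X"
  shows "mnorm n X (x - z) \<le> mnorm n X (x - y) + mnorm n X (y - z)"
  using mnorm_triangle[of "x - y" "y - z"] assms by (simp add: diff_closed)

lemma mnorm_eq_0: assumes x: "x \<in> carr X" and "mnorm n X x = 0" shows "x = 0"
proof (rule ip_definite[OF x])
  have "ip X x x j = 0" for j using ip_bound[OF x x, of j] assms(2) by simp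
  thus "ip X x x = 0" by (simp add: fun_eq_iff)
qed

lemma mnorm_pos: "x \<in> carr X \<Longrightarrow> x \<noteq> 0 \<Longrightarrow> 0 < mnorm n X x"
  using mnorm_eq_0 mnorm_nonneg[of x] by fastforce

lemma eqI_ip: assumes "x \<in> carr X" "y \<in> carr X" "\<And>z. z \<in> carr X \<Longrightarrow> ip X z x = ip X z y"
  shows "x = y"
  using ip_definite[of "x - y"] assms by (simp add: diff_closed ip_diff_right)

section \<open>Continuity of the inner product and total sets\<close>

lemma mconv_ip_right:
  assumes s: "\<And>k. s k \<in> carr X" and x: "x \<in> carr X" and y: "y \<in> carr X" and lim: "mconv n X s x"
  shows "(\<lambda>k. ip X y (s k) j) \<longlonglongrightarrow> ip X y x j"
proof -
  have *: "(\<lambda>k. mnorm n X y * mnorm n X (s k - x)) \<longlonglongrightarrow> 0"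
    using tendsto_mult_right_zero[OF lim[unfolded mconv_def]] .
  have "(\<lambda>k. ip X y (s k) j - ip X y x j) \<longlonglongrightarrow> 0"
  proof (rule Lim_null_comparison[OF _ *])
    show "\<forall>\<^sub>F k in sequentially. cmod (ip X y (s k) j - ip X y x j) \<le> mnorm n X y * mnorm n X (s k - x)"
      using ip_bound[OF y diff_closed[OF s x]] by (auto simp: ip_diff_right s x y intro: always_eventually)
  qed
  thus ?thesis by (simp add: LIM_zero_iff)
qed

lemma mconv_ip_left:
  assumes s: "\<And>k. s k \<in> carr X" and x: "x \<in> carr X" and y: "y \<in> carr X" and lim: "mconv n X s x"
  shows "(\<lambda>k. ip X (s k) y j) \<longlonglongrightarrow> ip X x y j"
  using tendsto_cnj[OF mconv_ip_right[OF assms, of j]] unfolding ip_cnj[OF y s] ip_cnj[OF y x] .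

lemma closed_submodule_orth:
  assumes x: "x \<in> carr X" shows "closed_submodule n X {y \<in> carr X. ip X x y = 0}"
proof -
  have "ip X x y = 0" if "\<And>k. s k \<in> carr X \<and> ip X x (s k) = 0" "y \<in> carr X" "mconv n X s y" for s y
  proof
    fix j
    have "(\<lambda>k. ip X x (s k) j) \<longlonglongrightarrow> ip X x y j"
      by (rule mconv_ip_right) (use that x in auto)
    thus "ip X x y j = 0 j" using that(1) by (simp add: LIMSEQ_const_iff)
  qed
  thus ?thesis unfolding closed_submodule_def
    by (auto simp: zero_closed add_closed rmul_closed ip_zero_right ip_add_right ip_rmul_right x)
qed

text \<open>Totality in its weak form: the orthogonal complement of \<open>x\<close> is a closed
  submodule, so it contains the hull of \<open>S\<close>, and \<open>x\<close> is orthogonal to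
  itself. Identities can then be tested on generators.\<close>

lemma orth_hull:
  assumes x: "x \<in> carr X" and S: "closed_submodule n X hull S = carr X" "S \<subseteq> carr X"
    and "\<And>s. s \<in> S \<Longrightarrow> ip X x s = 0"
  shows "x = 0"
proof -
  have "closed_submodule n X hull S \<subseteq> {y \<in> carr X. ip X x y = 0}"
    by (rule hull_minimal) (use assms closed_submodule_orth in auto)
  thus ?thesis using ip_definite x S(1) by blast
qed

lemma eq_hull:
  assumes "x \<in> carr X" "y \<in> carr X" and S: "closed_submodule n X hull S = carr X" "S \<subseteq> carr X"
    and "\<And>s. s \<in> S \<Longrightarrow> ip X x s = ip X y s"
  shows "x = y"
proof -
  have "x - y = 0"
    by (rule orth_hull[OF _ S]) (use assms in \<open>auto simp: diff_closed ip_diff_left subset_iff\<close>)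
  thus ?thesis by simp
qed

section \<open>Adjointable operators: linearity, operations and boundedness\<close>

lemma adjointable_closed: "T \<in> adjointable X \<Longrightarrow> x \<in> carr X \<Longrightarrow> T x \<in> carr X"
  by (simp add: adjointable_def)

lemma adjointable_closed': "T \<in> adjointable X \<Longrightarrow> T x \<in> carr X"
  by (cases "x \<in> carr X") (auto simp: adjointable_def zero_closed)

lemma adjointable_off: "T \<in> adjointable X \<Longrightarrow> x \<notin> carr X \<Longrightarrow> T x = 0"
  by (simp add: adjointable_def)

lemma adjointableI:
  assumes "\<And>x. x \<in> carr X \<Longrightarrow> T x \<in> carr X" "\<And>x. x \<notin> carr X \<Longrightarrow> T x = 0"
    "\<And>x. x \<in> carr X \<Longrightarrow> S x \<in> carr X"
    "\<And>x y. x \<in> carr X \<Longrightarrow> y \<in> carr X \<Longrightarrow> ip X (S x) y = ip X x (T y)"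
  shows "T \<in> adjointable X"
  using assms unfolding adjointable_def by blast

lemma adjoint_obtain:
  assumes "T \<in> adjointable X"
  obtains S where "\<And>x. x \<in> carr X \<Longrightarrow> S x \<in> carr X"
    "\<And>x y. x \<in> carr X \<Longrightarrow> y \<in> carr X \<Longrightarrow> ip X (S x) y = ip X x (T y)"
  using assms unfolding adjointable_def by blast

text \<open>Linearity is not part of \<open>adjointable\<close>; the adjoint forces it, since
  \<open>ip X x (T y) = ip X (S x) y\<close> is additive in \<open>y\<close> for every
  \<open>x\<close>.\<close>

lemma adjointable_add: assumes "T \<in> adjointable X" "x \<in> carr X" "y \<in> carr X"
  shows "T (x + y) = T x + T y"
proof -
  obtain S where S: "\<And>x. x \<in> carr X \<Longrightarrow> S x \<in> carr X"
    "\<And>x y. x \<in> carr X \<Longrightarrow> y \<in> carr X \<Longrightarrow> ip X (S x) y = ip X x (T y)"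
    by (rule adjoint_obtain[OF assms(1)]) blast
  show ?thesis
    by (rule eqI_ip) (auto simp: assms adjointable_closed add_closed ip_add_right S(1) simp flip: S(2))
qed

lemma adjointable_rmul: assumes "T \<in> adjointable X" "x \<in> carr X" "a \<in> diag_alg n"
  shows "T (rmul X x a) = rmul X (T x) a"
proof -
  obtain S where S: "\<And>x. x \<in> carr X \<Longrightarrow> S x \<in> carr X"
    "\<And>x y. x \<in> carr X \<Longrightarrow> y \<in> carr X \<Longrightarrow> ip X (S x) y = ip X x (T y)"
    by (rule adjoint_obtain[OF assms(1)]) blast
  show ?thesis
    by (rule eqI_ip) (auto simp: assms adjointable_closed rmul_closed ip_rmul_right S(1) simp flip: S(2))
qed

lemma adjointable_csc: "T \<in> adjointable X \<Longrightarrow> x \<in> carr X \<Longrightarrow> T (csc n X c x) = csc n X c (T x)"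
  unfolding csc_def by (rule adjointable_rmul[OF _ _ diag_scalar_closed])

lemma adjointable_zero: "T \<in> adjointable X \<Longrightarrow> T 0 = 0"
  using adjointable_add[of T 0 0] zero_closed by simp

lemma adjointable_uminus: "T \<in> adjointable X \<Longrightarrow> x \<in> carr X \<Longrightarrow> T (- x) = - T x"
  using adjointable_csc[of T x "-1"] by (simp add: csc_neg adjointable_closed)

lemma adjointable_diff: "T \<in> adjointable X \<Longrightarrow> x \<in> carr X \<Longrightarrow> y \<in> carr X \<Longrightarrow> T (x - y) = T x - T y"
  using adjointable_add[of T x "- y"] by (simp add: uminus_closed adjointable_uminus)

lemma zero_adjointable: "0 \<in> adjointable X"
  by (rule adjointableI[where S="\<lambda>_. 0"]) (auto simp: zero_closed ip_zero_left ip_zero_right)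

lemma plus_adjointable: assumes S: "S \<in> adjointable X" and T: "T \<in> adjointable X"
  shows "S + T \<in> adjointable X"
proof -
  obtain S' where S': "\<And>x. x \<in> carr X \<Longrightarrow> S' x \<in> carr X"
    "\<And>x y. x \<in> carr X \<Longrightarrow> y \<in> carr X \<Longrightarrow> ip X (S' x) y = ip X x (S y)"
    by (rule adjoint_obtain[OF S]) blast
  obtain T' where T': "\<And>x. x \<in> carr X \<Longrightarrow> T' x \<in> carr X"
    "\<And>x y. x \<in> carr X \<Longrightarrow> y \<in> carr X \<Longrightarrow> ip X (T' x) y = ip X x (T y)"
    by (rule adjoint_obtain[OF T]) blast
  show ?thesis
    by (rule adjointableI[where S="\<lambda>x. S' x + T' x"])
       (auto simp: S' T' S T adjointable_closed adjointable_off add_closed ip_add_left ip_add_right)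
qed

lemma comp_adjointable: assumes S: "S \<in> adjointable X" and T: "T \<in> adjointable X"
  shows "S \<circ> T \<in> adjointable X"
proof -
  obtain S' where S': "\<And>x. x \<in> carr X \<Longrightarrow> S' x \<in> carr X"
    "\<And>x y. x \<in> carr X \<Longrightarrow> y \<in> carr X \<Longrightarrow> ip X (S' x) y = ip X x (S y)"
    by (rule adjoint_obtain[OF S]) blast
  obtain T' where T': "\<And>x. x \<in> carr X \<Longrightarrow> T' x \<in> carr X"
    "\<And>x y. x \<in> carr X \<Longrightarrow> y \<in> carr X \<Longrightarrow> ip X (T' x) y = ip X x (T y)"
    by (rule adjoint_obtain[OF T]) blast
  show ?thesis
    by (rule adjointableI[where S="T' \<circ> S'"])
       (auto simp: S' T' S T adjointable_closed adjointable_off adjointable_zero)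
qed

lemma scale_adjointable: assumes T: "T \<in> adjointable X" shows "op_scale n X c T \<in> adjointable X"
proof -
  obtain T' where T': "\<And>x. x \<in> carr X \<Longrightarrow> T' x \<in> carr X"
    "\<And>x y. x \<in> carr X \<Longrightarrow> y \<in> carr X \<Longrightarrow> ip X (T' x) y = ip X x (T y)"
    by (rule adjoint_obtain[OF T]) blast
  have "csc n X c 0 = 0"
    using mnorm_csc[OF zero_closed, of c] by (simp add: mnorm_zero mnorm_eq_0 scalar_closed zero_closed)
  thus ?thesis
    by (intro adjointableI[where S="\<lambda>x. csc n X (cnj c) (T' x)"])
       (auto simp: op_scale_def T' T adjointable_closed adjointable_off scalar_closed ip_csc_left ip_csc_right fun_eq_iff)
qed

lemma minus_eq_scale: assumes S: "S \<in> adjointable X" and T: "T \<in> adjointable X"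
  shows "S - T = S + op_scale n X (-1) T"
  by (auto simp: fun_eq_iff op_scale_def csc_neg adjointable_closed'[OF T])

lemma minus_adjointable: "S \<in> adjointable X \<Longrightarrow> T \<in> adjointable X \<Longrightarrow> S - T \<in> adjointable X"
  by (simp add: minus_eq_scale plus_adjointable scale_adjointable)

text \<open>For \<open>y\<close> in the unit ball, \<open>x + r y\<close> lies in the ball of radius
  \<open>r\<close> around \<open>x\<close>, and \<open>T (r y) = T (x + r y) - T x\<close>. The
  threshold \<open>(M + mnorm n X (T x)) / r\<close> makes up for the scaling and for the loss of
  \<open>T x\<close>.\<close>

lemma unbounded_near:
  assumes T: "T \<in> adjointable X" and unbdd: "\<And>M. \<exists>y\<in>carr X. mnorm n X y \<le> 1 \<and> M < mnorm n X (T y)"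
    and x: "x \<in> carr X" and r: "0 < r"
  shows "\<exists>x'\<in>carr X. mnorm n X (x' - x) \<le> r \<and> M < mnorm n X (T x')"
proof -
  obtain y where y: "y \<in> carr X" "mnorm n X y \<le> 1" and yM: "(M + mnorm n X (T x)) / r < mnorm n X (T y)"
    using unbdd by blast
  let ?y = "csc n X (of_real r) y"
  have c: "?y \<in> carr X" "x + ?y \<in> carr X" "T (x + ?y) \<in> carr X" "T x \<in> carr X"
    using x y T by (auto intro: add_closed scalar_closed adjointable_closed)
  have "mnorm n X ?y \<le> r"
    using y r by (simp add: mnorm_csc)
  moreover have "T ?y = T (x + ?y) + (- T x)"
    using T x c by (simp add: adjointable_add)
  hence "mnorm n X (T ?y) \<le> mnorm n X (T (x + ?y)) + mnorm n X (T x)"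
    using mnorm_triangle[OF c(3) uminus_closed[OF c(4)]] c by (simp add: mnorm_uminus)
  moreover have "mnorm n X (T ?y) = r * mnorm n X (T y)"
    using T y r by (simp add: adjointable_csc mnorm_csc adjointable_closed)
  moreover have "M + mnorm n X (T x) < r * mnorm n X (T y)"
    using yM r by (simp add: field_simps)
  ultimately show ?thesis
    using c by (intro bexI[of _ "x + ?y"]) auto
qed

text \<open>The norm of \<open>T y\<close> is bounded below by pairing with \<open>z = T x\<close>.
  The pairing \<open>ip X z (T y) = ip X (S z) y\<close> is continuous in \<open>y\<close> by
  Cauchy-Schwarz, even before \<open>T\<close> is known to be bounded.\<close>

lemma adjointable_lower_semicontinuous:
  assumes T: "T \<in> adjointable X" and x: "x \<in> carr X" and M: "0 \<le> M" "M < mnorm n X (T x)"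
  shows "\<exists>r>0. \<forall>y\<in>carr X. mnorm n X (y - x) \<le> r \<longrightarrow> M < mnorm n X (T y)"
proof -
  obtain S where S: "\<And>x. x \<in> carr X \<Longrightarrow> S x \<in> carr X"
    "\<And>x y. x \<in> carr X \<Longrightarrow> y \<in> carr X \<Longrightarrow> ip X (S x) y = ip X x (T y)"
    by (rule adjoint_obtain[OF T]) blast
  define z N where "z = T x" and "N = mnorm n X z"
  have z: "z \<in> carr X" unfolding z_def by (rule adjointable_closed[OF T x])
  obtain j where j: "cmod (ip X z z j) = N\<^sup>2"
    using mnorm_attained[OF z] unfolding N_def by blast
  \<comment> \<open>The summand 1 keeps \<open>c\<close> positive when
    \<open>S z = 0\<close>.\<close>
  define c where "c = mnorm n X (S z) + 1"
  have c: "0 < c" unfolding c_def using mnorm_nonneg[of "S z"] by simp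
  have N: "M < N" "0 < N" using M unfolding N_def z_def by auto
  \<comment> \<open>With this radius the pairing changes by at most \<open>N * (N - M) / 2\<close>,
    which leaves \<open>N * (N + M) / 2\<close>, more than \<open>N * M\<close>.\<close>
  define r where "r = N * (N - M) / (2 * c)"
  have r: "0 < r" unfolding r_def using c N by simp
  have "M < mnorm n X (T y)" if y: "y \<in> carr X" and yr: "mnorm n X (y - x) \<le> r" for y
  proof -
    have "cmod (ip X (S z) (y - x) j) \<le> mnorm n X (S z) * mnorm n X (y - x)"
      by (intro ip_bound S diff_closed z x y)
    also have "\<dots> \<le> c * r"
      unfolding c_def using yr mnorm_nonneg[of "y - x"] mnorm_nonneg[of "S z"] by (intro mult_mono) auto
    also have "\<dots> = N * (N - M) / 2" unfolding r_def using c by simp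
    finally have "cmod (ip X (S z) (y - x) j) \<le> N * (N - M) / 2" .
    moreover have "ip X (S z) (y - x) j = ip X z (T y) j - ip X z z j"
      using S(2)[OF z diff_closed[OF y x]] T x y z
      by (simp add: adjointable_diff ip_diff_right adjointable_closed z_def)
    moreover have "N\<^sup>2 \<le> cmod (ip X z (T y) j) + cmod (ip X z (T y) j - ip X z z j)"
      using norm_triangle_sub[of "ip X z z j" "ip X z (T y) j"] j by (simp add: norm_minus_commute)
    moreover have "cmod (ip X z (T y) j) \<le> N * mnorm n X (T y)"
      unfolding N_def by (intro ip_bound z adjointable_closed[OF T y])
    ultimately have "N\<^sup>2 - N * (N - M) / 2 \<le> N * mnorm n X (T y)" by simp
    moreover have "N * M < N\<^sup>2 - N * (N - M) / 2"
      using N by (simp add: field_simps power2_eq_square)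
    ultimately have "N * M < N * mnorm n X (T y)" by linarith
    thus ?thesis using N by simp
  qed
  thus ?thesis using r by blast
qed

text \<open>
  A nested balls argument. Without it, the supremum in \<^const>\<open>op_norm\<close> could be that of an unbounded
  set, i.e. a junk value.
\<close>

lemma adjointable_bounded:
  assumes T: "T \<in> adjointable X"
  shows "\<exists>M. \<forall>x\<in>carr X. mnorm n X x \<le> 1 \<longrightarrow> mnorm n X (T x) \<le> M"
proof (rule ccontr)
  assume "\<not> ?thesis"
  hence unbdd: "\<exists>y\<in>carr X. mnorm n X y \<le> 1 \<and> M < mnorm n X (T y)" for M
    by (metis not_le)
  \<comment> \<open>\<open>p\<close> is a closed ball, given by centre and radius, on which
    \<open>T\<close> exceeds \<open>k\<close>. \<open>Q\<close> moves the centre by at most half the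
    old radius and at least halves the radius, so that the balls are nested.\<close>
  define P where "P k p \<longleftrightarrow> fst p \<in> carr X \<and> 0 < snd p
     \<and> (\<forall>y\<in>carr X. mnorm n X (y - fst p) \<le> snd p \<longrightarrow> real k < mnorm n X (T y))" for k p
  define Q where "Q p q \<longleftrightarrow> mnorm n X (fst q - fst p) \<le> snd p / 2 \<and> snd q \<le> snd p / 2" for p q
  have step: "\<exists>q. P k q \<and> Q p q" if p: "fst p \<in> carr X" "0 < snd p" for p k
  proof -
    obtain x' where x': "x' \<in> carr X" "mnorm n X (x' - fst p) \<le> snd p / 2" "real k < mnorm n X (T x')"
      using unbounded_near[OF T unbdd p(1), of "snd p / 2"] p(2) by auto
    obtain r where r: "0 < r" "\<forall>y\<in>carr X. mnorm n X (y - x') \<le> r \<longrightarrow> real k < mnorm n X (T y)"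
      using adjointable_lower_semicontinuous[OF T x'(1) _ x'(3)] by auto
    show ?thesis
      by (rule exI[of _ "(x', min r (snd p / 2))"]) (use x' r p in \<open>auto simp: P_def Q_def\<close>)
  qed
  have "\<exists>f. \<forall>k. P k (f k) \<and> Q (f k) (f (Suc k))"
  proof (rule dependent_nat_choice)
    show "\<exists>p. P 0 p" using step[of "(0, 1)" 0] zero_closed by auto
  next
    fix p k assume "P k p"
    thus "\<exists>q. P (Suc k) q \<and> Q p q" using step[of p "Suc k"] by (simp add: P_def)
  qed
  then obtain f where f: "\<And>k. P k (f k)" "\<And>k. Q (f k) (f (Suc k))" by blast
  define s r where "s k = fst (f k)" and "r k = snd (f k)" for k
  have s: "s k \<in> carr X" and r: "0 < r k"
    and large: "y \<in> carr X \<Longrightarrow> mnorm n X (y - s k) \<le> r k \<Longrightarrow> real k < mnorm n X (T y)"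
    and s_step: "mnorm n X (s (Suc k) - s k) \<le> r k / 2" and r_step: "r (Suc k) \<le> r k / 2" for k y
    using f[of k] by (auto simp: P_def Q_def s_def r_def)
  \<comment> \<open>A move of at most \<open>r k / 2\<close> is at most
    \<open>r k - r (Suc k)\<close>, so the estimates telescope and all later centres stay in ball
    \<open>k\<close>.\<close>
  have dist: "mnorm n X (s (k + l) - s k) \<le> r k - r (k + l)" for k l
  proof (induction l)
    case 0
    show ?case by (simp add: mnorm_zero)
  next
    case (Suc l)
    have "mnorm n X (s (k + Suc l) - s k) \<le> r (k + l) / 2 + (r k - r (k + l))"
      using mnorm_triangle_diff[OF s[of "k + Suc l"] s[of "k + l"] s[of k]] s_step[of "k + l"] Suc by simp
    thus ?case using r_step[of "k + l"] by simp
  qed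
  have dist': "mnorm n X (s l - s k) \<le> r k" if "k \<le> l" for k l
    using dist[of k "l - k"] r[of l] \<open>k \<le> l\<close> by simp
  have "r k \<le> r 0 / 2 ^ k" for k
  proof (induction k)
    case (Suc k)
    have "r (Suc k) \<le> r k / 2" by (rule r_step)
    also have "\<dots> \<le> (r 0 / 2 ^ k) / 2" using Suc by (rule divide_right_mono) simp
    finally show ?case by simp
  qed simp
  moreover have "(\<lambda>k. r 0 / 2 ^ k) \<longlonglongrightarrow> 0"
    using LIMSEQ_divide_realpow_zero[of 2 "r 0"] by simp
  ultimately have r0: "r \<longlonglongrightarrow> 0"
    using r by (intro tendsto_sandwich[OF _ _ tendsto_const, of 0 r]) (auto intro: always_eventually less_imp_le)
  have "\<exists>x\<in>carr X. mconv n X s x"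
  proof (rule complete)
    fix e :: real assume "0 < e"
    then obtain N where N: "r N < e / 2"
      using order_tendstoD(2)[OF r0, of "e / 2"] by (auto simp: eventually_sequentially)
    have "mnorm n X (s k - s l) < e" if kl: "k \<ge> N" "l \<ge> N" for k l
      using mnorm_triangle_diff[OF s[of k] s[of N] s[of l]] dist'[OF kl(1)] dist'[OF kl(2)] N
        mnorm_minus_commute[OF s s, of N l] by simp
    thus "\<exists>N. \<forall>k\<ge>N. \<forall>l\<ge>N. mnorm n X (s k - s l) < e" by blast
  qed (rule s)
  then obtain x where x: "x \<in> carr X" and lim: "mconv n X s x" by blast
  have "mnorm n X (x - s k) \<le> r k" for k
  proof (rule LIMSEQ_le_const)
    have "(\<lambda>l. mnorm n X (s l - x) + r k) \<longlonglongrightarrow> 0 + r k"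
      by (intro tendsto_add tendsto_const lim[unfolded mconv_def])
    thus "(\<lambda>l. mnorm n X (s l - x) + r k) \<longlonglongrightarrow> r k" by simp
    show "\<exists>N. \<forall>l\<ge>N. mnorm n X (x - s k) \<le> mnorm n X (s l - x) + r k"
    proof (intro exI allI impI)
      fix l assume "k \<le> l"
      show "mnorm n X (x - s k) \<le> mnorm n X (s l - x) + r k"
        using mnorm_triangle_diff[OF x s[of l] s[of k]] dist'[OF \<open>k \<le> l\<close>] mnorm_minus_commute[OF x s, of l]
        by simp
    qed
  qed
  hence "real k < mnorm n X (T x)" for k using large[OF x] by blast
  thus False using reals_Archimedean2[of "mnorm n X (T x)"] less_asym by blast
qed

lemma op_norm_bound:
  assumes T: "T \<in> adjointable X" and x: "x \<in> carr X"
  shows "mnorm n X (T x) \<le> op_norm n X T * mnorm n X x"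
proof (cases "x = 0")
  case True
  thus ?thesis using adjointable_zero[OF T] by (simp add: mnorm_zero)
next
  case False
  let ?c = "complex_of_real (1 / mnorm n X x)"
  let ?A = "{mnorm n X (T x) | x. x \<in> carr X \<and> mnorm n X x \<le> 1}"
  have pos: "0 < mnorm n X x" by (rule mnorm_pos[OF x False])
  obtain M where "\<forall>x\<in>carr X. mnorm n X x \<le> 1 \<longrightarrow> mnorm n X (T x) \<le> M"
    using adjointable_bounded[OF T] by blast
  hence "bdd_above ?A" by (intro bdd_aboveI[of _ M]) auto
  moreover have "mnorm n X (csc n X ?c x) \<le> 1" using pos x by (simp add: mnorm_csc norm_divide)
  hence "mnorm n X (T (csc n X ?c x)) \<in> ?A" using scalar_closed[OF x] by blast
  ultimately have "mnorm n X (T (csc n X ?c x)) \<le> op_norm n X T"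
    unfolding op_norm_def by (rule cSup_upper[rotated])
  thus ?thesis
    using pos T x by (simp add: adjointable_csc mnorm_csc adjointable_closed norm_divide field_simps)
qed

end

section \<open>Coordinates on Fock spaces\<close>

text \<open>
  The graph of the isometry is generated as a closed submodule of the direct sum; this avoids formal
  linear combinations of the generators.
\<close>

inductive gram_graph :: "nat \<Rightarrow> ('x::ab_group_add, 'r) hmod_scheme \<Rightarrow> ('y::ab_group_add, 's) hmod_scheme \<Rightarrow>
    ('x \<times> 'y) set \<Rightarrow> 'x \<Rightarrow> 'y \<Rightarrow> bool"
  for n X Y G where
  gen: "(x, y) \<in> G \<Longrightarrow> gram_graph n X Y G x y"
| add: "gram_graph n X Y G x y \<Longrightarrow> gram_graph n X Y G x' y' \<Longrightarrow> gram_graph n X Y G (x + x') (y + y')"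
| rmul: "gram_graph n X Y G x y \<Longrightarrow> a \<in> diag_alg n \<Longrightarrow> gram_graph n X Y G (rmul X x a) (rmul Y y a)"
| lim: "(\<And>k. gram_graph n X Y G (s k) (t k)) \<Longrightarrow> x \<in> carr X \<Longrightarrow> y \<in> carr Y \<Longrightarrow>
    mconv n X s x \<Longrightarrow> mconv n Y t y \<Longrightarrow> gram_graph n X Y G x y"

text \<open>Two families of vectors with the same Gram matrix. Totality is asked of the family in
  \<open>X\<close> alone; the result is an isometry into \<open>Y\<close>.\<close>

locale gram_pair =
  X: pos_hilbert_module n X + Y: pos_hilbert_module n Y
  for n :: nat and X :: "('x::ab_group_add, 'r) hmod_scheme" and Y :: "('y::ab_group_add, 's) hmod_scheme" +
  fixes G :: "('x \<times> 'y) set"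
  assumes G_carr: "(x, y) \<in> G \<Longrightarrow> x \<in> carr X \<and> y \<in> carr Y"
    and G_ip: "(x, y) \<in> G \<Longrightarrow> (x', y') \<in> G \<Longrightarrow> ip X x x' = ip Y y y'"
    and G_nonempty: "G \<noteq> {}"
    and G_hull: "closed_submodule n X hull (fst ` G) = carr X"
begin

abbreviation "graph \<equiv> gram_graph n X Y G"

lemma graph_carr: "graph x y \<Longrightarrow> x \<in> carr X \<and> y \<in> carr Y"
  by (induction rule: gram_graph.induct)
     (auto simp: G_carr X.add_closed Y.add_closed X.rmul_closed Y.rmul_closed)

lemma graph_ip_gen: "graph x y \<Longrightarrow> (x', y') \<in> G \<Longrightarrow> ip X x' x = ip Y y' y"
proof (induction rule: gram_graph.induct)
  case (lim s t x y)
  have "ip X x' x j = ip Y y' y j" for j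
  proof (rule LIMSEQ_unique)
    show "(\<lambda>k. ip X x' (s k) j) \<longlonglongrightarrow> ip X x' x j"
      using lim graph_carr G_carr by (intro X.mconv_ip_right) auto
    have "(\<lambda>k. ip Y y' (t k) j) \<longlonglongrightarrow> ip Y y' y j"
      using lim graph_carr G_carr by (intro Y.mconv_ip_right) auto
    thus "(\<lambda>k. ip X x' (s k) j) \<longlonglongrightarrow> ip Y y' y j" using lim by simp
  qed
  thus ?case by blast
qed (use graph_carr G_carr in \<open>auto simp: G_ip X.ip_add_right Y.ip_add_right X.ip_rmul_right Y.ip_rmul_right\<close>)

lemma graph_ip: "graph x' y' \<Longrightarrow> graph x y \<Longrightarrow> ip X x' x = ip Y y' y"
proof (induction rule: gram_graph.induct)
  case (lim s t x' y')
  have "ip X x' x j = ip Y y' y j" for j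
  proof (rule LIMSEQ_unique)
    show "(\<lambda>k. ip X (s k) x j) \<longlonglongrightarrow> ip X x' x j"
      using lim graph_carr by (intro X.mconv_ip_left) auto
    have "(\<lambda>k. ip Y (t k) y j) \<longlonglongrightarrow> ip Y y' y j"
      using lim graph_carr by (intro Y.mconv_ip_left) auto
    thus "(\<lambda>k. ip X (s k) x j) \<longlonglongrightarrow> ip Y y' y j" using lim by simp
  qed
  thus ?case by blast
next
  case (gen x' y')
  thus ?case using graph_ip_gen by blast
qed (use graph_carr in \<open>auto simp: X.ip_add_left Y.ip_add_left X.ip_rmul_left Y.ip_rmul_left\<close>)

lemma graph_diff: assumes "graph x y" "graph x' y'" shows "graph (x - x') (y - y')"
proof -
  have "graph (rmul X x' (diag_scalar n (-1))) (rmul Y y' (diag_scalar n (-1)))"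
    by (intro gram_graph.rmul assms diag_scalar_closed)
  hence "graph (- x') (- y')"
    using X.csc_neg[of x'] Y.csc_neg[of y'] graph_carr[OF assms(2)] unfolding csc_def by simp
  thus ?thesis using gram_graph.add[OF assms(1)] by fastforce
qed

lemma graph_mnorm: "graph x y \<Longrightarrow> mnorm n X x = mnorm n Y y"
  unfolding mnorm_def by (simp add: graph_ip)

text \<open>Paired vectors have equal norms, so the images of a convergent sequence are Cauchy and
  completeness of \<open>Y\<close> supplies their limit. The domain of the graph is therefore a
  closed submodule, and it contains the generators.\<close>

lemma graph_domain: assumes "x \<in> carr X" shows "\<exists>y. graph x y"
proof -
  \<comment> \<open>A closed submodule must contain 0, which is obtained as the difference of a
    generator with itself.\<close>
  have "\<exists>x y. (x, y) \<in> G" using G_nonempty by auto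
  then obtain x0 y0 where "graph x0 y0" using gram_graph.gen by blast
  hence zero: "graph 0 0" using graph_diff[of x0 y0 x0 y0] by simp
  have lim: "\<exists>y. graph x y" if s: "\<forall>k. \<exists>y. graph (s k) y" and x: "x \<in> carr X" and sx: "mconv n X s x" for s x
  proof -
    obtain t where t: "\<And>k. graph (s k) (t k)" using s by metis
    have "\<exists>y\<in>carr Y. mconv n Y t y"
    proof (rule Y.complete)
      fix e :: real assume e: "0 < e"
      have "\<forall>\<^sub>F k in sequentially. mnorm n X (s k - x) < e / 2"
        using order_tendstoD(2)[OF sx[unfolded mconv_def], of "e / 2"] e by simp
      then obtain N where N: "\<And>k. k \<ge> N \<Longrightarrow> mnorm n X (s k - x) < e / 2"
        unfolding eventually_sequentially by blast
      have "mnorm n Y (t k - t l) < e" if kl: "k \<ge> N" "l \<ge> N" for k l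
      proof -
        have "mnorm n Y (t k - t l) = mnorm n X (s k - s l)"
          by (rule graph_mnorm[OF graph_diff[OF t t], symmetric])
        also have "\<dots> \<le> mnorm n X (s k - x) + mnorm n X (x - s l)"
          using t graph_carr x by (intro X.mnorm_triangle_diff) auto
        also have "mnorm n X (x - s l) = mnorm n X (s l - x)"
          using t graph_carr x by (intro X.mnorm_minus_commute) auto
        finally show ?thesis using N[OF kl(1)] N[OF kl(2)] by simp
      qed
      thus "\<exists>N. \<forall>k\<ge>N. \<forall>l\<ge>N. mnorm n Y (t k - t l) < e" by blast
    qed (use t graph_carr in auto)
    thus ?thesis using gram_graph.lim[of n X Y G s t x] t x sx by blast
  qed
  have "closed_submodule n X {x. \<exists>y. graph x y}"
    unfolding closed_submodule_def
    using graph_carr zero lim by (auto intro: gram_graph.add gram_graph.rmul)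
  hence "closed_submodule n X hull (fst ` G) \<subseteq> {x. \<exists>y. graph x y}"
    by (intro hull_minimal) (use gram_graph.gen in fastforce)
  thus ?thesis using assms G_hull by blast
qed

text \<open>The graph is single-valued: two images of one vector differ by a vector paired with 0,
  hence of norm 0. So a map chosen from the graph takes the prescribed values on the
  generators.\<close>

lemma isometry_exists:
  "\<exists>U. (\<forall>x\<in>carr X. U x \<in> carr Y) \<and> (\<forall>x\<in>carr X. \<forall>x'\<in>carr X. ip Y (U x) (U x') = ip X x x')
     \<and> (\<forall>(x, y)\<in>G. U x = y)"
proof -
  obtain U where U: "\<And>x. x \<in> carr X \<Longrightarrow> graph x (U x)" using graph_domain by metis
  have "U x = y" if "(x, y) \<in> G" for x y
  proof -
    have x: "graph x y" using that by (rule gram_graph.gen)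
    hence "graph 0 (U x - y)" using graph_diff[OF U x] graph_carr by fastforce
    hence "mnorm n Y (U x - y) = 0" "U x - y \<in> carr Y"
      using graph_mnorm X.mnorm_zero graph_carr by fastforce+
    thus ?thesis using Y.mnorm_eq_0 by fastforce
  qed
  moreover have "U x \<in> carr Y" if "x \<in> carr X" for x using U[OF that] graph_carr by blast
  moreover have "ip Y (U x) (U x') = ip X x x'" if "x \<in> carr X" "x' \<in> carr X" for x x'
    using graph_ip[OF U[OF that(1)] U[OF that(2)]] by simp
  ultimately show ?thesis by blast
qed

end

text \<open>\<open>U\<close> writes the vectors of an arbitrary Fock space as functions on paths,
  and \<open>V\<close> is its inverse. Linearity of \<open>U\<close> is a consequence, since
  \<open>U\<close> preserves inner products and is onto.\<close>

locale fock_coordinates = pos_hilbert_module n F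
  for n :: nat and C :: "nat \<Rightarrow> nat \<Rightarrow> enat"
    and F :: "(nat \<Rightarrow> nat \<Rightarrow> nat \<Rightarrow> complex, 'x::ab_group_add) fock"
    and U :: "'x \<Rightarrow> (nat \<times> nat) list \<Rightarrow> nat \<Rightarrow> complex" and V +
  assumes fock: "fock_space n (matrix_corr n C) F"
    and U_closed: "x \<in> carr F \<Longrightarrow> U x \<in> carr (path_fock n C)"
    and U_ip: "x \<in> carr F \<Longrightarrow> y \<in> carr F \<Longrightarrow> ip (path_fock n C) (U x) (U y) = ip F x y"
    and U_vac: "a \<in> diag_alg n \<Longrightarrow> U (vac F a) = path_vac a"
    and U_ten: "w \<in> words (matrix_corr n C) \<Longrightarrow> U (ten F w) = ten (path_fock n C) w"
    and V_closed: "f \<in> carr (path_fock n C) \<Longrightarrow> V f \<in> carr F"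
    and U_V: "f \<in> carr (path_fock n C) \<Longrightarrow> U (V f) = f"
    and V_U: "x \<in> carr F \<Longrightarrow> V (U x) = x"

lemma fock_spaceD:
  assumes "fock_space n E F"
  shows "hilbert_module n F"
    and "a \<in> diag_alg n \<Longrightarrow> vac F a \<in> carr F"
    and "w \<in> words E \<Longrightarrow> ten F w \<in> carr F"
    and "a \<in> diag_alg n \<Longrightarrow> b \<in> diag_alg n \<Longrightarrow> ip F (vac F a) (vac F b) = diag_adj a * b"
    and "a \<in> diag_alg n \<Longrightarrow> w \<in> words E \<Longrightarrow> ip F (vac F a) (ten F w) = 0"
    and "w \<in> words E \<Longrightarrow> w' \<in> words E \<Longrightarrow>
      ip F (ten F w) (ten F w') = (if length w = length w' then tensor_ip E w w' else 0)"
    and "closed_submodule n F hull (vac F ` diag_alg n \<union> ten F ` words E) = carr F"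
  using assms unfolding fock_space_def by (simp_all add: image_subset_iff)

text \<open>The definition of a Fock space prescribes every inner product of generators, so the Gram
  matrices of any two Fock spaces of \<open>E\<close> agree.\<close>

lemma fock_ip_determined:
  fixes E :: "('e, 'r) corr_scheme" and F :: "('e, 'x::ab_group_add, 's) fock_scheme"
    and F' :: "('e, 'y::ab_group_add, 't) fock_scheme"
  assumes F: "fock_space n E F" and F': "fock_space n E F'" and n: "0 < n"
  defines "G \<equiv> (\<lambda>a. (vac F a, vac F' a)) ` diag_alg n \<union> (\<lambda>w. (ten F w, ten F' w)) ` words E"
  shows "gram_pair n F F' G"
proof -
  have pos: "pos_hilbert_module n F" "pos_hilbert_module n F'"
    using n fock_spaceD(1)[OF F] fock_spaceD(1)[OF F']
    by (auto simp: pos_hilbert_module_def pos_hilbert_module_axioms_def)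
  interpret F: pos_hilbert_module n F by (rule pos)
  interpret F': pos_hilbert_module n F' by (rule pos)
  have vt: "ip F (ten F w) (vac F a) = 0" "ip F' (ten F' w) (vac F' a) = 0"
    if "a \<in> diag_alg n" "w \<in> words E" for a w
    using F.ip_adj[of "vac F a" "ten F w"] F'.ip_adj[of "vac F' a" "ten F' w"] that
    by (simp_all add: fock_spaceD[OF F] fock_spaceD[OF F'] diag_adj_def fun_eq_iff)
  show ?thesis
  proof (unfold_locales)
    show "x \<in> carr F \<and> y \<in> carr F'" if "(x, y) \<in> G" for x y
      using that fock_spaceD(2,3)[OF F] fock_spaceD(2,3)[OF F'] unfolding G_def by blast
    show "G \<noteq> {}" using F.diag_alg_zero unfolding G_def by blast
    have "fst ` G = vac F ` diag_alg n \<union> ten F ` words E"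
      unfolding G_def by (simp add: image_Un image_image)
    thus "closed_submodule n F hull (fst ` G) = carr F" using fock_spaceD(7)[OF F] by simp
    show "ip F x x' = ip F' y y'" if "(x, y) \<in> G" "(x', y') \<in> G" for x y x' y'
      using that unfolding G_def
      by (elim UnE imageE) (simp_all add: fock_spaceD[OF F] fock_spaceD[OF F'] vt)
  qed
qed

lemma fock_isometry:
  fixes E :: "('e, 'r) corr_scheme" and F :: "('e, 'x::ab_group_add, 's) fock_scheme"
    and F' :: "('e, 'y::ab_group_add, 't) fock_scheme"
  assumes F: "fock_space n E F" and F': "fock_space n E F'" and n: "0 < n"
  shows "\<exists>U. (\<forall>x\<in>carr F. U x \<in> carr F') \<and> (\<forall>x\<in>carr F. \<forall>x'\<in>carr F. ip F' (U x) (U x') = ip F x x')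
    \<and> (\<forall>a\<in>diag_alg n. U (vac F a) = vac F' a) \<and> (\<forall>w\<in>words E. U (ten F w) = ten F' w)"
  using gram_pair.isometry_exists[OF fock_ip_determined[OF assms]] by (simp add: ball_Un)

text \<open>Since \<open>V (U s) = s\<close> for a generator \<open>s\<close> and both maps preserve
  inner products, \<open>V (U x)\<close> and \<open>x\<close> have the same inner product with each
  generator.\<close>

lemma fock_isometry_inverse:
  assumes F: "fock_space n E F" and n: "0 < n"
    and F': "fock_space n E F'"
    and U: "\<And>x. x \<in> carr F \<Longrightarrow> U x \<in> carr F'"
      "\<And>x x'. x \<in> carr F \<Longrightarrow> x' \<in> carr F \<Longrightarrow> ip F' (U x) (U x') = ip F x x'"
      "\<And>a. a \<in> diag_alg n \<Longrightarrow> U (vac F a) = vac F' a" "\<And>w. w \<in> words E \<Longrightarrow> U (ten F w) = ten F' w"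
    and V: "\<And>x. x \<in> carr F' \<Longrightarrow> V x \<in> carr F"
      "\<And>x x'. x \<in> carr F' \<Longrightarrow> x' \<in> carr F' \<Longrightarrow> ip F (V x) (V x') = ip F' x x'"
      "\<And>a. a \<in> diag_alg n \<Longrightarrow> V (vac F' a) = vac F a" "\<And>w. w \<in> words E \<Longrightarrow> V (ten F' w) = ten F w"
    and x: "x \<in> carr F"
  shows "V (U x) = x"
proof -
  interpret F: pos_hilbert_module n F
    using n fock_spaceD(1)[OF F] by (auto simp: pos_hilbert_module_def pos_hilbert_module_axioms_def)
  show ?thesis
  proof (rule F.eq_hull[OF _ x fock_spaceD(7)[OF F]])
    show "V (U x) \<in> carr F" by (intro U V x)
    show "vac F ` diag_alg n \<union> ten F ` words E \<subseteq> carr F"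
      using fock_spaceD(2,3)[OF F] by blast
    fix s assume "s \<in> vac F ` diag_alg n \<union> ten F ` words E"
    hence s: "s \<in> carr F" "V (U s) = s"
      using fock_spaceD(2,3)[OF F] U V by auto
    thus "ip F (V (U x)) s = ip F x s" using V(2)[OF U(1)[OF x] U(1)[OF s(1)]] U(2)[OF x s(1)] by simp
  qed
qed

lemma fock_coordinates_exist:
  assumes n: "0 < n" and F: "fock_space n (matrix_corr n C) F"
  shows "\<exists>U V. fock_coordinates n C F U V"
proof -
  let ?P = "path_fock n C" and ?E = "matrix_corr n C"
  have P: "fock_space n ?E ?P" by (rule fock_space_exists[OF n])
  obtain U where U: "\<And>x. x \<in> carr F \<Longrightarrow> U x \<in> carr ?P"
      "\<And>x x'. x \<in> carr F \<Longrightarrow> x' \<in> carr F \<Longrightarrow> ip ?P (U x) (U x') = ip F x x'"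
      "\<And>a. a \<in> diag_alg n \<Longrightarrow> U (vac F a) = vac ?P a" "\<And>w. w \<in> words ?E \<Longrightarrow> U (ten F w) = ten ?P w"
    using fock_isometry[OF F P n] by blast
  obtain V where V: "\<And>x. x \<in> carr ?P \<Longrightarrow> V x \<in> carr F"
      "\<And>x x'. x \<in> carr ?P \<Longrightarrow> x' \<in> carr ?P \<Longrightarrow> ip F (V x) (V x') = ip ?P x x'"
      "\<And>a. a \<in> diag_alg n \<Longrightarrow> V (vac ?P a) = vac F a" "\<And>w. w \<in> words ?E \<Longrightarrow> V (ten ?P w) = ten F w"
    using fock_isometry[OF P F n] by blast
  have "V (U x) = x" if "x \<in> carr F" for x
    by (rule fock_isometry_inverse[OF F n P, where U=U and V=V]) (simp_all add: U V that)
  moreover have "U (V f) = f" if "f \<in> carr ?P" for f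
    by (rule fock_isometry_inverse[OF P n F, where U=V and V=U]) (simp_all add: U V that)
  moreover have "pos_hilbert_module n F"
    using n fock_spaceD(1)[OF F] by (simp add: pos_hilbert_module_def pos_hilbert_module_axioms_def)
  ultimately have "fock_coordinates n C F U V"
    unfolding fock_coordinates_def fock_coordinates_axioms_def using F U V by (simp add: path_vac)
  thus ?thesis by blast
qed

section \<open>Creation, annihilation and diagonal operators on the space of paths\<close>

lemma l2_Cauchy_Schwarz:
  assumes f: "l2 f" and g: "l2 g"
  shows "(cmod (l2_ip f g))\<^sup>2 \<le> l2_sq f * l2_sq g"
proof -
  have "cmod (l2_ip f g) \<le> (\<Sum>\<^sub>\<infinity>p. norm (cnj (f p) * g p))"
    unfolding l2_ip_def by (rule norm_infsum_bound[OF l2_prod[OF f g]])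
  also have "\<dots> \<le> sqrt (l2_sq f * l2_sq g)"
  proof (rule infsum_le_finite_sums[OF l2_prod[OF f g]])
    fix A :: "'a set" assume A: "finite A"
    have "(\<Sum>p\<in>A. norm (cnj (f p) * g p))\<^sup>2 \<le> (\<Sum>p\<in>A. (cmod (f p))\<^sup>2) * (\<Sum>p\<in>A. (cmod (g p))\<^sup>2)"
      using Cauchy_Schwarz_ineq_sum[of "\<lambda>p. cmod (f p)" "\<lambda>p. cmod (g p)" A] by (simp add: norm_mult)
    also have "\<dots> \<le> l2_sq f * l2_sq g"
      unfolding l2_sq_def using f g A
      by (intro mult_mono finite_sum_le_infsum sum_nonneg infsum_nonneg) (auto simp: l2_def)
    finally show "(\<Sum>p\<in>A. norm (cnj (f p) * g p)) \<le> sqrt (l2_sq f * l2_sq g)"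
      by (rule real_le_rsqrt)
  qed
  finally have "(cmod (l2_ip f g))\<^sup>2 \<le> (sqrt (l2_sq f * l2_sq g))\<^sup>2"
    by (rule power_mono) simp
  thus ?thesis by (simp add: l2_sq_nonneg)
qed

text \<open>The annihilation operator: it strips the first edge of a path and pairs it with
  \<open>\<xi>\<close>. It is the adjoint that makes \<open>path_cons \<xi>\<close>
  adjointable.\<close>

definition path_annihilate :: "(nat \<Rightarrow> nat \<Rightarrow> nat \<Rightarrow> complex) \<Rightarrow> ((nat \<times> nat) list \<Rightarrow> nat \<Rightarrow> complex) \<Rightarrow>
    (nat \<times> nat) list \<Rightarrow> nat \<Rightarrow> complex" where
  "path_annihilate \<xi> g = (\<lambda>q j. l2_ip (\<lambda>e. \<xi> (fst e) (src q j) (snd e)) (\<lambda>e. g (e # q) j))"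

text \<open>Tonelli after splitting a nonempty list into head and tail. The empty list has no head,
  which is why \<open>?u\<close> is 0 there.\<close>

lemma tail_l2:
  assumes "l2 (g :: 'a list \<Rightarrow> complex)"
  shows "l2 (\<lambda>e. g (e # q))" and "(\<lambda>q. l2_sq (\<lambda>e. g (e # q))) summable_on UNIV"
proof -
  let ?u = "\<lambda>p. if p = [] then 0 else (cmod (g p))\<^sup>2"
  let ?v = "\<lambda>x. (cmod (g (snd x # fst x)))\<^sup>2"
  have "?u summable_on UNIV"
    by (rule summable_on_comparison_test[OF assms[unfolded l2_def]]) auto
  hence "(\<lambda>x. norm (?v x)) summable_on Sigma UNIV (\<lambda>_. UNIV)"
    by (subst (asm) summable_lists) (simp_all add: case_prod_unfold)
  hence "\<forall>q. (\<lambda>e. norm (?v (q, e))) summable_on UNIV"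
    "(\<lambda>q. norm (\<Sum>\<^sub>\<infinity>e. norm (?v (q, e)))) summable_on UNIV"
    unfolding Infinite_Sum.abs_summable_on_Sigma_iff by auto
  moreover have "norm (\<Sum>\<^sub>\<infinity>e. norm (?v (q, e))) = l2_sq (\<lambda>e. g (e # q))" for q
    using l2_sq_nonneg[of "\<lambda>e. g (e # q)"] by (simp add: l2_sq_def)
  ultimately show "l2 (\<lambda>e. g (e # q))" "(\<lambda>q. l2_sq (\<lambda>e. g (e # q))) summable_on UNIV"
    by (auto simp: l2_def)
qed

lemma annihilate_closed:
  assumes \<xi>: "\<xi> \<in> carr (matrix_corr n C)" and g: "g \<in> carr (path_fock n C)"
  shows "path_annihilate \<xi> g \<in> carr (path_fock n C)"
proof -
  have "path_annihilate \<xi> g q j = 0" if "\<not> quiver_path n C q j" for q j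
  proof -
    have "g (e # q) j = 0" for e using that g by (simp add: path_carr)
    thus ?thesis by (simp add: path_annihilate_def l2_ip_def)
  qed
  moreover have "l2 (\<lambda>q. path_annihilate \<xi> g q j)" for j
  proof -
    \<comment> \<open>A common bound for all columns of \<open>\<xi>\<close>: there are only
      \<open>n\<close> of them, and those beyond vanish.\<close>
    define M where "M = (\<Sum>t<n. l2_sq (\<lambda>e. \<xi> (fst e) t (snd e)))"
    have M: "l2_sq (\<lambda>e. \<xi> (fst e) t (snd e)) \<le> M" for t
    proof (cases "t < n")
      case True
      thus ?thesis unfolding M_def by (intro member_le_sum) (auto simp: l2_sq_nonneg)
    next
      case False
      hence "l2_sq (\<lambda>e. \<xi> (fst e) t (snd e)) = 0"
        by (simp add: l2_sq_def corr_zero[OF \<xi>])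
      thus ?thesis unfolding M_def by (simp add: sum_nonneg l2_sq_nonneg)
    qed
    have gl2: "l2 (\<lambda>p. g p j)" using g by (simp add: path_carr)
    show ?thesis
      unfolding l2_def
    proof (rule summable_on_comparison_test)
      show "(\<lambda>q. M * l2_sq (\<lambda>e. g (e # q) j)) summable_on UNIV"
        by (intro summable_on_cmult_right tail_l2[OF gl2])
      fix q
      have "(cmod (path_annihilate \<xi> g q j))\<^sup>2
          \<le> l2_sq (\<lambda>e. \<xi> (fst e) (src q j) (snd e)) * l2_sq (\<lambda>e. g (e # q) j)"
        unfolding path_annihilate_def by (intro l2_Cauchy_Schwarz corr_col_l2[OF \<xi>] tail_l2[OF gl2])
      also have "\<dots> \<le> M * l2_sq (\<lambda>e. g (e # q) j)"
        by (intro mult_right_mono M l2_sq_nonneg)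
      finally show "(cmod (path_annihilate \<xi> g q j))\<^sup>2 \<le> M * l2_sq (\<lambda>e. g (e # q) j)" .
    qed simp
  qed
  ultimately show ?thesis by (simp add: path_carr)
qed

lemma annihilate_adjoint:
  assumes \<xi>: "\<xi> \<in> carr (matrix_corr n C)" and f: "f \<in> carr (path_fock n C)" and g: "g \<in> carr (path_fock n C)"
  shows "ip (path_fock n C) (path_annihilate \<xi> g) f = ip (path_fock n C) g (path_cons \<xi> f)"
proof
  fix j
  let ?u = "\<lambda>p. cnj (g p j) * path_cons \<xi> f p j"
  let ?v = "\<lambda>x. cnj (g (snd x # fst x) j) * (\<xi> (fst (snd x)) (src (fst x) j) (snd (snd x)) * f (fst x) j)"
  have u0: "?u [] = 0" by (simp add: path_cons_def)
  have uv: "(\<lambda>(q, e). ?u (e # q)) = ?v" by (auto simp: path_cons_def)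
  have "?u summable_on UNIV"
    using g by (intro l2_prod' cons_l2[OF \<xi> f]) (simp add: path_carr)
  hence "?v summable_on Sigma UNIV (\<lambda>_. UNIV)"
    using summable_lists[of ?u, OF u0] uv by simp
  from infsum_Sigma_banach[OF this]
  have "infsum ?v UNIV = (\<Sum>\<^sub>\<infinity>q. \<Sum>\<^sub>\<infinity>e. ?v (q, e))" by simp
  also have "\<dots> = (\<Sum>\<^sub>\<infinity>q. cnj (path_annihilate \<xi> g q j) * f q j)"
  proof (rule infsum_cong)
    fix q
    have "(\<Sum>\<^sub>\<infinity>e. ?v (q, e)) = (\<Sum>\<^sub>\<infinity>e. cnj (g (e # q) j) * \<xi> (fst e) (src q j) (snd e) * f q j)"
      by (intro infsum_cong) simp
    also have "\<dots> = l2_ip (\<lambda>e. g (e # q) j) (\<lambda>e. \<xi> (fst e) (src q j) (snd e)) * f q j"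
      by (simp add: infsum_cmult_left' l2_ip_def)
    also have "l2_ip (\<lambda>e. g (e # q) j) (\<lambda>e. \<xi> (fst e) (src q j) (snd e)) = cnj (path_annihilate \<xi> g q j)"
      unfolding path_annihilate_def by (rule l2_ip_cnj)
    finally show "(\<Sum>\<^sub>\<infinity>e. ?v (q, e)) = cnj (path_annihilate \<xi> g q j) * f q j" .
  qed
  finally have "infsum ?u UNIV = \<dots>"
    using infsum_lists[of ?u, OF u0] uv by simp
  thus "ip (path_fock n C) (path_annihilate \<xi> g) f j = ip (path_fock n C) g (path_cons \<xi> f) j"
    by (simp add: path_ip l2_ip_def)
qed

text \<open>The left action on a tensor touches only its first factor, so on a path it depends only
  on the first vertex.\<close>

definition path_diag :: "diag \<Rightarrow> ((nat \<times> nat) list \<Rightarrow> nat \<Rightarrow> complex) \<Rightarrow> (nat \<times> nat) list \<Rightarrow> nat \<Rightarrow> complex" where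
  "path_diag a f = (\<lambda>p j. a (src p j) * f p j)"

lemma path_diag_closed:
  assumes a: "a \<in> diag_alg n" and f: "f \<in> carr (path_fock n C)"
  shows "path_diag a f \<in> carr (path_fock n C)"
proof -
  define M where "M = (\<Sum>i<n. cmod (a i))"
  have M: "cmod (a i) \<le> M" for i
  proof (cases "i < n")
    case True
    thus ?thesis unfolding M_def by (intro member_le_sum) auto
  next
    case False
    thus ?thesis using a unfolding M_def by (simp add: diag_alg_def sum_nonneg)
  qed
  have "l2 (\<lambda>p. path_diag a f p j)" for j
  proof (rule l2_comparison)
    show "l2 (\<lambda>p. f p j)" using f by (simp add: path_carr)
    show "cmod (path_diag a f p j) \<le> M * cmod (f p j)" for p
      unfolding path_diag_def norm_mult by (intro mult_right_mono M) simp
  qed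
  thus ?thesis using f by (simp add: path_carr path_diag_def)
qed

lemma path_diag_adjoint:
  "ip (path_fock n C) (path_diag (diag_adj a) g) f = ip (path_fock n C) g (path_diag a f)"
  by (simp add: fun_eq_iff path_ip l2_ip_def path_diag_def diag_adj_def mult_ac)

lemma path_cons_vac:
  "b \<in> diag_alg n \<Longrightarrow> path_cons \<xi> (path_vac b) = ten (path_fock n C) [rmul (matrix_corr n C) \<xi> b]"
  by (auto simp: fun_eq_iff path_ten_cons path_ten_nil path_cons_def path_vac_def matrix_corr_def
      diag_alg_def diag_scalar_def split: list.splits)

lemma path_diag_vac: "path_diag a (path_vac b) = path_vac (a * b)"
  by (auto simp: fun_eq_iff path_diag_def path_vac_def)

lemma path_diag_ten:
  "path_diag a (ten (path_fock n C) (\<xi> # w)) = ten (path_fock n C) (lmul (matrix_corr n C) a \<xi> # w)"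
  by (auto simp: fun_eq_iff path_ten_cons path_diag_def path_cons_def matrix_corr_def split: list.splits)

lemma rmul_corr_closed:
  assumes "\<xi> \<in> carr (matrix_corr n C)"
  shows "rmul (matrix_corr n C) \<xi> d \<in> carr (matrix_corr n C)"
proof -
  have "summable (\<lambda>k. (cmod (\<xi> i j k * d j))\<^sup>2)" if "summable (\<lambda>k. (cmod (\<xi> i j k))\<^sup>2)" for i j
    using summable_mult2[OF that, of "(cmod (d j))\<^sup>2"] by (simp add: norm_mult power_mult_distrib)
  thus ?thesis using assms by (auto simp: matrix_corr_def hilb_def fun_eq_iff)
qed

section \<open>Creation and diagonal operators\<close>

context fock_coordinates
begin

abbreviation "E \<equiv> matrix_corr n C"
abbreviation "P \<equiv> path_fock n C"

lemma pos_P: "pos_hilbert_module n P"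
  using path_hilbert_module[OF n_pos] n_pos
  by (simp add: pos_hilbert_module_def pos_hilbert_module_axioms_def)

lemmas vac_closed = fock_spaceD(2)[OF fock]
lemmas ten_closed = fock_spaceD(3)[OF fock]

lemma ip_U: "f \<in> carr P \<Longrightarrow> x \<in> carr F \<Longrightarrow> ip P f (U x) = ip F (V f) x"
  using U_ip[of "V f" x] by (simp add: V_closed U_V)

text \<open>\<open>U\<close> is onto, so a vector of the path space is determined by its inner
  products with all \<open>g\<close>. Linearity of \<open>U\<close> is read off from this
  characterization.\<close>

lemma U_eq: "f \<in> carr P \<Longrightarrow> x \<in> carr F \<Longrightarrow> (\<And>g. g \<in> carr P \<Longrightarrow> ip P g f = ip F (V g) x) \<Longrightarrow> U x = f"
  by (rule pos_hilbert_module.eqI_ip[OF pos_P]) (auto simp: ip_U U_closed)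

lemma U_add: "x \<in> carr F \<Longrightarrow> y \<in> carr F \<Longrightarrow> U (x + y) = U x + U y"
  by (rule U_eq)
     (auto simp: add_closed U_closed V_closed ip_add_right ip_U
       hilbert_module.ip_add_right[OF path_hilbert_module[OF n_pos]]
       hilbert_module.add_closed[OF path_hilbert_module[OF n_pos]])

lemma U_rmul: "x \<in> carr F \<Longrightarrow> a \<in> diag_alg n \<Longrightarrow> U (rmul F x a) = rmul P (U x) a"
  by (rule U_eq)
     (auto simp: rmul_closed U_closed V_closed ip_rmul_right ip_U
       hilbert_module.ip_rmul_right[OF path_hilbert_module[OF n_pos]]
       hilbert_module.rmul_closed[OF path_hilbert_module[OF n_pos]])

lemma U_off: "x \<in> carr F \<Longrightarrow> \<not> quiver_path n C p j \<Longrightarrow> U x p j = 0"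
  using U_closed[of x] by (simp add: path_carr)

lemma U_csc: assumes "x \<in> carr F" shows "U (csc n F c x) p j = c * U x p j"
proof (cases "j < n")
  case True
  thus ?thesis
    unfolding csc_def U_rmul[OF assms diag_scalar_closed] path_rmul by (simp add: diag_scalar_def)
next
  case False
  thus ?thesis using assms U_off path_end by (metis mult_zero_right scalar_closed)
qed

lemma U_zero: "U 0 = 0"
  using U_add[of 0 0] zero_closed by simp

lemma U_diff: "x \<in> carr F \<Longrightarrow> y \<in> carr F \<Longrightarrow> U (x - y) = U x - U y"
  using U_add[of "x - y" y] by (simp add: diff_closed)

lemma U_inj: "x \<in> carr F \<Longrightarrow> y \<in> carr F \<Longrightarrow> U x = U y \<Longrightarrow> x = y"
  using V_U by metis

text \<open>The agreement is passed to an adjoint of \<open>T - T'\<close>: its values are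
  orthogonal to all generators, hence 0. In this way the set where \<open>T\<close> and
  \<open>T'\<close> agree never has to be shown closed.\<close>

lemma operator_eq:
  assumes T: "T \<in> adjointable F" and T': "T' \<in> adjointable F"
    and vac: "\<And>a. a \<in> diag_alg n \<Longrightarrow> T (vac F a) = T' (vac F a)"
    and ten: "\<And>w. w \<in> words E \<Longrightarrow> T (ten F w) = T' (ten F w)"
  shows "T = T'"
proof
  fix y
  obtain S where S: "\<And>x. x \<in> carr F \<Longrightarrow> S x \<in> carr F"
    "\<And>x y. x \<in> carr F \<Longrightarrow> y \<in> carr F \<Longrightarrow> ip F (S x) y = ip F x ((T - T') y)"
    by (rule adjoint_obtain[OF minus_adjointable[OF T T']]) blast
  have "S x = 0" if x: "x \<in> carr F" for x
  proof (rule orth_hull[OF S(1)[OF x] fock_spaceD(7)[OF fock]])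
    show "vac F ` diag_alg n \<union> ten F ` words E \<subseteq> carr F" using vac_closed ten_closed by blast
    fix s assume "s \<in> vac F ` diag_alg n \<union> ten F ` words E"
    hence "s \<in> carr F" "T s = T' s" using vac ten vac_closed ten_closed by auto
    thus "ip F (S x) s = 0" using S(2)[OF x] by (simp add: ip_zero_right x)
  qed
  hence z: "ip F x ((T - T') y) = 0" if "x \<in> carr F" "y \<in> carr F" for x y
    using S(2) that ip_zero_left by metis
  show "T y = T' y"
  proof (cases "y \<in> carr F")
    case True
    have c: "(T - T') y \<in> carr F" by (rule adjointable_closed[OF minus_adjointable[OF T T'] True])
    have "(T - T') y = 0" by (rule ip_definite[OF c z[OF c True]])
    thus ?thesis by simp
  qed (simp add: adjointable_off T T')
qed

text \<open>Conjugation of an operator \<open>A\<close> on the path space by the unitary, cut off to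
  0 outside the carrier as \<open>adjointable\<close> demands; \<open>B\<close> is the adjoint of
  \<open>A\<close>.\<close>

lemma transport:
  assumes A: "\<And>f. f \<in> carr P \<Longrightarrow> A f \<in> carr P" and B: "\<And>f. f \<in> carr P \<Longrightarrow> B f \<in> carr P"
    and adj: "\<And>f g. f \<in> carr P \<Longrightarrow> g \<in> carr P \<Longrightarrow> ip P (B g) f = ip P g (A f)"
  defines "T \<equiv> \<lambda>y. if y \<in> carr F then V (A (U y)) else 0"
  shows "T \<in> adjointable F" and "y \<in> carr F \<Longrightarrow> U (T y) = A (U y)"
proof -
  show "T \<in> adjointable F"
  proof (rule adjointableI[where S="\<lambda>x. V (B (U x))"])
    fix x y assume x: "x \<in> carr F" and y: "y \<in> carr F"
    have "ip F (V (B (U x))) y = ip P (U x) (A (U y))"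
      using ip_U[OF B y] adj x y by (simp add: U_closed)
    also have "\<dots> = ip F x (T y)"
      using U_ip[of x "T y"] x y by (simp add: T_def U_V V_closed A U_closed)
    finally show "ip F (V (B (U x))) y = ip F x (T y)" .
  qed (auto simp: T_def A B U_closed V_closed)
  show "y \<in> carr F \<Longrightarrow> U (T y) = A (U y)" by (simp add: T_def U_V A U_closed)
qed

text \<open>This resolves the definite description in \<open>creation\<close>: the transported
  \<open>path_cons \<xi>\<close> satisfies it, and uniqueness is \<open>operator_eq\<close>.\<close>

lemma creation:
  assumes \<xi>: "\<xi> \<in> carr E"
  shows creation_adjointable: "creation n E F \<xi> \<in> adjointable F"
    and U_creation: "y \<in> carr F \<Longrightarrow> U (creation n E F \<xi> y) = path_cons \<xi> (U y)"
proof -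
  define T where "T = (\<lambda>y. if y \<in> carr F then V (path_cons \<xi> (U y)) else 0)"
  have T: "T \<in> adjointable F" and UT: "y \<in> carr F \<Longrightarrow> U (T y) = path_cons \<xi> (U y)" for y
    unfolding T_def
    by (rule transport[where A="path_cons \<xi>" and B="path_annihilate \<xi>"];
        simp add: cons_closed[OF \<xi>] annihilate_closed[OF \<xi>] annihilate_adjoint[OF \<xi>])+
  have word: "[rmul E \<xi> b] \<in> words E" for b
    using rmul_corr_closed[OF \<xi>] by (simp add: words_def)
  have word': "\<xi> # w \<in> words E" if "w \<in> words E" for w
    using \<xi> that by (simp add: words_def)
  have "creation n E F \<xi> = T"
    unfolding creation_def
  proof (rule the_equality)
    have "T (vac F b) = ten F [rmul E \<xi> b]" if b: "b \<in> diag_alg n" for b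
    proof (rule U_inj)
      show "U (T (vac F b)) = U (ten F [rmul E \<xi> b])"
        by (simp only: UT[OF vac_closed[OF b]] U_vac[OF b] U_ten[OF word] path_cons_vac[OF b])
    qed (use b word in \<open>auto simp: adjointable_closed[OF T] vac_closed ten_closed\<close>)
    moreover have "T (ten F w) = ten F (\<xi> # w)" if w: "w \<in> words E" for w
    proof (rule U_inj)
      show "U (T (ten F w)) = U (ten F (\<xi> # w))"
        by (simp only: UT[OF ten_closed[OF w]] U_ten[OF w] U_ten[OF word'[OF w]] path_ten_cons)
    qed (use w word' in \<open>auto simp: adjointable_closed[OF T] ten_closed\<close>)
    ultimately show *: "T \<in> adjointable F \<and> (\<forall>b\<in>diag_alg n. T (vac F b) = ten F [rmul E \<xi> b])
        \<and> (\<forall>w\<in>words E. T (ten F w) = ten F (\<xi> # w))" using T by blast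
    fix T' assume "T' \<in> adjointable F \<and> (\<forall>b\<in>diag_alg n. T' (vac F b) = ten F [rmul E \<xi> b])
        \<and> (\<forall>w\<in>words E. T' (ten F w) = ten F (\<xi> # w))"
    thus "T' = T" using * by (intro operator_eq) simp_all
  qed
  thus "creation n E F \<xi> \<in> adjointable F" "y \<in> carr F \<Longrightarrow> U (creation n E F \<xi> y) = path_cons \<xi> (U y)"
    using T UT by simp_all
qed

lemma diag_op:
  assumes a: "a \<in> diag_alg n"
  shows diag_op_adjointable: "diag_op n E F a \<in> adjointable F"
    and U_diag_op: "y \<in> carr F \<Longrightarrow> U (diag_op n E F a y) = path_diag a (U y)"
proof -
  define T where "T = (\<lambda>y. if y \<in> carr F then V (path_diag a (U y)) else 0)"
  have "diag_adj a \<in> diag_alg n" using a by (simp add: diag_alg_def diag_adj_def)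
  note a' = this
  have T: "T \<in> adjointable F" and UT: "y \<in> carr F \<Longrightarrow> U (T y) = path_diag a (U y)" for y
    unfolding T_def
    by (rule transport[where A="path_diag a" and B="path_diag (diag_adj a)"];
        simp add: path_diag_closed path_diag_adjoint a a')+
  have ab: "a * b \<in> diag_alg n" for b using a by (simp add: diag_alg_def)
  have word: "lmul E a \<xi> # w \<in> words E" if "\<xi> # w \<in> words E" for \<xi> w
    using that lmul_closed by (simp add: words_def)
  have "diag_op n E F a = T"
    unfolding diag_op_def
  proof (rule the_equality)
    have "T (vac F b) = vac F (a * b)" if b: "b \<in> diag_alg n" for b
    proof (rule U_inj)
      show "U (T (vac F b)) = U (vac F (a * b))"
        by (simp only: UT[OF vac_closed[OF b]] U_vac[OF b] U_vac[OF ab] path_diag_vac)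
    qed (use b ab in \<open>auto simp: adjointable_closed[OF T] vac_closed\<close>)
    moreover have "T (ten F (\<xi> # w)) = ten F (lmul E a \<xi> # w)" if w: "\<xi> # w \<in> words E" for \<xi> w
    proof (rule U_inj)
      show "U (T (ten F (\<xi> # w))) = U (ten F (lmul E a \<xi> # w))"
        by (simp only: UT[OF ten_closed[OF w]] U_ten[OF w] U_ten[OF word[OF w]] path_diag_ten)
    qed (use w word in \<open>auto simp: adjointable_closed[OF T] ten_closed\<close>)
    ultimately show *: "T \<in> adjointable F \<and> (\<forall>b\<in>diag_alg n. T (vac F b) = vac F (a * b))
        \<and> (\<forall>\<xi> w. \<xi> # w \<in> words E \<longrightarrow> T (ten F (\<xi> # w)) = ten F (lmul E a \<xi> # w))" using T by blast
    fix T' assume T': "T' \<in> adjointable F \<and> (\<forall>b\<in>diag_alg n. T' (vac F b) = vac F (a * b))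
        \<and> (\<forall>\<xi> w. \<xi> # w \<in> words E \<longrightarrow> T' (ten F (\<xi> # w)) = ten F (lmul E a \<xi> # w))"
    have "T' (ten F w) = T (ten F w)" if "w \<in> words E" for w
      using that T' * by (cases w) (auto simp: words_def)
    thus "T' = T" using T' * by (intro operator_eq) simp_all
  qed
  thus "diag_op n E F a \<in> adjointable F" "y \<in> carr F \<Longrightarrow> U (diag_op n E F a y) = path_diag a (U y)"
    using T UT by simp_all
qed

end

section \<open>Triangularity of the Hardy algebra\<close>

text \<open>Continuity in both senses in which the algebras are closed: ultraweakly, for the Hardy
  algebra, and in operator norm, in Lipschitz form, for the norm-closed hull that is the tensor
  algebra.\<close>

definition normal_functional :: "nat \<Rightarrow> ('x::ab_group_add, 'r) hmod_scheme \<Rightarrow> (('x \<Rightarrow> 'x) \<Rightarrow> complex) \<Rightarrow> bool" where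
  "normal_functional n X f \<longleftrightarrow> continuous_map (wstar_topology n X) euclidean f
     \<and> (\<exists>M. \<forall>S\<in>adjointable X. \<forall>T\<in>adjointable X. cmod (f S - f T) \<le> M * op_norm n X (S - T))"

lemma normal_functional_add:
  assumes "normal_functional n X f" "normal_functional n X g"
  shows "normal_functional n X (\<lambda>T. f T + g T)"
proof -
  obtain M N where
    M: "\<And>S T. S \<in> adjointable X \<Longrightarrow> T \<in> adjointable X \<Longrightarrow> cmod (f S - f T) \<le> M * op_norm n X (S - T)" and
    N: "\<And>S T. S \<in> adjointable X \<Longrightarrow> T \<in> adjointable X \<Longrightarrow> cmod (g S - g T) \<le> N * op_norm n X (S - T)"
    using assms unfolding normal_functional_def by blast
  have "cmod (f S + g S - (f T + g T)) \<le> (M + N) * op_norm n X (S - T)"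
    if "S \<in> adjointable X" "T \<in> adjointable X" for S T
    using norm_triangle_ineq[of "f S - f T" "g S - g T"] M[OF that] N[OF that] by (simp add: algebra_simps)
  moreover have "continuous_map (wstar_topology n X) euclidean (\<lambda>T. f T + g T)"
    using assms unfolding normal_functional_def by (intro continuous_map_add) auto
  ultimately show ?thesis unfolding normal_functional_def by blast
qed

lemma normal_functional_cmult:
  assumes "normal_functional n X f"
  shows "normal_functional n X (\<lambda>T. c * f T)"
proof -
  obtain M where
    M: "\<And>S T. S \<in> adjointable X \<Longrightarrow> T \<in> adjointable X \<Longrightarrow> cmod (f S - f T) \<le> M * op_norm n X (S - T)"
    using assms unfolding normal_functional_def by blast
  have "cmod (c * f S - c * f T) \<le> (cmod c * M) * op_norm n X (S - T)"
    if "S \<in> adjointable X" "T \<in> adjointable X" for S T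
    using mult_left_mono[OF M[OF that], of "cmod c"]
    by (simp add: norm_mult mult.assoc flip: right_diff_distrib)
  moreover have "continuous_map (wstar_topology n X) euclidean ((\<lambda>z. c * z) \<circ> f)"
    using assms unfolding normal_functional_def
    by (intro continuous_map_compose) (auto intro!: continuous_intros)
  ultimately show ?thesis unfolding normal_functional_def o_def by blast
qed

lemma normal_functional_zero: "normal_functional n X (\<lambda>T. 0)"
  unfolding normal_functional_def by (auto intro: exI[of _ 0])

lemma normal_functional_diff:
  "normal_functional n X f \<Longrightarrow> normal_functional n X g \<Longrightarrow> normal_functional n X (\<lambda>T. f T - g T)"
  using normal_functional_add[OF _ normal_functional_cmult[of n X g "-1"], of f] by simp

lemma normal_functional_sum:
  "(\<And>i. i \<in> I \<Longrightarrow> normal_functional n X (f i)) \<Longrightarrow> normal_functional n X (\<lambda>T. \<Sum>i\<in>I. f i T)"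
  by (induction I rule: infinite_finite_induct) (simp_all add: normal_functional_zero normal_functional_add)

lemma normal_functional_limit:
  assumes f: "normal_functional n X f"
    and s: "\<And>k. s k \<in> adjointable X" "\<And>k. f (s k) = 0" and T: "T \<in> adjointable X"
    and lim: "(\<lambda>k. op_norm n X (s k - T)) \<longlonglongrightarrow> 0"
  shows "f T = 0"
proof -
  obtain M where M: "\<And>S. S \<in> adjointable X \<Longrightarrow> cmod (f S - f T) \<le> M * op_norm n X (S - T)"
    using f T unfolding normal_functional_def by blast
  have "(\<lambda>k. M * op_norm n X (s k - T)) \<longlonglongrightarrow> M * 0" by (intro tendsto_mult tendsto_const lim)
  hence "cmod (f T) \<le> M * 0"
    by (rule LIMSEQ_le_const) (use M[OF s(1)] s(2) in auto)
  thus ?thesis by simp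
qed

section \<open>Generated subalgebras and vector functionals\<close>

context pos_hilbert_module
begin

lemma closed_subalgebra_adjointable: "closed_subalgebra n X (adjointable X)"
  unfolding closed_subalgebra_def
  by (auto simp: zero_adjointable plus_adjointable comp_adjointable scale_adjointable)

lemma closed_subalgebra_hull:
  assumes "S \<subseteq> adjointable X" shows "closed_subalgebra n X (closed_subalgebra n X hull S)"
proof -
  let ?A = "{B. closed_subalgebra n X B \<and> S \<subseteq> B}"
  \<comment> \<open>The family is nonempty, which keeps the intersection inside
    \<open>adjointable X\<close>.\<close>
  have A: "adjointable X \<in> ?A" using assms closed_subalgebra_adjointable by blast
  have B: "closed_subalgebra n X B" if "B \<in> ?A" for B using that by blast
  define H where "H = \<Inter>?A"
  have H: "T \<in> H \<longleftrightarrow> (\<forall>D\<in>?A. T \<in> D)" for T unfolding H_def by blast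
  have "closed_subalgebra n X H"
    unfolding closed_subalgebra_def
  proof (intro conjI ballI allI impI)
    show "H \<subseteq> adjointable X" using A H by blast
    show "0 \<in> H" using B unfolding H closed_subalgebra_def by blast
    fix S T assume ST: "S \<in> H" "T \<in> H"
    thus "S + T \<in> H" "S \<circ> T \<in> H" using B unfolding H closed_subalgebra_def by blast+
  next
    fix c T assume "T \<in> H"
    thus "op_scale n X c T \<in> H" using B unfolding H closed_subalgebra_def by blast
  next
    fix s T assume T: "T \<in> adjointable X" "(\<forall>k. s k \<in> H) \<and> (\<lambda>k. op_norm n X (s k - T)) \<longlonglongrightarrow> 0"
    have "T \<in> D" if "D \<in> ?A" for D
    proof -
      have "\<forall>s. \<forall>T\<in>adjointable X. (\<forall>k. s k \<in> D) \<and> (\<lambda>k. op_norm n X (s k - T)) \<longlonglongrightarrow> 0 \<longrightarrow> T \<in> D"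
        using B[OF that] unfolding closed_subalgebra_def by blast
      thus ?thesis using T that H by blast
    qed
    thus "T \<in> H" using H by blast
  qed
  thus ?thesis by (simp add: hull_def H_def)
qed

lemma zero_sq_summable: "(\<lambda>_. 0) \<in> sq_summable n X"
  by (simp add: sq_summable_def zero_closed trace_ip_def ip_zero_left)

lemma topspace_wstar: "topspace (wstar_topology n X) = adjointable X"
proof -
  let ?S = "{{T \<in> adjointable X. (\<Sum>k. trace_ip n X (x k) (T (y k))) \<in> U} | x y U.
        x \<in> sq_summable n X \<and> y \<in> sq_summable n X \<and> open U}"
  have "{T \<in> adjointable X. (\<Sum>k. trace_ip n X ((\<lambda>_. 0) k) (T ((\<lambda>_. 0) k))) \<in> UNIV} \<in> ?S"
    using zero_sq_summable open_UNIV by blast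
  hence "adjointable X \<in> ?S" by simp
  thus ?thesis unfolding wstar_topology_def topology_generated_by_topspace by blast
qed

lemma trace_ip_zero_left: "y \<in> carr X \<Longrightarrow> trace_ip n X 0 y = 0"
  by (simp add: trace_ip_def ip_zero_left)

lemma wstar_continuous_trace_ip:
  assumes x: "x \<in> carr X" and y: "y \<in> carr X"
  shows "continuous_map (wstar_topology n X) euclidean (\<lambda>T. trace_ip n X x (T y))"
  unfolding continuous_map_def topspace_wstar
proof (intro conjI allI impI)
  fix W :: "complex set" assume "openin euclidean W"
  hence W: "open W" by simp
  \<comment> \<open>A single vector becomes a square-summable sequence supported at 0, so that the
    series defining a subbasic set reduces to one term.\<close>
  define s where "s v = (\<lambda>k::nat. if k = 0 then v else 0)" for v :: 'x
  have s: "s v \<in> sq_summable n X" if v: "v \<in> carr X" for v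
  proof -
    have "Re (trace_ip n X (s v k) (s v k)) = 0" if "k \<notin> {0}" for k
      using that by (simp add: s_def trace_ip_zero_left zero_closed)
    hence "summable (\<lambda>k. Re (trace_ip n X (s v k) (s v k)))" by (rule summable_finite[of "{0}", rotated]) auto
    thus ?thesis using v by (simp add: sq_summable_def s_def zero_closed)
  qed
  have "(\<Sum>k. trace_ip n X (s x k) (T (s y k))) = trace_ip n X x (T y)" if T: "T \<in> adjointable X" for T
    using suminf_finite[of "{0}" "\<lambda>k. trace_ip n X (s x k) (T (s y k))"] adjointable_closed'[OF T]
    by (simp add: s_def trace_ip_zero_left)
  hence "{T \<in> adjointable X. trace_ip n X x (T y) \<in> W}
      = {T \<in> adjointable X. (\<Sum>k. trace_ip n X (s x k) (T (s y k))) \<in> W}" by auto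
  also have "openin (wstar_topology n X) \<dots>"
    unfolding wstar_topology_def
    by (rule topology_generated_by_Basis) (use s x y W in blast)
  finally show "openin (wstar_topology n X) {T \<in> adjointable X. trace_ip n X x (T y) \<in> W}" .
qed simp

lemma normal_functional_closedin:
  assumes "normal_functional n X f"
  shows "closedin (wstar_topology n X) {T \<in> adjointable X. f T = 0}"
  using closedin_continuous_map_preimage[of "wstar_topology n X" euclidean f "{0}"] assms
  by (simp add: normal_functional_def topspace_wstar)

end

definition vertex :: "nat \<Rightarrow> diag" where
  "vertex i = (\<lambda>j. if j = i then 1 else 0)"

lemma vertex_closed: "i < n \<Longrightarrow> vertex i \<in> diag_alg n"
  by (auto simp: vertex_def diag_alg_def)

lemma unit_path_closed:
  assumes "quiver_path n C p j" shows "unit_path p j \<in> carr (path_fock n C)"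
proof -
  have "l2 (\<lambda>q. unit_path p j q l)" for l
    unfolding l2_def
    by (rule finite_nonzero_values_imp_summable_on) (auto simp: unit_path_def intro: finite_subset[of _ "{p}"])
  thus ?thesis using assms by (auto simp: path_carr unit_path_def)
qed

lemma unit_path_ip: "ip (path_fock n C) (unit_path p j) f l = (if l = j then f p j else 0)"
proof -
  have "(\<Sum>\<^sub>\<infinity>q. cnj (unit_path p j q l) * f q l) = (\<Sum>\<^sub>\<infinity>q\<in>{p}. cnj (unit_path p j q l) * f q l)"
    by (rule infsum_cong_neutral) (auto simp: unit_path_def)
  thus ?thesis by (simp add: path_ip l2_ip_def unit_path_def)
qed

section \<open>Coefficients of operators and the triangular algebra\<close>

context fock_coordinates
begin

text \<open>A coordinate is the inner product with a basis vector. Since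
  \<open>unit_path p j\<close> lives in column \<open>j\<close> alone, the sum over columns in
  \<open>trace_ip\<close> has one term, and the coordinate of \<open>T y\<close> becomes an
  ultraweakly continuous vector functional of \<open>T\<close>.\<close>

lemma coordinate_trace_ip:
  assumes p: "quiver_path n C p j" and y: "y \<in> carr F"
  shows "trace_ip n F (V (unit_path p j)) y = U y p j"
proof -
  have "ip F (V (unit_path p j)) y = ip P (unit_path p j) (U y)"
    by (rule ip_U[OF unit_path_closed[OF p] y, symmetric])
  thus ?thesis using path_end[OF p] by (simp add: trace_ip_def unit_path_ip)
qed

lemma coordinate_bound:
  assumes y: "y \<in> carr F" shows "cmod (U y p j) \<le> mnorm n F y"
proof -
  have l2: "l2 (\<lambda>p. U y p j)" using U_closed[OF y] by (simp add: path_carr)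
  have "(cmod (U y p j))\<^sup>2 \<le> l2_sq (\<lambda>p. U y p j)" by (rule l2_sq_point[OF l2])
  also have "\<dots> = Re (ip P (U y) (U y) j)" by (simp add: path_ip l2_ip_self[OF l2])
  also have "\<dots> \<le> (mnorm n F y)\<^sup>2" unfolding U_ip[OF y y] by (rule ip_le_mnorm[OF y])
  finally show ?thesis by (rule power2_le_imp_le) (rule mnorm_nonneg)
qed

lemma normal_functional_coordinate:
  assumes y: "y \<in> carr F" shows "normal_functional n F (\<lambda>T. U (T y) p j)"
  unfolding normal_functional_def
proof (intro conjI exI ballI)
  fix S T assume S: "S \<in> adjointable F" and T: "T \<in> adjointable F"
  have "U (S y) p j - U (T y) p j = U ((S - T) y) p j"
    using U_diff adjointable_closed[OF S y] adjointable_closed[OF T y] by simp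
  also have "cmod \<dots> \<le> mnorm n F ((S - T) y)"
    by (rule coordinate_bound[OF adjointable_closed[OF minus_adjointable[OF S T] y]])
  also have "\<dots> \<le> op_norm n F (S - T) * mnorm n F y"
    by (rule op_norm_bound[OF minus_adjointable[OF S T] y])
  finally show "cmod (U (S y) p j - U (T y) p j) \<le> mnorm n F y * op_norm n F (S - T)"
    by (simp add: mult.commute)
next
  show "continuous_map (wstar_topology n F) euclidean (\<lambda>T. U (T y) p j)"
  proof (cases "quiver_path n C p j")
    case True
    have "continuous_map (wstar_topology n F) euclidean (\<lambda>T. trace_ip n F (V (unit_path p j)) (T y))"
      by (rule wstar_continuous_trace_ip[OF V_closed[OF unit_path_closed[OF True]] y])
    thus ?thesis
      by (rule continuous_map_eq) (simp add: topspace_wstar coordinate_trace_ip[OF True] adjointable_closed y)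
  next
    case False
    have "continuous_map (wstar_topology n F) euclidean (\<lambda>T. 0 :: complex)" by simp
    thus ?thesis
      by (rule continuous_map_eq) (simp add: topspace_wstar U_off[OF _ False] adjointable_closed y)
  qed
qed

text \<open>The coefficients of an operator seen as a noncommutative power series in the edges, read
  off from its value at the vacuum vector of the end vertex. For a creation operator the paths of
  length one return the entries of its vector.\<close>

definition fourier :: "('x \<Rightarrow> 'x) \<Rightarrow> (nat \<times> nat) list \<Rightarrow> nat \<Rightarrow> complex" where
  "fourier T p j = U (T (vac F (vertex j))) p j"

text \<open>
  Only vectors without shorter coordinates are tested, so that the condition is linear in \<open>T\<close> and
  survives ultraweak limits.
\<close>

definition triangular :: "('x \<Rightarrow> 'x) set" where
  "triangular = {T \<in> adjointable F. \<forall>p j. \<forall>y\<in>carr F. quiver_path n C p j \<longrightarrow>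
     (\<forall>q. length q < length p \<longrightarrow> U y q j = 0) \<longrightarrow> U (T y) p j = fourier T [] (src p j) * U y p j}"

lemma triangularD:
  "T \<in> triangular \<Longrightarrow> y \<in> carr F \<Longrightarrow> quiver_path n C p j \<Longrightarrow> (\<And>q. length q < length p \<Longrightarrow> U y q j = 0)
    \<Longrightarrow> U (T y) p j = fourier T [] (src p j) * U y p j"
  unfolding triangular_def by blast

lemma triangular_adjointable: "T \<in> triangular \<Longrightarrow> T \<in> adjointable F"
  unfolding triangular_def by blast

lemma vertex_carr: "i < n \<Longrightarrow> vac F (vertex i) \<in> carr F"
  by (intro vac_closed vertex_closed)

lemma U_vertex: "i < n \<Longrightarrow> U (vac F (vertex i)) p j = (if p = [] \<and> j = i then 1 else 0)"
  unfolding U_vac[OF vertex_closed] path_vac_def by (simp add: vertex_def)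

lemma fourier_add:
  "S \<in> adjointable F \<Longrightarrow> T \<in> adjointable F \<Longrightarrow> j < n \<Longrightarrow> fourier (S + T) p j = fourier S p j + fourier T p j"
  by (simp add: fourier_def U_add adjointable_closed vertex_carr)

lemma fourier_scale:
  "T \<in> adjointable F \<Longrightarrow> j < n \<Longrightarrow> fourier (op_scale n F c T) p j = c * fourier T p j"
  by (simp add: fourier_def op_scale_def U_csc adjointable_closed vertex_carr)

lemma normal_functional_fourier: "j < n \<Longrightarrow> normal_functional n F (\<lambda>T. fourier T p j)"
  unfolding fourier_def by (intro normal_functional_coordinate vertex_carr)

text \<open>No path is shorter than the empty one, so at \<open>[]\<close> triangularity of
  \<open>S\<close> applies to every vector, in particular to the image under \<open>T\<close> of a
  vacuum vector.\<close>

lemma triangular_fourier_mult: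
  assumes S: "S \<in> triangular" and T: "T \<in> adjointable F" and i: "i < n"
  shows "fourier (S \<circ> T) [] i = fourier S [] i * fourier T [] i"
  unfolding fourier_def o_def
  using triangularD[OF S adjointable_closed[OF T vertex_carr[OF i]], of "[]" i] i by (simp add: fourier_def)

lemma triangular_eq:
  "triangular = {T \<in> adjointable F. \<forall>p j. \<forall>y\<in>carr F. quiver_path n C p j \<longrightarrow>
     (\<forall>q. length q < length p \<longrightarrow> U y q j = 0) \<longrightarrow> U (T y) p j - U y p j * fourier T [] (src p j) = 0}"
  unfolding triangular_def by (auto simp: mult.commute)

lemma normal_functional_triangular:
  assumes "y \<in> carr F" "quiver_path n C p j"
  shows "normal_functional n F (\<lambda>T. U (T y) p j - U y p j * fourier T [] (src p j))"
  using assms src_less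
  by (intro normal_functional_diff normal_functional_cmult normal_functional_coordinate normal_functional_fourier) auto

text \<open>If \<open>y\<close> has no coordinates in column \<open>j\<close> shorter than
  \<open>p\<close>, neither has \<open>T y\<close>, so triangularity of \<open>S\<close> applies to
  \<open>T y\<close>.\<close>

lemma triangular_comp:
  assumes S: "S \<in> triangular" and T: "T \<in> triangular"
  shows "S \<circ> T \<in> triangular"
proof -
  note S' = triangular_adjointable[OF S] and T' = triangular_adjointable[OF T]
  have "U (S (T y)) p j = fourier (S \<circ> T) [] (src p j) * U y p j"
    if y: "y \<in> carr F" and p: "quiver_path n C p j" and z: "\<And>q. length q < length p \<Longrightarrow> U y q j = 0" for p j y
  proof -
    have "U (T y) q j = 0" if q: "length q < length p" for q
    proof (cases "quiver_path n C q j")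
      case True
      have "U (T y) q j = fourier T [] (src q j) * U y q j"
        by (rule triangularD[OF T y True]) (use z q in auto)
      thus ?thesis using z[OF q] by simp
    next
      case False
      thus ?thesis by (rule U_off[OF adjointable_closed[OF T' y]])
    qed
    hence "U (S (T y)) p j = fourier S [] (src p j) * U (T y) p j"
      by (rule triangularD[OF S adjointable_closed[OF T' y] p])
    also have "U (T y) p j = fourier T [] (src p j) * U y p j"
      by (rule triangularD[OF T y p z])
    finally show ?thesis using triangular_fourier_mult[OF S T' src_less[OF p]] by simp
  qed
  thus ?thesis unfolding triangular_def using comp_adjointable[OF S' T'] by simp
qed

lemma closed_subalgebra_triangular: "closed_subalgebra n F triangular"
  unfolding closed_subalgebra_def
proof (intro conjI ballI allI impI)
  show "triangular \<subseteq> adjointable F" using triangular_adjointable by blast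
  show "0 \<in> triangular" by (simp add: triangular_def zero_adjointable fourier_def U_zero)
next
  fix S T assume S: "S \<in> triangular" and T: "T \<in> triangular"
  note S' = triangular_adjointable[OF S] and T' = triangular_adjointable[OF T]
  show "S \<circ> T \<in> triangular" by (rule triangular_comp[OF S T])
  have "U ((S + T) y) p j = fourier (S + T) [] (src p j) * U y p j"
    if y: "y \<in> carr F" and p: "quiver_path n C p j" and z: "\<forall>q. length q < length p \<longrightarrow> U y q j = 0" for p j y
    using triangularD[OF S y p] triangularD[OF T y p] z
    by (simp add: fourier_add[OF S' T' src_less[OF p]] U_add adjointable_closed[OF S' y]
        adjointable_closed[OF T' y] distrib_right)
  thus "S + T \<in> triangular" unfolding triangular_def using plus_adjointable[OF S' T'] by blast
next
  fix c T assume T: "T \<in> triangular"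
  note T' = triangular_adjointable[OF T]
  have "U (op_scale n F c T y) p j = fourier (op_scale n F c T) [] (src p j) * U y p j"
    if y: "y \<in> carr F" and p: "quiver_path n C p j" and z: "\<forall>q. length q < length p \<longrightarrow> U y q j = 0" for p j y
  proof -
    have "U (op_scale n F c T y) p j = c * U (T y) p j"
      by (simp add: op_scale_def U_csc adjointable_closed[OF T' y])
    thus ?thesis using triangularD[OF T y p] z by (simp add: fourier_scale[OF T' src_less[OF p]])
  qed
  thus "op_scale n F c T \<in> triangular" unfolding triangular_def using scale_adjointable[OF T'] by blast
next
  fix s T assume T: "T \<in> adjointable F" and s: "(\<forall>k. s k \<in> triangular) \<and> (\<lambda>k. op_norm n F (s k - T)) \<longlonglongrightarrow> 0"
  have "U (T y) p j - U y p j * fourier T [] (src p j) = 0"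
    if y: "y \<in> carr F" and p: "quiver_path n C p j" and z: "\<forall>q. length q < length p \<longrightarrow> U y q j = 0" for p j y
    by (rule normal_functional_limit[OF normal_functional_triangular[OF y p], of s])
       (use T s y p z in \<open>auto simp: triangular_eq\<close>)
  thus "T \<in> triangular" unfolding triangular_eq using T by blast
qed

lemma closedin_triangular: "closedin (wstar_topology n F) triangular"
proof -
  let ?I = "{(p, j, y). y \<in> carr F \<and> quiver_path n C p j \<and> (\<forall>q. length q < length p \<longrightarrow> U y q j = 0)}"
  let ?K = "\<lambda>(p, j, y). {T \<in> adjointable F. U (T y) p j - U y p j * fourier T [] (src p j) = 0}"
  \<comment> \<open>\<open>adjointable F\<close> is the whole space; inserting it makes the family
    visibly nonempty and accounts for the condition \<open>T \<in> adjointable F\<close>.\<close>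
  have "closedin (wstar_topology n F) (\<Inter> (insert (adjointable F) (?K ` ?I)))"
  proof (rule closedin_Inter)
    fix K assume "K \<in> insert (adjointable F) (?K ` ?I)"
    thus "closedin (wstar_topology n F) K"
      using normal_functional_closedin[OF normal_functional_triangular]
        closedin_topspace[of "wstar_topology n F"] by (auto simp: topspace_wstar)
  qed simp
  also have "\<Inter> (insert (adjointable F) (?K ` ?I)) = triangular"
    unfolding triangular_eq by auto
  finally show ?thesis .
qed

lemma U_creation_vertex:
  assumes \<xi>: "\<xi> \<in> carr E" and i: "i < n"
  shows "fourier (creation n E F \<xi>) [] i = 0"
    and "fourier (creation n E F \<xi>) [e] i = \<xi> (fst e) i (snd e)"
  using U_creation[OF \<xi> vertex_carr[OF i]] by (simp_all add: fourier_def path_cons_def U_vertex[OF i])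

lemma fourier_diag_op:
  "a \<in> diag_alg n \<Longrightarrow> i < n \<Longrightarrow> fourier (diag_op n E F a) [] i = a i"
  by (simp add: fourier_def U_diag_op vertex_carr path_diag_def U_vertex)

text \<open>A creation operator lengthens paths by one, so its value at \<open>p\<close> involves
  only a shorter coordinate, which vanishes; its diagonal coefficients are 0 as well. A diagonal
  operator multiplies by its entry at the first vertex.\<close>

lemma generators_triangular:
  "creation n E F ` carr E \<union> diag_op n E F ` diag_alg n \<subseteq> triangular"
proof -
  have "creation n E F \<xi> \<in> triangular" if \<xi>: "\<xi> \<in> carr E" for \<xi>
  proof -
    have "U (creation n E F \<xi> y) p j = 0"
      if y: "y \<in> carr F" and z: "\<forall>q. length q < length p \<longrightarrow> U y q j = 0" for p j y
      using z by (auto simp: U_creation[OF \<xi> y] path_cons_def split: list.splits)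
    thus ?thesis
      unfolding triangular_def using creation_adjointable[OF \<xi>] U_creation_vertex(1)[OF \<xi> src_less] by auto
  qed
  moreover have "diag_op n E F a \<in> triangular" if a: "a \<in> diag_alg n" for a
    unfolding triangular_def
    using diag_op_adjointable[OF a] fourier_diag_op[OF a src_less] by (auto simp: U_diag_op[OF a] path_diag_def)
  ultimately show ?thesis by blast
qed

lemma generators_adjointable:
  "creation n E F ` carr E \<union> diag_op n E F ` diag_alg n \<subseteq> adjointable F"
  using generators_triangular triangular_adjointable by blast

abbreviation "TA \<equiv> tensor_algebra n E F"

lemma closed_subalgebra_tensor_algebra: "closed_subalgebra n F TA"
  unfolding tensor_algebra_def by (rule closed_subalgebra_hull[OF generators_adjointable])

lemma tensor_algebra_minimal:
  "closed_subalgebra n F B \<Longrightarrow> creation n E F ` carr E \<subseteq> B \<Longrightarrow> diag_op n E F ` diag_alg n \<subseteq> B \<Longrightarrow> TA \<subseteq> B"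
  unfolding tensor_algebra_def by (rule hull_minimal) auto

lemma tensor_algebra_triangular: "TA \<subseteq> triangular"
  using tensor_algebra_minimal[OF closed_subalgebra_triangular] generators_triangular by blast

lemma creation_tensor_algebra: "\<xi> \<in> carr E \<Longrightarrow> creation n E F \<xi> \<in> TA"
  unfolding tensor_algebra_def by (rule hull_inc) simp

lemma diag_op_tensor_algebra: "a \<in> diag_alg n \<Longrightarrow> diag_op n E F a \<in> TA"
  unfolding tensor_algebra_def by (rule hull_inc) simp

lemma tensor_algebra_adjointable: "TA \<subseteq> adjointable F"
  using tensor_algebra_triangular triangular_adjointable by blast

lemma tensor_algebra_hardy_algebra: "TA \<subseteq> hardy_algebra n E F"
  unfolding hardy_algebra_def by (rule closure_of_subset) (simp add: topspace_wstar tensor_algebra_adjointable)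

lemma hardy_algebra_triangular: "hardy_algebra n E F \<subseteq> triangular"
  unfolding hardy_algebra_def by (rule closure_of_minimal[OF tensor_algebra_triangular closedin_triangular])

end

section \<open>Linear algebra, and truncation of a matrix entry\<close>

lemma homogeneous_system_nontrivial:
  fixes M :: "'a \<Rightarrow> 'b \<Rightarrow> 'c::field"
  assumes "finite J" "finite I" "card J < card I"
  shows "\<exists>c. (\<exists>t\<in>I. c t \<noteq> 0) \<and> (\<forall>s\<in>J. (\<Sum>t\<in>I. c t * M t s) = 0)"
  using assms
proof (induction J arbitrary: I M rule: finite_induct)
  case empty
  hence "\<exists>t. t \<in> I" by (metis card.empty equals0I less_irrefl)
  thus ?case by (intro exI[of _ "\<lambda>_. 1"]) auto
next
  case (insert u J)
  show ?case
  proof (cases "\<forall>t\<in>I. M t u = 0")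
    case True
    have "card J < card I" using insert.prems insert.hyps by simp
    then obtain c where "\<exists>t\<in>I. c t \<noteq> 0" "\<forall>s\<in>J. (\<Sum>t\<in>I. c t * M t s) = 0"
      using insert.IH[OF insert.prems(1), of M] by blast
    thus ?thesis using True by (intro exI[of _ c]) auto
  next
    case False
    \<comment> \<open>Gaussian elimination: equation \<open>u\<close> is solved for the unknown at
      the pivot \<open>r\<close>, which is then substituted into the other equations.\<close>
    then obtain r where r: "r \<in> I" "M r u \<noteq> 0" by blast
    define I' where "I' = I - {r}"
    have I: "finite I'" "r \<notin> I'" "I = insert r I'" using r insert.prems(1) unfolding I'_def by auto
    have "card J < card I'" using insert.prems insert.hyps I by simp
    then obtain c where c: "\<exists>t\<in>I'. c t \<noteq> 0"
      "\<And>s. s \<in> J \<Longrightarrow> (\<Sum>t\<in>I'. c t * (M t s - M t u / M r u * M r s)) = 0"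
      using insert.IH[OF I(1), of "\<lambda>t s. M t s - M t u / M r u * M r s"] by blast
    define c' where "c' t = (if t = r then - (\<Sum>t\<in>I'. c t * M t u) / M r u else c t)" for t
    have sum: "(\<Sum>t\<in>I. c' t * M t s) = (\<Sum>t\<in>I'. c t * M t s) - (\<Sum>t\<in>I'. c t * M t u) / M r u * M r s" for s
    proof -
      have "(\<Sum>t\<in>I'. c' t * M t s) = (\<Sum>t\<in>I'. c t * M t s)"
        using I(2) by (intro sum.cong) (auto simp: c'_def)
      thus ?thesis unfolding I(3) using I(1,2) by (simp add: c'_def)
    qed
    have "(\<Sum>t\<in>I. c' t * M t s) = 0" if s: "s \<in> J" for s
    proof -
      have "(\<Sum>t\<in>I'. c t * M t s) - (\<Sum>t\<in>I'. c t * M t u) / M r u * M r s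
          = (\<Sum>t\<in>I'. c t * (M t s - M t u / M r u * M r s))"
        by (simp add: right_diff_distrib sum_subtractf sum_distrib_right sum_divide_distrib mult.assoc)
      thus ?thesis using sum c(2)[OF s] by simp
    qed
    moreover have "(\<Sum>t\<in>I. c' t * M t u) = 0" unfolding sum using r(2) by simp
    moreover have "\<exists>t\<in>I. c' t \<noteq> 0" using c(1) I by (auto simp: c'_def)
    ultimately show ?thesis by (intro exI[of _ c']) auto
  qed
qed

text \<open>Keeps the first \<open>r\<close> coordinates of one entry. Raising \<open>r\<close> by
  one adds a multiple of a unit edge, so induction on \<open>r\<close> takes the place of a basis
  expansion.\<close>

definition edge_part :: "nat \<Rightarrow> nat \<Rightarrow> nat \<Rightarrow> (nat \<Rightarrow> nat \<Rightarrow> nat \<Rightarrow> complex) \<Rightarrow> nat \<Rightarrow> nat \<Rightarrow> nat \<Rightarrow> complex" where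
  "edge_part i j r \<xi> = (\<lambda>i' j' k. if i' = i \<and> j' = j \<and> k < r then \<xi> i j k else 0)"

lemma edge_part_closed:
  assumes "\<xi> \<in> carr (matrix_corr n C)" shows "edge_part i j r \<xi> \<in> carr (matrix_corr n C)"
proof -
  have "summable (\<lambda>k. (cmod (edge_part i j r \<xi> i' j' k))\<^sup>2)" for i' j'
    by (rule summable_finite[of "{..<r}"]) (auto simp: edge_part_def)
  moreover have "edge_part i j r \<xi> i' j' k = 0" if "\<not> (i' < n \<and> j' < n \<and> enat k < C i' j')" for i' j' k
    using corr_zero[OF assms that] by (auto simp: edge_part_def)
  ultimately show ?thesis by (fastforce simp: matrix_corr_def hilb_def fun_eq_iff)
qed

section \<open>Edge coefficients, idempotents and corners\<close>

context fock_coordinates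
begin

lemma operator_eqI:
  assumes "S \<in> adjointable F" "T \<in> adjointable F" "\<And>y. y \<in> carr F \<Longrightarrow> U (S y) = U (T y)"
  shows "S = T"
proof
  fix y
  show "S y = T y"
    by (cases "y \<in> carr F") (auto simp: assms adjointable_off adjointable_closed intro: U_inj)
qed

text \<open>A Leibniz rule: \<open>T v\<close> is split into \<open>c v\<close> and a rest
  \<open>y\<close> without vacuum coordinate in column \<open>j\<close>. By triangularity
  \<open>S\<close> multiplies the edge coordinate of \<open>y\<close> by its diagonal coefficient at
  the first vertex, and \<open>c v\<close> contributes the edge coefficient of
  \<open>S\<close>.\<close>

lemma fourier_comp_edge:
  assumes S: "S \<in> triangular" and T: "T \<in> triangular" and e: "quiver_path n C [e] j"
  shows "fourier (S \<circ> T) [e] j = fourier S [] (fst e) * fourier T [e] j + fourier S [e] j * fourier T [] j"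
proof -
  note S' = triangular_adjointable[OF S] and T' = triangular_adjointable[OF T]
  have j: "j < n" by (rule path_end[OF e])
  define v c where "v = vac F (vertex j)" and "c = fourier T [] j"
  have v: "v \<in> carr F" unfolding v_def by (rule vertex_carr[OF j])
  define y where "y = T v - csc n F c v"
  note cl = adjointable_closed[OF S'] adjointable_closed[OF T'] v scalar_closed
  have y: "y \<in> carr F" unfolding y_def by (intro diff_closed cl)
  have "U y [] j = 0"
    by (simp add: y_def U_diff cl U_csc c_def fourier_def v_def U_vertex[OF j] flip: v_def)
       (simp add: v_def U_vertex[OF j])
  hence "U (S y) [e] j = fourier S [] (fst e) * U y [e] j"
    using triangularD[OF S y e] by simp
  also have "U y [e] j = fourier T [e] j"
    using U_vertex[OF j] by (simp add: y_def U_diff cl U_csc fourier_def v_def vertex_carr[OF j])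
  also have "S y = S (T v) - csc n F c (S v)"
    unfolding y_def by (simp add: adjointable_diff[OF S'] adjointable_csc[OF S'] cl)
  also have "U \<dots> [e] j = fourier (S \<circ> T) [e] j - c * fourier S [e] j"
    using U_diff U_csc cl by (simp add: fourier_def v_def vertex_carr[OF j])
  finally show ?thesis by (simp add: c_def algebra_simps)
qed

text \<open>With zero diagonal, \<open>Q\<close> pushes the lowest nonzero coordinates of a vector
  to longer paths, but \<open>Q (Q y) = Q y\<close>. Induction on the length then kills every
  coordinate of \<open>Q y\<close>.\<close>

lemma idempotent_eq_zero:
  assumes Q: "Q \<in> triangular" and idem: "Q \<circ> Q = Q" and zero: "\<And>i. i < n \<Longrightarrow> fourier Q [] i = 0"
  shows "Q = 0"
proof -
  note Q' = triangular_adjointable[OF Q]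
  have "U (Q y) p j = 0" if y: "y \<in> carr F" for p j y
    using y
  proof (induction "length p" arbitrary: p rule: less_induct)
    case less
    show ?case
    proof (cases "quiver_path n C p j")
      case True
      have "U (Q (Q y)) p j = fourier Q [] (src p j) * U (Q y) p j"
        by (rule triangularD[OF Q adjointable_closed[OF Q' y] True]) (use less in auto)
      thus ?thesis using zero[OF src_less[OF True]] idem by (metis comp_apply mult_zero_left)
    next
      case False
      thus ?thesis by (rule U_off[OF adjointable_closed[OF Q' y]])
    qed
  qed
  hence "U (Q y) = U ((0 :: 'x \<Rightarrow> 'x) y)" if "y \<in> carr F" for y
    using that by (simp add: U_zero fun_eq_iff)
  thus ?thesis by (rule operator_eqI[OF Q' zero_adjointable])
qed

abbreviation "proj i \<equiv> diag_op n E F (vertex i)"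
abbreviation "one \<equiv> diag_op n E F (diag_scalar n 1)"

lemma U_one: "y \<in> carr F \<Longrightarrow> U (one y) = U y"
proof -
  assume y: "y \<in> carr F"
  have *: "diag_scalar n 1 (src p j) * U y p j = U y p j" for p j
    using U_off[OF y] src_less by (cases "quiver_path n C p j") (auto simp: diag_scalar_def)
  thus "U (one y) = U y"
    unfolding U_diag_op[OF diag_scalar_closed y] path_diag_def by (intro ext *)
qed

text \<open>\<open>one\<close> is the identity on the carrier and 0 elsewhere. Since operators
  vanish off the carrier, this and not \<open>id\<close> is the unit of the algebras.\<close>

lemma one_comp: "T \<in> adjointable F \<Longrightarrow> one \<circ> T = T" and comp_one: "T \<in> adjointable F \<Longrightarrow> T \<circ> one = T"
proof -
  assume T: "T \<in> adjointable F"
  note o = diag_op_adjointable[OF diag_scalar_closed[of n 1]]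
  have "one y = y" if "y \<in> carr F" for y
    by (rule U_inj[OF adjointable_closed[OF o that] that U_one[OF that]])
  moreover have "one y = 0" if "y \<notin> carr F" for y by (rule adjointable_off[OF o that])
  ultimately show "one \<circ> T = T" "T \<circ> one = T"
    using adjointable_closed'[OF T] adjointable_off[OF T] adjointable_zero[OF T]
    by (auto simp: fun_eq_iff) metis
qed

lemma diag_op_add:
  assumes "a \<in> diag_alg n" "b \<in> diag_alg n"
  shows "diag_op n E F (a + b) = diag_op n E F a + diag_op n E F b"
proof -
  have ab: "a + b \<in> diag_alg n" using assms by (simp add: diag_alg_def)
  note cl = diag_op_adjointable[OF assms(1)] diag_op_adjointable[OF assms(2)]
  show ?thesis
    by (rule operator_eqI[OF diag_op_adjointable[OF ab] plus_adjointable[OF cl]])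
       (simp add: U_diag_op ab assms U_add adjointable_closed[OF cl(1)] adjointable_closed[OF cl(2)]
         path_diag_def fun_eq_iff distrib_right)
qed

lemma diag_op_zero: "diag_op n E F 0 = 0"
  by (rule operator_eqI[OF diag_op_adjointable[OF diag_alg_zero] zero_adjointable])
     (simp add: U_diag_op diag_alg_zero U_zero path_diag_def fun_eq_iff)

lemma diag_op_mult:
  assumes "a \<in> diag_alg n" "b \<in> diag_alg n"
  shows "diag_op n E F a \<circ> diag_op n E F b = diag_op n E F (a * b)"
proof -
  have ab: "a * b \<in> diag_alg n" using assms by (simp add: diag_alg_def)
  note cl = diag_op_adjointable[OF assms(1)] diag_op_adjointable[OF assms(2)]
  show ?thesis
    by (rule operator_eqI[OF comp_adjointable[OF cl] diag_op_adjointable[OF ab]])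
       (simp add: U_diag_op ab assms adjointable_closed[OF cl(2)] path_diag_def fun_eq_iff mult.assoc)
qed

lemma diag_op_scale:
  assumes "a \<in> diag_alg n"
  shows "op_scale n F c (diag_op n E F a) = diag_op n E F (\<lambda>i. c * a i)"
proof -
  have ca: "(\<lambda>i. c * a i) \<in> diag_alg n" using assms by (simp add: diag_alg_def)
  note cl = diag_op_adjointable[OF assms]
  show ?thesis
    by (rule operator_eqI[OF scale_adjointable[OF cl] diag_op_adjointable[OF ca]])
       (simp add: U_diag_op ca assms op_scale_def U_csc adjointable_closed[OF cl] path_diag_def fun_eq_iff mult.assoc)
qed

lemma creation_add:
  assumes "\<xi> \<in> carr E" "\<eta> \<in> carr E" "\<xi> + \<eta> \<in> carr E"
  shows "creation n E F (\<xi> + \<eta>) = creation n E F \<xi> + creation n E F \<eta>"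
proof -
  note cl = creation_adjointable[OF assms(1)] creation_adjointable[OF assms(2)]
  show ?thesis
    by (rule operator_eqI[OF creation_adjointable[OF assms(3)] plus_adjointable[OF cl]])
       (simp add: U_creation assms U_add adjointable_closed[OF cl(1)] adjointable_closed[OF cl(2)]
         path_cons_def fun_eq_iff distrib_right split: list.splits)
qed

lemma creation_scale:
  assumes "\<xi> \<in> carr E" "(\<lambda>i j k. c * \<xi> i j k) \<in> carr E"
  shows "creation n E F (\<lambda>i j k. c * \<xi> i j k) = op_scale n F c (creation n E F \<xi>)"
proof -
  note cl = creation_adjointable[OF assms(1)]
  show ?thesis
    by (rule operator_eqI[OF creation_adjointable[OF assms(2)] scale_adjointable[OF cl]])
       (simp add: U_creation assms op_scale_def U_csc adjointable_closed[OF cl]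
         path_cons_def fun_eq_iff mult.assoc split: list.splits)
qed

lemma creation_zero: "0 \<in> carr E" "creation n E F 0 = 0"
proof -
  show *: "0 \<in> carr E" by (auto simp: matrix_corr_def hilb_def)
  show "creation n E F 0 = 0"
    by (rule operator_eqI[OF creation_adjointable[OF *] zero_adjointable])
       (simp add: U_creation[OF *] U_zero path_cons_def fun_eq_iff split: list.splits)
qed

text \<open>The compression leaves a single block of \<open>\<xi>\<close>. That block has only
  \<open>d\<close> coordinates, so truncation after \<open>d\<close> edges loses nothing.\<close>

lemma creation_corner:
  assumes \<xi>: "\<xi> \<in> carr E" and i: "i < n" and j: "j < n" and d: "C i j = enat d"
  shows "proj i \<circ> creation n E F \<xi> \<circ> proj j = creation n E F (edge_part i j d \<xi>)"
proof -
  note v = vertex_closed[OF i] vertex_closed[OF j] and c = creation_adjointable[OF \<xi>]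
  note pi = diag_op_adjointable[OF v(1)] and pj = diag_op_adjointable[OF v(2)]
  have z: "\<xi> i j k = 0" if "\<not> k < d" for k using that d by (intro corr_zero[OF \<xi>]) simp
  show ?thesis
  proof (rule operator_eqI)
    show "proj i \<circ> creation n E F \<xi> \<circ> proj j \<in> adjointable F" by (intro comp_adjointable pi pj c)
    show "creation n E F (edge_part i j d \<xi>) \<in> adjointable F"
      by (rule creation_adjointable[OF edge_part_closed[OF \<xi>]])
    fix y assume y: "y \<in> carr F"
    have "U ((proj i \<circ> creation n E F \<xi> \<circ> proj j) y) = path_diag (vertex i) (path_cons \<xi> (path_diag (vertex j) (U y)))"
      by (simp add: U_diag_op[OF v(1)] U_diag_op[OF v(2)] U_creation[OF \<xi>] y
          adjointable_closed[OF pj] adjointable_closed[OF c])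
    also have "\<dots> = path_cons (edge_part i j d \<xi>) (U y)"
      using z by (auto simp: path_diag_def path_cons_def edge_part_def vertex_def fun_eq_iff split: list.splits)
    finally show "U ((proj i \<circ> creation n E F \<xi> \<circ> proj j) y) = U (creation n E F (edge_part i j d \<xi>) y)"
      by (simp add: U_creation[OF edge_part_closed[OF \<xi>] y])
  qed
qed

lemma proj_comp: "i < n \<Longrightarrow> j < n \<Longrightarrow> proj i \<circ> proj j = (if i = j then proj i else 0)"
proof -
  assume i: "i < n" "j < n"
  have "vertex i * vertex j = (if i = j then vertex i else 0)" by (auto simp: vertex_def fun_eq_iff)
  thus ?thesis using i by (simp add: diag_op_mult vertex_closed diag_op_zero)
qed

lemma diag_op_corner:
  assumes a: "a \<in> diag_alg n" and i: "i < n" and j: "j < n"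
  shows "proj i \<circ> diag_op n E F a \<circ> proj j = (if i = j then op_scale n F (a i) (proj i) else 0)"
proof -
  have "vertex i * a \<in> diag_alg n" using a by (simp add: diag_alg_def)
  hence "proj i \<circ> diag_op n E F a \<circ> proj j = diag_op n E F (vertex i * a * vertex j)"
    using a i j by (simp add: diag_op_mult vertex_closed)
  moreover have "vertex i * a * vertex j = (if i = j then (\<lambda>l. a i * vertex i l) else 0)"
    by (auto simp: vertex_def fun_eq_iff)
  ultimately show ?thesis using i by (simp add: diag_op_scale vertex_closed diag_op_zero)
qed

lemma creation_edge_part_Suc:
  assumes \<xi>: "\<xi> \<in> carr E" and u: "unit_edge i j r \<in> carr E"
  shows "creation n E F (edge_part i j (Suc r) \<xi>)
    = creation n E F (edge_part i j r \<xi>) + op_scale n F (\<xi> i j r) (creation n E F (unit_edge i j r))"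
proof -
  have eq: "(\<lambda>i' j' k. \<xi> i j r * unit_edge i j r i' j' k) = lmul E (\<lambda>_. \<xi> i j r) (unit_edge i j r)"
    by (simp add: matrix_corr_def)
  have c: "(\<lambda>i' j' k. \<xi> i j r * unit_edge i j r i' j' k) \<in> carr E"
    unfolding eq by (rule lmul_closed[OF u])
  have sum: "edge_part i j (Suc r) \<xi> = edge_part i j r \<xi> + (\<lambda>i' j' k. \<xi> i j r * unit_edge i j r i' j' k)"
    by (auto simp: edge_part_def unit_edge_def fun_eq_iff less_Suc_eq)
  show ?thesis
    unfolding creation_scale[OF u c, symmetric] sum
    by (rule creation_add[OF edge_part_closed[OF \<xi>] c]) (use edge_part_closed[OF \<xi>] sum in metis)
qed

lemma edge_part_0: "edge_part i j 0 \<xi> = 0"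
  by (simp add: edge_part_def fun_eq_iff)

end

section \<open>Vertices and edges under an isomorphism\<close>

text \<open>Covers both statements: \<open>A\<close> and \<open>A'\<close> stand for the tensor
  algebras or for the Hardy algebras. The assumption \<open>extension\<close> is the density needed
  to pass from the generated algebra to \<open>A\<close>: it is trivial for the tensor algebra and
  ultraweak continuity of \<open>\<alpha>\<close> for the Hardy algebra.\<close>

locale algebra_isomorphism =
  B: fock_coordinates n C F U V + B': fock_coordinates m C' F' U' V'
  for n :: nat and C :: "nat \<Rightarrow> nat \<Rightarrow> enat"
    and F :: "(nat \<Rightarrow> nat \<Rightarrow> nat \<Rightarrow> complex, 'x::ab_group_add) fock" and U V
    and m :: nat and C' :: "nat \<Rightarrow> nat \<Rightarrow> enat"
    and F' :: "(nat \<Rightarrow> nat \<Rightarrow> nat \<Rightarrow> complex, 'y::ab_group_add) fock" and U' V' +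
  fixes A :: "('x \<Rightarrow> 'x) set" and A' :: "('y \<Rightarrow> 'y) set" and \<alpha> :: "('x \<Rightarrow> 'x) \<Rightarrow> 'y \<Rightarrow> 'y"
  assumes TA_A: "B.TA \<subseteq> A" and A_triangular: "A \<subseteq> B.triangular"
    and TA_A': "B'.TA \<subseteq> A'" and A'_triangular: "A' \<subseteq> B'.triangular"
    and iso: "isometric_isomorphism n F A m F' A' \<alpha>"
    and extension: "normal_functional m F' f \<Longrightarrow> (\<And>T. T \<in> B.TA \<Longrightarrow> f (\<alpha> T) = 0) \<Longrightarrow> T \<in> A \<Longrightarrow> f (\<alpha> T) = 0"
begin

lemma \<alpha>_bij: "bij_betw \<alpha> A A'"
  and \<alpha>_add: "S \<in> A \<Longrightarrow> T \<in> A \<Longrightarrow> \<alpha> (S + T) = \<alpha> S + \<alpha> T"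
  and \<alpha>_comp: "S \<in> A \<Longrightarrow> T \<in> A \<Longrightarrow> \<alpha> (S \<circ> T) = \<alpha> S \<circ> \<alpha> T"
  and \<alpha>_scale: "T \<in> A \<Longrightarrow> \<alpha> (op_scale n F c T) = op_scale m F' c (\<alpha> T)"
  and \<alpha>_norm: "T \<in> A \<Longrightarrow> op_norm m F' (\<alpha> T) = op_norm n F T"
  using iso unfolding isometric_isomorphism_def by blast+

lemma TA: "T \<in> B.TA \<Longrightarrow> T \<in> A" and TA': "T' \<in> B'.TA \<Longrightarrow> T' \<in> A'"
  using TA_A TA_A' by blast+

lemma TA_zero: "0 \<in> B.TA"
  and TA_add: "S \<in> B.TA \<Longrightarrow> T \<in> B.TA \<Longrightarrow> S + T \<in> B.TA"
  and TA_comp: "S \<in> B.TA \<Longrightarrow> T \<in> B.TA \<Longrightarrow> S \<circ> T \<in> B.TA"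
  and TA_scale: "T \<in> B.TA \<Longrightarrow> op_scale n F c T \<in> B.TA"
  and TA_limit: "(\<And>k. s k \<in> B.TA) \<Longrightarrow> T \<in> adjointable F \<Longrightarrow> (\<lambda>k. op_norm n F (s k - T)) \<longlonglongrightarrow> 0 \<Longrightarrow> T \<in> B.TA"
  using B.closed_subalgebra_tensor_algebra unfolding closed_subalgebra_def by blast+

lemma \<alpha>_closed: "T \<in> A \<Longrightarrow> \<alpha> T \<in> A'"
  using \<alpha>_bij bij_betw_apply by metis

lemma \<alpha>_surj: "T' \<in> A' \<Longrightarrow> \<exists>T\<in>A. \<alpha> T = T'"
  using bij_betw_imp_surj_on[OF \<alpha>_bij] by (metis imageE)

lemma \<alpha>_triangular: "T \<in> A \<Longrightarrow> \<alpha> T \<in> B'.triangular"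
  using \<alpha>_closed A'_triangular by blast

lemma \<alpha>_adjointable: "T \<in> A \<Longrightarrow> \<alpha> T \<in> adjointable F'"
  using \<alpha>_triangular B'.triangular_adjointable by blast

lemma A_adjointable: "T \<in> A \<Longrightarrow> T \<in> adjointable F"
  using A_triangular B.triangular_adjointable by blast

lemma \<alpha>_zero: "\<alpha> 0 = 0"
  using \<alpha>_add[OF TA[OF TA_zero] TA[OF TA_zero]] by simp

lemma TA_proj: "i < n \<Longrightarrow> B.proj i \<in> B.TA"
  by (intro B.diag_op_tensor_algebra vertex_closed)

text \<open>Preservation of the unit is not part of \<open>isometric_isomorphism\<close>. It follows
  from surjectivity: the unit of \<open>A'\<close> has a preimage \<open>T\<close>, and
  \<open>B.one \<circ> T = T\<close>.\<close>

lemma \<alpha>_one: "\<alpha> B.one = B'.one"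
proof -
  have one: "B.one \<in> A" "B'.one \<in> A'"
    by (intro TA TA' B.diag_op_tensor_algebra B'.diag_op_tensor_algebra diag_scalar_closed)+
  obtain T where T: "T \<in> A" "\<alpha> T = B'.one"
    using \<alpha>_surj[OF one(2)] by (elim bexE)
  have "\<alpha> B.one = \<alpha> B.one \<circ> B'.one" by (simp only: B'.comp_one[OF \<alpha>_adjointable[OF one(1)]])
  also have "\<dots> = \<alpha> (B.one \<circ> T)" using \<alpha>_comp[OF one(1) T(1)] T(2) by simp
  also have "\<dots> = B'.one" using B.one_comp[OF A_adjointable[OF T(1)]] T(2) by simp
  finally show ?thesis .
qed

section \<open>Pulled back characters and the map of vertices\<close>

definition eta :: "nat \<Rightarrow> ('x \<Rightarrow> 'x) \<Rightarrow> complex" where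
  "eta k T = B'.fourier (\<alpha> T) [] k"

lemma eta_add: "S \<in> A \<Longrightarrow> T \<in> A \<Longrightarrow> k < m \<Longrightarrow> eta k (S + T) = eta k S + eta k T"
  by (simp add: eta_def \<alpha>_add B'.fourier_add \<alpha>_adjointable)

lemma eta_comp: "S \<in> A \<Longrightarrow> T \<in> A \<Longrightarrow> k < m \<Longrightarrow> eta k (S \<circ> T) = eta k S * eta k T"
  by (simp add: eta_def \<alpha>_comp B'.triangular_fourier_mult \<alpha>_triangular \<alpha>_adjointable)

lemma eta_zero: "eta k 0 = 0"
  by (simp add: eta_def \<alpha>_zero B'.fourier_def B'.U_zero)

lemma eta_one: "k < m \<Longrightarrow> eta k B.one = 1"
  by (simp add: eta_def \<alpha>_one B'.fourier_diag_op diag_scalar_closed) (simp add: diag_scalar_def)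

lemma eta_proj_cases: "i < n \<Longrightarrow> k < m \<Longrightarrow> eta k (B.proj i) = 0 \<or> eta k (B.proj i) = 1"
  using eta_comp[of "B.proj i" "B.proj i" k] B.proj_comp[of i i] TA[OF TA_proj[of i]] by simp

lemma eta_proj_disjoint:
  assumes i: "i < n" and j: "j < n" and k: "k < m" and "eta k (B.proj i) = 1" "i \<noteq> j"
  shows "eta k (B.proj j) = 0"
  using eta_comp[OF TA[OF TA_proj[OF i]] TA[OF TA_proj[OF j]] k] B.proj_comp[OF i j] assms(4,5)
  by (simp add: eta_zero)

text \<open>The vertex projections add up to the unit, where the character is 1, so it cannot be 0
  at all of them. The diagonals \<open>q r\<close> are the partial sums.\<close>

lemma eta_proj_exists: assumes k: "k < m" shows "\<exists>i<n. eta k (B.proj i) = 1"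
proof (rule ccontr)
  assume "\<not> ?thesis"
  hence z: "eta k (B.proj i) = 0" if "i < n" for i using eta_proj_cases[OF that k] that by blast
  define q where "q r = (\<lambda>i. if i < r then 1 else 0 :: complex)" for r :: nat
  have "eta k (diag_op n B.E F (q r)) = 0" if "r \<le> n" for r
    using that
  proof (induction r)
    case 0
    have q0: "q 0 = 0" unfolding q_def by (rule ext) simp
    show ?case unfolding q0 B.diag_op_zero by (rule eta_zero)
  next
    case (Suc r)
    have q: "q r \<in> diag_alg n" "vertex r \<in> diag_alg n"
      using Suc.prems by (auto simp: q_def diag_alg_def vertex_def)
    have q_Suc: "q (Suc r) = q r + vertex r" by (auto simp: q_def vertex_def fun_eq_iff)
    have "eta k (diag_op n B.E F (q (Suc r))) = eta k (diag_op n B.E F (q r)) + eta k (B.proj r)"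
      unfolding q_Suc B.diag_op_add[OF q]
      by (intro eta_add k TA B.diag_op_tensor_algebra q)
    thus ?case using Suc z by simp
  qed
  moreover have "q n = diag_scalar n 1" by (simp add: q_def diag_scalar_def fun_eq_iff)
  ultimately show False using eta_one[OF k] by (metis order_refl zero_neq_one)
qed

lemma proj_eta_exists: assumes i: "i < n" shows "\<exists>k<m. eta k (B.proj i) = 1"
proof (rule ccontr)
  assume "\<not> ?thesis"
  hence z: "eta k (B.proj i) = 0" if "k < m" for k using eta_proj_cases[OF i that] that by blast
  note p = TA[OF TA_proj[OF i]]
  have "\<alpha> (B.proj i) \<circ> \<alpha> (B.proj i) = \<alpha> (B.proj i)"
    using \<alpha>_comp[OF p p] B.proj_comp[OF i i] by simp
  hence "\<alpha> (B.proj i) = 0"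
    using B'.idempotent_eq_zero[OF \<alpha>_triangular[OF p]] z unfolding eta_def by blast
  hence "B.proj i = 0"
    using \<alpha>_bij p TA[OF TA_zero] \<alpha>_zero unfolding bij_betw_def by (metis inj_onD)
  moreover have "B.fourier (B.proj i) [] i = 1"
    using B.fourier_diag_op[OF vertex_closed[OF i] i] by (simp add: vertex_def)
  ultimately show False by (simp add: B.fourier_def B.U_zero)
qed

lemma \<alpha>_diff: assumes S: "S \<in> B.TA" and T: "T \<in> B.TA" shows "\<alpha> (S - T) = \<alpha> S - \<alpha> T" "S - T \<in> B.TA"
proof -
  note A = TA[OF S] TA[OF T] TA[OF TA_scale[OF T]]
  have eq: "S - T = S + op_scale n F (-1) T"
    by (rule B.minus_eq_scale) (use A A_adjointable in auto)
  show "\<alpha> (S - T) = \<alpha> S - \<alpha> T"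
    unfolding eq using B'.minus_eq_scale[OF \<alpha>_adjointable[OF A(1)] \<alpha>_adjointable[OF A(2)]]
    by (simp add: \<alpha>_add A \<alpha>_scale)
  show "S - T \<in> B.TA" unfolding eq by (intro TA_add TA_scale S T)
qed

text \<open>
  Compressing an operator by the two vertex projections does not change the value of the derivation,
  so that only the edges between the two vertices matter.
\<close>

lemma derivation_vanishes:
  assumes f: "normal_functional m F' f"
    and f_add: "\<And>S T. S \<in> adjointable F' \<Longrightarrow> T \<in> adjointable F' \<Longrightarrow> f (S + T) = f S + f T"
    and f_scale: "\<And>c T. T \<in> adjointable F' \<Longrightarrow> f (op_scale m F' c T) = c * f T"
    and f_comp: "\<And>S T. S \<in> A \<Longrightarrow> T \<in> A \<Longrightarrow> f (\<alpha> (S \<circ> T)) = eta k S * f (\<alpha> T) + f (\<alpha> S) * eta l T"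
    and k: "k < m" and l: "l < m" and i: "i < n" and j: "j < n"
    and eta_i: "eta k (B.proj i) = 1" and eta_j: "eta l (B.proj j) = 1"
    and f_i: "f (\<alpha> (B.proj i)) = 0"
    and d: "C i j = enat d" and f_edge: "\<And>s. s < d \<Longrightarrow> f (\<alpha> (creation n B.E F (unit_edge i j s))) = 0"
    and T: "T \<in> A"
  shows "f (\<alpha> T) = 0"
proof -
  define \<delta> where "\<delta> T = f (\<alpha> T)" for T
  have \<delta>_add: "\<delta> (S + T) = \<delta> S + \<delta> T" if "S \<in> A" "T \<in> A" for S T
    unfolding \<delta>_def using that by (simp add: \<alpha>_add f_add \<alpha>_adjointable)
  have \<delta>_scale: "\<delta> (op_scale n F c T) = c * \<delta> T" if "T \<in> A" for c T
    unfolding \<delta>_def using that by (simp add: \<alpha>_scale f_scale \<alpha>_adjointable)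
  have \<delta>_comp: "\<delta> (S \<circ> T) = eta k S * \<delta> T + \<delta> S * eta l T" if "S \<in> A" "T \<in> A" for S T
    unfolding \<delta>_def by (rule f_comp[OF that])
  have \<delta>_zero: "\<delta> 0 = 0" using \<delta>_add[OF TA[OF TA_zero] TA[OF TA_zero]] by simp
  note p = TA_proj[OF i] TA_proj[OF j]
  have \<delta>_i: "\<delta> (B.proj i) = 0" unfolding \<delta>_def by (rule f_i)
  \<comment> \<open>For \<open>i \<noteq> j\<close> the derivation rule is applied to
    \<open>B.proj i \<circ> B.proj j = 0\<close>: at the first factor \<open>eta k\<close> is 1 and
    \<open>\<delta>\<close> is 0, so only \<open>\<delta> (B.proj j)\<close> remains.\<close>
  have \<delta>_j: "\<delta> (B.proj j) = 0"
  proof (cases "i = j")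
    case False
    hence "\<delta> (B.proj i \<circ> B.proj j) = 0" using B.proj_comp[OF i j] \<delta>_zero by simp
    thus ?thesis using \<delta>_comp[OF TA[OF p(1)] TA[OF p(2)]] eta_i \<delta>_i by simp
  qed (use \<delta>_i in simp)
  have corner: "\<delta> T = \<delta> (B.proj i \<circ> T \<circ> B.proj j)" if T: "T \<in> B.TA" for T
    using \<delta>_comp[OF TA[OF TA_comp[OF p(1) T]] TA[OF p(2)]] \<delta>_comp[OF TA[OF p(1)] TA[OF T]]
    by (simp add: eta_i eta_j \<delta>_i \<delta>_j)
  have "\<delta> (diag_op n B.E F a) = 0" if a: "a \<in> diag_alg n" for a
    unfolding corner[OF B.diag_op_tensor_algebra[OF a]] B.diag_op_corner[OF a i j]
    using \<delta>_scale[OF TA[OF p(1)], of "a i"] \<delta>_i \<delta>_zero by (cases "i = j") simp_all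
  moreover have "\<delta> (creation n B.E F \<xi>) = 0" if \<xi>: "\<xi> \<in> carr B.E" for \<xi>
  proof -
    have "\<delta> (creation n B.E F (edge_part i j r \<xi>)) = 0" if "r \<le> d" for r
      using that
    proof (induction r)
      case 0
      show ?case unfolding B.edge_part_0 B.creation_zero(2) by (rule \<delta>_zero)
    next
      case (Suc r)
      have u: "unit_edge i j r \<in> carr B.E"
        using Suc.prems by (intro unit_edge_closed i j) (simp add: d)
      note c = B.creation_tensor_algebra[OF edge_part_closed[OF \<xi>]] B.creation_tensor_algebra[OF u]
      have "\<delta> (creation n B.E F (unit_edge i j r)) = 0"
        unfolding \<delta>_def by (rule f_edge) (use Suc.prems in simp)
      hence "\<delta> (op_scale n F (\<xi> i j r) (creation n B.E F (unit_edge i j r))) = 0"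
        using \<delta>_scale[OF TA[OF c(2)]] by simp
      moreover have "\<delta> (creation n B.E F (edge_part i j r \<xi>)) = 0" using Suc by simp
      ultimately show ?case
        unfolding B.creation_edge_part_Suc[OF \<xi> u] \<delta>_add[OF TA[OF c(1)] TA[OF TA_scale[OF c(2)]]] by simp
    qed
    thus ?thesis
      unfolding corner[OF B.creation_tensor_algebra[OF \<xi>]] B.creation_corner[OF \<xi> i j d] by simp
  qed
  \<comment> \<open>The kernel of a derivation is a subalgebra; once it contains the generators and
    is closed in norm, it is the whole tensor algebra.\<close>
  moreover define K where "K = {T \<in> B.TA. \<delta> T = 0}"
  have K: "T \<in> K \<longleftrightarrow> T \<in> B.TA \<and> \<delta> T = 0" for T unfolding K_def by simp
  have "closed_subalgebra n F K"
    unfolding closed_subalgebra_def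
  proof (intro conjI ballI allI impI)
    show "K \<subseteq> adjointable F" using TA A_adjointable K by blast
    show "0 \<in> K" unfolding K using TA_zero \<delta>_zero by blast
  next
    fix S T assume "S \<in> K" "T \<in> K"
    hence ST: "S \<in> B.TA" "T \<in> B.TA" "\<delta> S = 0" "\<delta> T = 0" unfolding K by auto
    show "S + T \<in> K"
      unfolding K \<delta>_add[OF TA[OF ST(1)] TA[OF ST(2)]] using TA_add[OF ST(1,2)] ST(3,4) by simp
    show "S \<circ> T \<in> K"
      unfolding K \<delta>_comp[OF TA[OF ST(1)] TA[OF ST(2)]] using TA_comp[OF ST(1,2)] ST(3,4) by simp
  next
    fix c T assume "T \<in> K"
    hence T: "T \<in> B.TA" "\<delta> T = 0" unfolding K by auto
    show "op_scale n F c T \<in> K" unfolding K \<delta>_scale[OF TA[OF T(1)]] using TA_scale[OF T(1)] T(2) by simp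
  next
    fix s T assume T: "T \<in> adjointable F" and s: "(\<forall>k. s k \<in> K) \<and> (\<lambda>k. op_norm n F (s k - T)) \<longlonglongrightarrow> 0"
    have sT: "s k \<in> B.TA" "f (\<alpha> (s k)) = 0" for k using s unfolding K \<delta>_def by auto
    have lim: "(\<lambda>k. op_norm n F (s k - T)) \<longlonglongrightarrow> 0" using s by blast
    have TT: "T \<in> B.TA" by (rule TA_limit[OF sT(1) T lim])
    \<comment> \<open>Preservation of norms turns the convergence of \<open>s k\<close> into that of
      the images, along which \<open>f\<close> is continuous.\<close>
    have "op_norm m F' (\<alpha> (s k) - \<alpha> T) = op_norm n F (s k - T)" for k
      using \<alpha>_norm[OF TA[OF \<alpha>_diff(2)[OF sT(1) TT]]] unfolding \<alpha>_diff(1)[OF sT(1) TT] .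
    hence "(\<lambda>k. op_norm m F' (\<alpha> (s k) - \<alpha> T)) \<longlonglongrightarrow> 0" using lim by presburger
    hence "f (\<alpha> T) = 0"
      by (rule normal_functional_limit[OF f \<alpha>_adjointable[OF TA[OF sT(1)]] sT(2) \<alpha>_adjointable[OF TA[OF TT]]])
    thus "T \<in> K" using TT unfolding K \<delta>_def by blast
  qed
  ultimately have "B.TA \<subseteq> K"
    using B.creation_tensor_algebra B.diag_op_tensor_algebra
    by (intro B.tensor_algebra_minimal) (auto simp: K)
  hence "\<forall>T\<in>B.TA. \<delta> T = 0" using K by blast
  hence "f (\<alpha> T) = 0" if "T \<in> B.TA" for T using that unfolding \<delta>_def by blast
  thus ?thesis by (rule extension[OF f _ T])
qed

lemma edge_bound:
  assumes k: "k < m" and l: "l < m" and i: "i < n" and j: "j < n"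
    and eta_i: "eta k (B.proj i) = 1" and eta_j: "eta l (B.proj j) = 1"
  shows "C' k l \<le> C i j"
proof (rule ccontr)
  assume less: "\<not> C' k l \<le> C i j"
  then obtain d where d: "C i j = enat d" by (cases "C i j") auto
  have path: "quiver_path m C' [(k, t)] l" if "t \<le> d" for t
  proof -
    have "enat t \<le> C i j" using that d by simp
    thus ?thesis using less k l by simp
  qed
  define g where "g t T = B'.fourier T [(k, t)] l" for t T
  define h where "h T = B'.fourier T [] k - B'.fourier T [] l" for T
  \<comment> \<open>\<open>h\<close> is the inner derivation between the two characters; at the
    projection it is \<open>1 - eta l (B.proj i)\<close>. Idempotency gives
    \<open>b t * eta l (B.proj i) = 0\<close>, so subtracting \<open>b t\<close> times
    \<open>h\<close> makes \<open>g t\<close> vanish there.\<close>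
  define b where "b t = g t (\<alpha> (B.proj i))" for t
  \<comment> \<open>\<open>{..d}\<close> has one element more than \<open>{..<d}\<close>:
    \<open>d + 1\<close> unknowns for \<open>d\<close> equations.\<close>
  let ?I = "{..d}"
  obtain c where c: "\<exists>t\<in>?I. c t \<noteq> 0"
    "\<And>s. s < d \<Longrightarrow> (\<Sum>t\<in>?I. c t * (g t (\<alpha> (creation n B.E F (unit_edge i j s)))
        - b t * h (\<alpha> (creation n B.E F (unit_edge i j s))))) = 0"
    using homogeneous_system_nontrivial[of "{..<d}" ?I
        "\<lambda>t s. g t (\<alpha> (creation n B.E F (unit_edge i j s))) - b t * h (\<alpha> (creation n B.E F (unit_edge i j s)))"]
    by auto
  define f where "f T = (\<Sum>t\<in>?I. c t * (g t T - b t * h T))" for T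
  have g_comp: "g t (\<alpha> (S \<circ> T)) = eta k S * g t (\<alpha> T) + g t (\<alpha> S) * eta l T"
    if "S \<in> A" "T \<in> A" "t \<le> d" for S T t
    using B'.fourier_comp_edge[OF \<alpha>_triangular[OF that(1)] \<alpha>_triangular[OF that(2)] path[OF that(3)]]
    by (simp add: g_def eta_def \<alpha>_comp[OF that(1,2)])
  have h_comp: "h (\<alpha> (S \<circ> T)) = eta k S * h (\<alpha> T) + h (\<alpha> S) * eta l T" if "S \<in> A" "T \<in> A" for S T
    using eta_comp[OF that k] eta_comp[OF that l] by (simp add: h_def eta_def algebra_simps)
  have "g t (\<alpha> (B.proj i)) - b t * h (\<alpha> (B.proj i)) = 0" if t: "t \<le> d" for t
  proof -
    have "b t = b t + b t * eta l (B.proj i)"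
      using g_comp[OF TA[OF TA_proj[OF i]] TA[OF TA_proj[OF i]] t] B.proj_comp[OF i i] eta_i
      by (simp add: b_def)
    moreover have "h (\<alpha> (B.proj i)) = 1 - eta l (B.proj i)" using eta_i by (simp add: h_def eta_def)
    ultimately show ?thesis unfolding b_def[symmetric] by auto
  qed
  hence f_i: "f (\<alpha> (B.proj i)) = 0" unfolding f_def by (intro sum.neutral) auto
  have f_zero: "f (\<alpha> T) = 0" if T: "T \<in> A" for T
  proof (rule derivation_vanishes[where f=f, OF _ _ _ _ k l i j eta_i eta_j f_i d _ T])
    show "normal_functional m F' f"
      unfolding f_def g_def h_def
      by (intro normal_functional_sum normal_functional_cmult normal_functional_diff
          B'.normal_functional_fourier k l)
    show "f (S + T) = f S + f T" if "S \<in> adjointable F'" "T \<in> adjointable F'" for S T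
      unfolding f_def sum.distrib[symmetric] using that k l
      by (intro sum.cong refl) (simp add: g_def h_def B'.fourier_add algebra_simps)
    show "f (op_scale m F' a T) = a * f T" if "T \<in> adjointable F'" for a T
      unfolding f_def sum_distrib_left using that k l
      by (intro sum.cong refl) (simp add: g_def h_def B'.fourier_scale algebra_simps)
    show "f (\<alpha> (S \<circ> T)) = eta k S * f (\<alpha> T) + f (\<alpha> S) * eta l T" if S: "S \<in> A" and T: "T \<in> A" for S T
    proof -
      have "f (\<alpha> (S \<circ> T)) = (\<Sum>t\<in>?I. eta k S * (c t * (g t (\<alpha> T) - b t * h (\<alpha> T)))
          + c t * (g t (\<alpha> S) - b t * h (\<alpha> S)) * eta l T)"
        unfolding f_def by (intro sum.cong refl) (simp add: g_comp[OF S T] h_comp[OF S T] algebra_simps)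
      thus ?thesis unfolding f_def sum.distrib sum_distrib_left sum_distrib_right .
    qed
    show "f (\<alpha> (creation n B.E F (unit_edge i j s))) = 0" if "s < d" for s
      unfolding f_def by (rule c(2)[OF that])
  qed
  obtain t where t: "t \<le> d" "c t \<noteq> 0" using c(1) by auto
  have u: "unit_edge k l t \<in> carr B'.E" using path[OF t(1)] by (intro unit_edge_closed) auto
  let ?T = "creation m B'.E F' (unit_edge k l t)"
  have "?T \<in> A'" by (rule TA'[OF B'.creation_tensor_algebra[OF u]])
  then obtain T where T: "T \<in> A" "\<alpha> T = ?T" by (elim \<alpha>_surj[THEN bexE])
  \<comment> \<open>A creation operator has no vacuum coefficient, so \<open>h\<close> vanishes at
    it; of the edge coefficients \<open>g r\<close> only the one with \<open>r = t\<close> is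
    nonzero.\<close>
  have "f ?T = (\<Sum>r\<in>?I. c r * (if r = t then 1 else 0))"
    unfolding f_def g_def h_def
    by (intro sum.cong refl) (simp add: B'.U_creation_vertex[OF u] k l, simp add: unit_edge_def)
  also have "\<dots> = (\<Sum>r\<in>?I. if r = t then c r else 0)" by (intro sum.cong) auto
  also have "\<dots> = c t" using t(1) by simp
  finally show False using f_zero[OF T(1)] T(2) t(2) by simp
qed

lemma vertex_map:
  "\<exists>\<sigma>. (\<forall>k<m. \<sigma> k < n) \<and> (\<forall>i<n. \<exists>k<m. \<sigma> k = i) \<and> (\<forall>k<m. \<forall>l<m. C' k l \<le> C (\<sigma> k) (\<sigma> l))"
proof -
  obtain \<sigma> where \<sigma>: "\<And>k. k < m \<Longrightarrow> \<sigma> k < n" "\<And>k. k < m \<Longrightarrow> eta k (B.proj (\<sigma> k)) = 1"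
    using eta_proj_exists by metis
  have "\<exists>k<m. \<sigma> k = i" if i: "i < n" for i
  proof -
    obtain k where k: "k < m" "eta k (B.proj i) = 1" using proj_eta_exists[OF i] by blast
    have "\<sigma> k = i" using eta_proj_disjoint[OF \<sigma>(1)[OF k(1)] i k(1) \<sigma>(2)[OF k(1)]] k(2) by fastforce
    thus ?thesis using k(1) by blast
  qed
  moreover have "C' k l \<le> C (\<sigma> k) (\<sigma> l)" if "k < m" "l < m" for k l
    by (rule edge_bound) (use that \<sigma> in auto)
  ultimately show ?thesis using \<sigma>(1) by (intro exI[of _ \<sigma>]) simp
qed

end

section \<open>Inverse isomorphisms and comparison of the matrices\<close>

lemma isometric_isomorphism_inverse:
  assumes "isometric_isomorphism n X B m Y D \<alpha>"
    and B: "\<And>S T c. S \<in> B \<Longrightarrow> T \<in> B \<Longrightarrow> S + T \<in> B \<and> S \<circ> T \<in> B \<and> op_scale n X c T \<in> B"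
  shows "isometric_isomorphism m Y D n X B (inv_into B \<alpha>)"
proof -
  have bij: "bij_betw \<alpha> B D" using assms(1) unfolding isometric_isomorphism_def by blast
  have inv: "inv_into B \<alpha> T \<in> B" "\<alpha> (inv_into B \<alpha> T) = T" if "T \<in> D" for T
    using that bij by (auto simp: bij_betw_def inv_into_into f_inv_into_f)
  \<comment> \<open>Candidates for inverse images must lie in \<open>B\<close>; closure of
    \<open>B\<close> under the operations provides this for sums, products and multiples.\<close>
  have inv_eq: "inv_into B \<alpha> T = S" if "S \<in> B" "\<alpha> S = T" for S T
    using that bij by (auto simp: bij_betw_def)
  show ?thesis
    unfolding isometric_isomorphism_def
  proof (intro conjI ballI allI)
    show "bij_betw (inv_into B \<alpha>) D B" by (rule bij_betw_inv_into[OF bij])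
    fix S T assume S: "S \<in> D" and T: "T \<in> D"
    show "inv_into B \<alpha> (S + T) = inv_into B \<alpha> S + inv_into B \<alpha> T"
      "inv_into B \<alpha> (S \<circ> T) = inv_into B \<alpha> S \<circ> inv_into B \<alpha> T"
      using assms(1) inv[OF S] inv[OF T] B unfolding isometric_isomorphism_def by (auto intro!: inv_eq)
  next
    fix c T assume T: "T \<in> D"
    show "inv_into B \<alpha> (op_scale m Y c T) = op_scale n X c (inv_into B \<alpha> T)"
      using assms(1) inv[OF T] B unfolding isometric_isomorphism_def by (auto intro!: inv_eq)
  next
    fix T assume T: "T \<in> D"
    show "op_norm n X (inv_into B \<alpha> T) = op_norm m Y T"
      using assms(1) inv[OF T] unfolding isometric_isomorphism_def by metis
  qed
qed

text \<open>The two vertex maps compose to a permutation \<open>\<pi>\<close> with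
  \<open>C' i j \<le> C' (\<pi> i) (\<pi> j)\<close>. As \<open>\<pi>\<close> has finite order, the
  chain of inequalities closes up, and antisymmetry makes all its terms equal.\<close>

lemma mutually_dominated_matrices:
  fixes C C' :: "nat \<Rightarrow> nat \<Rightarrow> 'a::order"
  assumes \<sigma>: "\<forall>k<m. \<sigma> k < n" "\<forall>i<n. \<exists>k<m. \<sigma> k = i" "\<forall>k<m. \<forall>l<m. C' k l \<le> C (\<sigma> k) (\<sigma> l)"
    and \<rho>: "\<forall>k<n. \<rho> k < m" "\<forall>i<m. \<exists>k<n. \<rho> k = i" "\<forall>k<n. \<forall>l<n. C k l \<le> C' (\<rho> k) (\<rho> l)"
  shows "n = m \<and> (\<exists>\<tau>. \<tau> permutes {..<n} \<and> (\<forall>i<n. \<forall>j<n. C' i j = C (\<tau> i) (\<tau> j)))"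
proof
  \<comment> \<open>Surjections in both directions between finite sets force equal cardinalities,
    and are then injective.\<close>
  have "\<sigma> ` {..<m} = {..<n}" "\<rho> ` {..<n} = {..<m}" using \<sigma>(1,2) \<rho>(1,2) by auto
  moreover from this show nm: "n = m"
    by (metis card_image_le card_lessThan finite_lessThan order_antisym)
  ultimately have inj: "inj_on \<sigma> {..<n}" "inj_on \<rho> {..<n}" and im: "\<sigma> ` {..<n} = {..<n}" "\<rho> ` {..<n} = {..<n}"
    by (auto intro: eq_card_imp_inj_on)
  define \<tau> \<upsilon> where "\<tau> i = (if i < n then \<sigma> i else i)" and "\<upsilon> i = (if i < n then \<rho> i else i)" for i
  have perm: "\<tau> permutes {..<n}" "\<upsilon> permutes {..<n}"
    unfolding \<tau>_def \<upsilon>_def using inj im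
    by (auto intro!: bij_imp_permutes simp: bij_betw_def inj_on_def image_def)
  define \<pi> where "\<pi> = \<upsilon> \<circ> \<tau>"
  have \<pi>: "\<pi> permutes {..<n}" unfolding \<pi>_def by (rule permutes_compose[OF perm])
  have step: "C' i j \<le> C (\<tau> i) (\<tau> j) \<and> C (\<tau> i) (\<tau> j) \<le> C' (\<pi> i) (\<pi> j)" if "i < n" "j < n" for i j
    using that \<sigma>(1,3) \<rho>(3) nm by (simp add: \<pi>_def \<tau>_def \<upsilon>_def)
  have \<pi>_less: "i < n \<Longrightarrow> (\<pi> ^^ r) i < n" for i r
    using permutes_in_image[OF permutes_funpow[OF \<pi>, of r], of i] by simp
  have iter: "C' i j \<le> C' ((\<pi> ^^ r) i) ((\<pi> ^^ r) j)" if "i < n" "j < n" for i j r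
  proof (induction r)
    case (Suc r)
    thus ?case using step[OF \<pi>_less[OF that(1), of r] \<pi>_less[OF that(2), of r]] by (auto intro: order_trans)
  qed simp
  have "permutation \<pi>" using \<pi> by (auto simp: permutation_permutes)
  then obtain r where r: "\<pi> ^^ r = id" "0 < r" using permutation_is_nilpotent by blast
  have "C (\<tau> i) (\<tau> j) \<le> C' i j" if ij: "i < n" "j < n" for i j
  proof -
    have "\<pi> i < n" "\<pi> j < n" using \<pi>_less[of _ 1] ij by auto
    hence "C' (\<pi> i) (\<pi> j) \<le> C' ((\<pi> ^^ (r - 1)) (\<pi> i)) ((\<pi> ^^ (r - 1)) (\<pi> j))" by (rule iter)
    moreover have "(\<pi> ^^ (r - 1)) (\<pi> i) = i" "(\<pi> ^^ (r - 1)) (\<pi> j) = j"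
      using r by (metis Suc_pred' comp_apply funpow_Suc_right id_apply)+
    ultimately have "C' (\<pi> i) (\<pi> j) \<le> C' i j" by simp
    thus ?thesis using step[OF ij] by (blast intro: order_trans)
  qed
  hence "\<forall>i<n. \<forall>j<n. C' i j = C (\<tau> i) (\<tau> j)" using step by (blast intro: antisym)
  thus "\<exists>\<tau>. \<tau> permutes {..<n} \<and> (\<forall>i<n. \<forall>j<n. C' i j = C (\<tau> i) (\<tau> j))" using perm(1) by blast
qed

section \<open>The ultraweak closure of an algebra\<close>

context pos_hilbert_module
begin

lemma trace_ip_self: "x \<in> carr X \<Longrightarrow> Re (trace_ip n X x x) = (\<Sum>j<n. Re (ip X x x j))"
  by (simp add: trace_ip_def)

lemma mnorm_sq_le_trace_ip: assumes x: "x \<in> carr X" shows "(mnorm n X x)\<^sup>2 \<le> Re (trace_ip n X x x)"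
proof -
  obtain j where j: "j < n" "cmod (ip X x x j) = (mnorm n X x)\<^sup>2" using mnorm_attained[OF x] by blast
  have "(mnorm n X x)\<^sup>2 = Re (ip X x x j)"
    unfolding j(2)[symmetric] by (subst ip_self[OF x]) (simp add: ip_pos[OF x])
  also have "\<dots> \<le> (\<Sum>j<n. Re (ip X x x j))"
    using j(1) ip_pos[OF x] by (intro member_le_sum) auto
  finally show ?thesis by (simp add: trace_ip_self[OF x])
qed

lemma trace_ip_le_mnorm: assumes x: "x \<in> carr X" shows "Re (trace_ip n X x x) \<le> real n * (mnorm n X x)\<^sup>2"
  using sum_bounded_above[of "{..<n}" "\<lambda>j. Re (ip X x x j)" "(mnorm n X x)\<^sup>2"] ip_le_mnorm[OF x]
  by (simp add: trace_ip_self[OF x])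

text \<open>The square of the Hilbert space norm given by \<open>trace_ip\<close> lies between the
  square of the module norm and \<open>n\<close> times it. Operator bounds for the module norm thus
  apply to square-summable sequences.\<close>

lemma sq_summable_iff:
  "x \<in> sq_summable n X \<longleftrightarrow> (\<forall>k. x k \<in> carr X) \<and> summable (\<lambda>k. (mnorm n X (x k))\<^sup>2)"
proof
  assume x: "x \<in> sq_summable n X"
  hence c: "x k \<in> carr X" for k by (simp add: sq_summable_def)
  have "summable (\<lambda>k. (mnorm n X (x k))\<^sup>2)"
    by (rule summable_comparison_test'[where g="\<lambda>k. Re (trace_ip n X (x k) (x k))" and N=0])
       (use x c mnorm_sq_le_trace_ip in \<open>auto simp: sq_summable_def\<close>)
  thus "(\<forall>k. x k \<in> carr X) \<and> summable (\<lambda>k. (mnorm n X (x k))\<^sup>2)" using c by blast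
next
  assume x: "(\<forall>k. x k \<in> carr X) \<and> summable (\<lambda>k. (mnorm n X (x k))\<^sup>2)"
  hence c: "x k \<in> carr X" for k by blast
  have "summable (\<lambda>k. Re (trace_ip n X (x k) (x k)))"
  proof (rule summable_comparison_test'[where g="\<lambda>k. real n * (mnorm n X (x k))\<^sup>2" and N=0])
    show "summable (\<lambda>k. real n * (mnorm n X (x k))\<^sup>2)" using x by (intro summable_mult) blast
    fix k
    have "0 \<le> Re (trace_ip n X (x k) (x k))"
      using mnorm_sq_le_trace_ip[OF c, of k] by (rule order_trans[rotated]) simp
    thus "norm (Re (trace_ip n X (x k) (x k))) \<le> real n * (mnorm n X (x k))\<^sup>2"
      using trace_ip_le_mnorm[OF c] by simp
  qed
  thus "x \<in> sq_summable n X" using c by (simp add: sq_summable_def)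
qed

lemma sq_summable_closed: "x \<in> sq_summable n X \<Longrightarrow> x k \<in> carr X"
  by (simp add: sq_summable_def)

lemma sq_summable_bounded_image:
  assumes x: "x \<in> sq_summable n X" and c: "\<And>k. y k \<in> carr X"
    and le: "\<And>k. mnorm n X (y k) \<le> M * mnorm n X (x k)"
  shows "y \<in> sq_summable n X"
  unfolding sq_summable_iff
proof (intro conjI allI c)
  show "summable (\<lambda>k. (mnorm n X (y k))\<^sup>2)"
  proof (rule summable_comparison_test'[where g="\<lambda>k. M\<^sup>2 * (mnorm n X (x k))\<^sup>2" and N=0])
    show "summable (\<lambda>k. M\<^sup>2 * (mnorm n X (x k))\<^sup>2)"
      using x unfolding sq_summable_iff by (intro summable_mult) blast
    show "norm ((mnorm n X (y k))\<^sup>2) \<le> M\<^sup>2 * (mnorm n X (x k))\<^sup>2" for k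
      using power_mono[OF le mnorm_nonneg, of k 2] by (simp add: power_mult_distrib)
  qed
qed

lemma sq_summable_operator:
  "T \<in> adjointable X \<Longrightarrow> x \<in> sq_summable n X \<Longrightarrow> (\<lambda>k. T (x k)) \<in> sq_summable n X"
  by (rule sq_summable_bounded_image[where M="op_norm n X T"])
     (auto simp: op_norm_bound sq_summable_closed adjointable_closed)

lemma sq_summable_scalar: "x \<in> sq_summable n X \<Longrightarrow> (\<lambda>k. csc n X c (x k)) \<in> sq_summable n X"
  by (rule sq_summable_bounded_image[where M="cmod c"])
     (auto simp: mnorm_csc sq_summable_closed scalar_closed)

text \<open>Required for splitting series in the functionals: \<open>suminf\<close> of a sum is the
  sum of the \<open>suminf\<close> only under convergence.\<close>

lemma trace_ip_summable:
  assumes x: "x \<in> sq_summable n X" and y: "y \<in> sq_summable n X"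
  shows "summable (\<lambda>k. trace_ip n X (x k) (y k))"
proof (rule summable_comparison_test'[where N=0])
  show "summable (\<lambda>k. real n * ((mnorm n X (x k))\<^sup>2 + (mnorm n X (y k))\<^sup>2))"
    using x y unfolding sq_summable_iff by (intro summable_mult summable_add) blast+
  fix k
  let ?a = "mnorm n X (x k)" and ?b = "mnorm n X (y k)"
  have "cmod (ip X (x k) (y k) j) \<le> ?a\<^sup>2 + ?b\<^sup>2" for j
  proof -
    have "cmod (ip X (x k) (y k) j) \<le> ?a * ?b"
      by (rule ip_bound[OF sq_summable_closed[OF x] sq_summable_closed[OF y]])
    moreover have "0 \<le> ?a * ?b" by (intro mult_nonneg_nonneg mnorm_nonneg)
    ultimately show ?thesis using sum_squares_bound[of ?a ?b] by linarith
  qed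
  hence "(\<Sum>j<n. cmod (ip X (x k) (y k) j)) \<le> real n * (?a\<^sup>2 + ?b\<^sup>2)"
    using sum_bounded_above[of "{..<n}" "\<lambda>j. cmod (ip X (x k) (y k) j)" "?a\<^sup>2 + ?b\<^sup>2"] by simp
  thus "cmod (trace_ip n X (x k) (y k)) \<le> real n * (?a\<^sup>2 + ?b\<^sup>2)"
    unfolding trace_ip_def using norm_sum order_trans by blast
qed

lemma wstar_basis:
  "x \<in> sq_summable n X \<Longrightarrow> y \<in> sq_summable n X \<Longrightarrow> open W \<Longrightarrow>
    openin (wstar_topology n X) {T \<in> adjointable X. (\<Sum>k. trace_ip n X (x k) (T (y k))) \<in> W}"
  unfolding wstar_topology_def by (rule topology_generated_by_Basis) blast

text \<open>Continuity is tested on subbasic sets. The constant \<open>c\<close> allows for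
  translations, whose pulled back functionals are affine.\<close>

lemma wstar_continuousI:
  assumes f: "\<And>T. T \<in> adjointable X \<Longrightarrow> f T \<in> adjointable X"
    and pullback: "\<And>x y. x \<in> sq_summable n X \<Longrightarrow> y \<in> sq_summable n X \<Longrightarrow>
      \<exists>x'\<in>sq_summable n X. \<exists>y'\<in>sq_summable n X. \<exists>c. \<forall>T\<in>adjointable X.
        (\<Sum>k. trace_ip n X (x k) (f T (y k))) = (\<Sum>k. trace_ip n X (x' k) (T (y' k))) + c"
  shows "continuous_map (wstar_topology n X) (wstar_topology n X) f"
proof -
  let ?W = "wstar_topology n X"
  let ?S = "{{T \<in> adjointable X. (\<Sum>k. trace_ip n X (x k) (T (y k))) \<in> U} | x y U.
        x \<in> sq_summable n X \<and> y \<in> sq_summable n X \<and> open U}"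
  have "continuous_map ?W (topology_generated_by ?S) f"
  proof (rule continuous_on_generated_topo)
    have "\<Union> ?S = adjointable X"
      using topspace_wstar unfolding wstar_topology_def topology_generated_by_topspace .
    thus "f ` topspace ?W \<subseteq> \<Union> ?S" using f by (simp only: topspace_wstar) blast
    fix Q assume "Q \<in> ?S"
    then obtain x y W where Q: "Q = {T \<in> adjointable X. (\<Sum>k. trace_ip n X (x k) (T (y k))) \<in> W}"
      and x: "x \<in> sq_summable n X" and y: "y \<in> sq_summable n X" and W: "open W" by blast
    obtain x' y' c where x': "x' \<in> sq_summable n X" and y': "y' \<in> sq_summable n X"
      and eq: "\<And>T. T \<in> adjointable X \<Longrightarrow>
        (\<Sum>k. trace_ip n X (x k) (f T (y k))) = (\<Sum>k. trace_ip n X (x' k) (T (y' k))) + c"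
      using pullback[OF x y] by blast
    have pre: "f -` Q \<inter> topspace ?W
        = {T \<in> adjointable X. (\<Sum>k. trace_ip n X (x' k) (T (y' k))) \<in> (\<lambda>z. z + c) -` W}"
      unfolding topspace_wstar Q using f eq by auto
    have "open ((\<lambda>z. z + c) -` W)" by (intro open_vimage W continuous_intros)
    thus "openin ?W (f -` Q \<inter> topspace ?W)" unfolding pre by (rule wstar_basis[OF x' y'])
  qed
  thus ?thesis unfolding wstar_topology_def[symmetric] .
qed

text \<open>An adjoint is specified on the carrier only. Cut off to 0 elsewhere it becomes an
  operator in its own right, and so maps square-summable sequences to such sequences.\<close>

lemma adjoint_adjointable:
  assumes "S \<in> adjointable X"
  shows "\<exists>S'\<in>adjointable X. \<forall>x\<in>carr X. \<forall>y\<in>carr X. ip X (S' x) y = ip X x (S y)"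
proof -
  obtain R where R: "\<And>x. x \<in> carr X \<Longrightarrow> R x \<in> carr X"
    "\<And>x y. x \<in> carr X \<Longrightarrow> y \<in> carr X \<Longrightarrow> ip X (R x) y = ip X x (S y)"
    by (rule adjoint_obtain[OF assms]) blast
  define S' where "S' x = (if x \<in> carr X then R x else 0)" for x
  have "S' \<in> adjointable X"
  proof (rule adjointableI)
    fix x y assume x: "x \<in> carr X" and y: "y \<in> carr X"
    show "S x \<in> carr X" by (rule adjointable_closed[OF assms x])
    show "ip X (S x) y = ip X x (S' y)"
      using ip_adj[OF y adjointable_closed[OF assms x]] ip_adj[OF R(1)[OF y] x] R(2)[OF y x] y
      by (simp add: S'_def)
  qed (simp_all add: S'_def R(1))
  thus ?thesis using R(2) by (intro bexI[of _ S']) (auto simp: S'_def)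
qed

lemma trace_ip_add: "x \<in> carr X \<Longrightarrow> y \<in> carr X \<Longrightarrow> z \<in> carr X
    \<Longrightarrow> trace_ip n X x (y + z) = trace_ip n X x y + trace_ip n X x z"
  by (simp add: trace_ip_def ip_add_right sum.distrib)

lemma wstar_continuous_comp_right:
  assumes S: "S \<in> adjointable X"
  shows "continuous_map (wstar_topology n X) (wstar_topology n X) (\<lambda>T. T \<circ> S)"
proof (rule wstar_continuousI)
  show "T \<circ> S \<in> adjointable X" if "T \<in> adjointable X" for T by (rule comp_adjointable[OF that S])
  fix x y assume "x \<in> sq_summable n X" "y \<in> sq_summable n X"
  thus "\<exists>x'\<in>sq_summable n X. \<exists>y'\<in>sq_summable n X. \<exists>c. \<forall>T\<in>adjointable X.
      (\<Sum>k. trace_ip n X (x k) ((T \<circ> S) (y k))) = (\<Sum>k. trace_ip n X (x' k) (T (y' k))) + c"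
    by (intro bexI[of _ x] bexI[of _ "\<lambda>k. S (y k)"] exI[of _ 0]) (simp_all add: sq_summable_operator[OF S])
qed

lemma wstar_continuous_comp_left:
  assumes S: "S \<in> adjointable X"
  shows "continuous_map (wstar_topology n X) (wstar_topology n X) (\<lambda>T. S \<circ> T)"
proof (rule wstar_continuousI)
  show "S \<circ> T \<in> adjointable X" if "T \<in> adjointable X" for T by (rule comp_adjointable[OF S that])
  obtain S' where S': "S' \<in> adjointable X"
    "\<And>x y. x \<in> carr X \<Longrightarrow> y \<in> carr X \<Longrightarrow> ip X (S' x) y = ip X x (S y)"
    using adjoint_adjointable[OF S] by blast
  fix x y assume x: "x \<in> sq_summable n X" and y: "y \<in> sq_summable n X"
  have "trace_ip n X (x k) (S (T (y k))) = trace_ip n X (S' (x k)) (T (y k))" if "T \<in> adjointable X" for T k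
    using S'(2)[OF sq_summable_closed[OF x] adjointable_closed'[OF that]] by (simp add: trace_ip_def)
  thus "\<exists>x'\<in>sq_summable n X. \<exists>y'\<in>sq_summable n X. \<exists>c. \<forall>T\<in>adjointable X.
      (\<Sum>k. trace_ip n X (x k) ((S \<circ> T) (y k))) = (\<Sum>k. trace_ip n X (x' k) (T (y' k))) + c"
    using y sq_summable_operator[OF S'(1) x]
    by (intro bexI[of _ "\<lambda>k. S' (x k)"] bexI[of _ y] exI[of _ 0]) simp_all
qed

lemma wstar_continuous_add:
  assumes S: "S \<in> adjointable X"
  shows "continuous_map (wstar_topology n X) (wstar_topology n X) (\<lambda>T. S + T)"
proof (rule wstar_continuousI)
  show "S + T \<in> adjointable X" if "T \<in> adjointable X" for T by (rule plus_adjointable[OF S that])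
  fix x y assume x: "x \<in> sq_summable n X" and y: "y \<in> sq_summable n X"
  have "(\<Sum>k. trace_ip n X (x k) ((S + T) (y k)))
      = (\<Sum>k. trace_ip n X (x k) (T (y k))) + (\<Sum>k. trace_ip n X (x k) (S (y k)))"
    if T: "T \<in> adjointable X" for T
  proof -
    have "trace_ip n X (x k) ((S + T) (y k)) = trace_ip n X (x k) (T (y k)) + trace_ip n X (x k) (S (y k))" for k
      using trace_ip_add[OF sq_summable_closed[OF x] adjointable_closed'[OF S] adjointable_closed'[OF T]]
      by (simp add: add.commute)
    thus ?thesis
      using suminf_add[OF trace_ip_summable[OF x sq_summable_operator[OF T y]]
          trace_ip_summable[OF x sq_summable_operator[OF S y]]] by simp
  qed
  thus "\<exists>x'\<in>sq_summable n X. \<exists>y'\<in>sq_summable n X. \<exists>c. \<forall>T\<in>adjointable X.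
      (\<Sum>k. trace_ip n X (x k) ((S + T) (y k))) = (\<Sum>k. trace_ip n X (x' k) (T (y' k))) + c"
    using x y by blast
qed

lemma wstar_continuous_scale:
  "continuous_map (wstar_topology n X) (wstar_topology n X) (op_scale n X c)"
proof (rule wstar_continuousI)
  show "op_scale n X c T \<in> adjointable X" if "T \<in> adjointable X" for T by (rule scale_adjointable[OF that])
  fix x y assume x: "x \<in> sq_summable n X" and y: "y \<in> sq_summable n X"
  have "op_scale n X c T (y k) = T (csc n X c (y k))" if "T \<in> adjointable X" for T k
    using adjointable_csc[OF that sq_summable_closed[OF y]] by (simp add: op_scale_def)
  thus "\<exists>x'\<in>sq_summable n X. \<exists>y'\<in>sq_summable n X. \<exists>a. \<forall>T\<in>adjointable X.
      (\<Sum>k. trace_ip n X (x k) (op_scale n X c T (y k))) = (\<Sum>k. trace_ip n X (x' k) (T (y' k))) + a"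
    using x sq_summable_scalar[OF y]
    by (intro bexI[of _ x] bexI[of _ "\<lambda>k. csc n X c (y k)"] exI[of _ 0]) simp_all
qed

lemma wstar_closure_invariant:
  assumes f: "continuous_map (wstar_topology n X) (wstar_topology n X) f"
    and B: "\<And>T. T \<in> B \<Longrightarrow> f T \<in> wstar_topology n X closure_of B"
    and T: "T \<in> wstar_topology n X closure_of B"
  shows "f T \<in> wstar_topology n X closure_of B"
proof -
  have "f T \<in> wstar_topology n X closure_of (f ` B)"
    using continuous_map_image_closure_subset[OF f] T by blast
  moreover have "wstar_topology n X closure_of (f ` B) \<subseteq> wstar_topology n X closure_of B"
    by (rule closure_of_minimal) (use B in auto)
  ultimately show ?thesis by blast
qed

text \<open>
  Multiplication is only separately continuous, so products in the closure are reached in two steps: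
  first with the left factor in the algebra, then with the right factor in the closure.
\<close>

lemma wstar_closure_subalgebra:
  assumes B: "closed_subalgebra n X B"
    and S: "S \<in> wstar_topology n X closure_of B" and T: "T \<in> wstar_topology n X closure_of B"
  shows "S + T \<in> wstar_topology n X closure_of B" "S \<circ> T \<in> wstar_topology n X closure_of B"
    "op_scale n X c T \<in> wstar_topology n X closure_of B"
proof -
  let ?W = "wstar_topology n X" and ?H = "wstar_topology n X closure_of B"
  have B_adj: "B \<subseteq> adjointable X" using B unfolding closed_subalgebra_def by blast
  have ops: "R + Q \<in> B" "R \<circ> Q \<in> B" "op_scale n X c Q \<in> B" if "R \<in> B" "Q \<in> B" for R Q
    using B that unfolding closed_subalgebra_def by blast+
  have sub: "R \<in> ?H" if "R \<in> B" for R
    using closure_of_subset[of B ?W] B_adj that by (auto simp: topspace_wstar)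
  have adj: "R \<in> adjointable X" if "R \<in> ?H" for R
    using closure_of_subset_topspace[of ?W B] that by (auto simp: topspace_wstar)
  have "R + T \<in> ?H" if R: "R \<in> B" for R
    by (rule wstar_closure_invariant[OF wstar_continuous_add _ T]) (use R B_adj sub ops in auto)
  hence "T + R \<in> ?H" if "R \<in> B" for R using that by (simp add: add.commute)
  hence "T + S \<in> ?H"
    by (rule wstar_closure_invariant[OF wstar_continuous_add[OF adj[OF T]] _ S])
  thus "S + T \<in> ?H" by (simp add: add.commute)
  have "R \<circ> T \<in> ?H" if R: "R \<in> B" for R
    by (rule wstar_closure_invariant[OF wstar_continuous_comp_left _ T]) (use R B_adj sub ops in auto)
  thus "S \<circ> T \<in> ?H"
    by (rule wstar_closure_invariant[OF wstar_continuous_comp_right[OF adj[OF T]] _ S])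
  show "op_scale n X c T \<in> ?H"
    by (rule wstar_closure_invariant[OF wstar_continuous_scale _ T]) (use sub ops in auto)
qed

end

section \<open>The classification\<close>

lemma tensor_algebra_vertex_map:
  fixes F :: "(nat \<Rightarrow> nat \<Rightarrow> nat \<Rightarrow> complex, 'x::ab_group_add) fock"
    and F' :: "(nat \<Rightarrow> nat \<Rightarrow> nat \<Rightarrow> complex, 'y::ab_group_add) fock"
  assumes n: "0 < n" and m: "0 < m"
    and F: "fock_space n (matrix_corr n C) F" and F': "fock_space m (matrix_corr m C') F'"
    and iso: "isometric_isomorphism n F (tensor_algebra n (matrix_corr n C) F)
      m F' (tensor_algebra m (matrix_corr m C') F') \<alpha>"
  shows "\<exists>\<sigma>. (\<forall>k<m. \<sigma> k < n) \<and> (\<forall>i<n. \<exists>k<m. \<sigma> k = i) \<and> (\<forall>k<m. \<forall>l<m. C' k l \<le> C (\<sigma> k) (\<sigma> l))"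
proof -
  obtain U V where U: "fock_coordinates n C F U V" using fock_coordinates_exist[OF n F] by blast
  obtain U' V' where U': "fock_coordinates m C' F' U' V'" using fock_coordinates_exist[OF m F'] by blast
  interpret B: fock_coordinates n C F U V by (rule U)
  interpret B': fock_coordinates m C' F' U' V' by (rule U')
  interpret algebra_isomorphism n C F U V m C' F' U' V' B.TA B'.TA \<alpha>
    by unfold_locales (use B.tensor_algebra_triangular B'.tensor_algebra_triangular iso in auto)
  show ?thesis by (rule vertex_map)
qed

lemma hardy_algebra_vertex_map:
  fixes F :: "(nat \<Rightarrow> nat \<Rightarrow> nat \<Rightarrow> complex, 'x::ab_group_add) fock"
    and F' :: "(nat \<Rightarrow> nat \<Rightarrow> nat \<Rightarrow> complex, 'y::ab_group_add) fock"
  assumes n: "0 < n" and m: "0 < m"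
    and F: "fock_space n (matrix_corr n C) F" and F': "fock_space m (matrix_corr m C') F'"
    and iso: "isometric_isomorphism n F (hardy_algebra n (matrix_corr n C) F)
      m F' (hardy_algebra m (matrix_corr m C') F') \<alpha>"
    and cont: "continuous_map (subtopology (wstar_topology n F) (hardy_algebra n (matrix_corr n C) F))
      (subtopology (wstar_topology m F') (hardy_algebra m (matrix_corr m C') F')) \<alpha>"
  shows "\<exists>\<sigma>. (\<forall>k<m. \<sigma> k < n) \<and> (\<forall>i<n. \<exists>k<m. \<sigma> k = i) \<and> (\<forall>k<m. \<forall>l<m. C' k l \<le> C (\<sigma> k) (\<sigma> l))"
proof -
  obtain U V where U: "fock_coordinates n C F U V" using fock_coordinates_exist[OF n F] by blast
  obtain U' V' where U': "fock_coordinates m C' F' U' V'" using fock_coordinates_exist[OF m F'] by blast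
  interpret B: fock_coordinates n C F U V by (rule U)
  interpret B': fock_coordinates m C' F' U' V' by (rule U')
  let ?H = "hardy_algebra n B.E F" and ?W = "wstar_topology n F"
  have ext: "f (\<alpha> T) = 0"
    if f: "normal_functional m F' f" and z: "\<And>T. T \<in> B.TA \<Longrightarrow> f (\<alpha> T) = 0" and T: "T \<in> ?H" for f T
  proof -
    have "continuous_map (subtopology ?W ?H) (wstar_topology m F') \<alpha>"
      using cont by (simp add: continuous_map_in_subtopology)
    hence "continuous_map (subtopology ?W ?H) euclidean (f \<circ> \<alpha>)"
      by (rule continuous_map_compose) (use f in \<open>simp add: normal_functional_def\<close>)
    hence "closedin (subtopology ?W ?H) {T \<in> topspace (subtopology ?W ?H). (f \<circ> \<alpha>) T \<in> {0}}"
      by (rule closedin_continuous_map_preimage) simp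
    \<comment> \<open>The kernel of \<open>f \<circ> \<alpha>\<close> is closed only relative to the
      Hardy algebra. It is cut out by an ultraweakly closed \<open>D\<close>, which contains the
      tensor algebra and hence its closure.\<close>
    then obtain D where D: "closedin ?W D"
      "{T \<in> topspace (subtopology ?W ?H). (f \<circ> \<alpha>) T \<in> {0}} = D \<inter> ?H"
      unfolding closedin_subtopology by blast
    have H: "B.TA \<subseteq> ?H" "?H \<subseteq> topspace ?W"
      using B.tensor_algebra_hardy_algebra B.hardy_algebra_triangular B.triangular_adjointable
      by (auto simp: B.topspace_wstar)
    hence "B.TA \<subseteq> D" using D(2) z by auto
    hence "?H \<subseteq> D" unfolding hardy_algebra_def by (rule closure_of_minimal[OF _ D(1)])
    thus ?thesis using D(2) T by auto
  qed
  interpret algebra_isomorphism n C F U V m C' F' U' V' ?H "hardy_algebra m B'.E F'" \<alpha>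
    by unfold_locales
      (use B.hardy_algebra_triangular B'.hardy_algebra_triangular B.tensor_algebra_hardy_algebra
        B'.tensor_algebra_hardy_algebra iso ext in auto)
  show ?thesis by (rule vertex_map)
qed

theorem theorem3p7:
  fixes n m :: nat
    and C C' :: "nat \<Rightarrow> nat \<Rightarrow> enat"
    and F :: "(nat \<Rightarrow> nat \<Rightarrow> nat \<Rightarrow> complex, 'f::ab_group_add) fock"
    and F' :: "(nat \<Rightarrow> nat \<Rightarrow> nat \<Rightarrow> complex, 'g::ab_group_add) fock"
  defines "E \<equiv> matrix_corr n C"
    and "E' \<equiv> matrix_corr m C'"
  assumes "0 < n" and "0 < m"
    and "fock_space n E F"
    and "fock_space m E' F'"
  shows "((\<exists>\<alpha>. isometric_isomorphism n F (tensor_algebra n E F) m F' (tensor_algebra m E' F') \<alpha>)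
            \<longrightarrow> n = m \<and> (\<exists>\<tau>. \<tau> permutes {..<n} \<and> (\<forall>i<n. \<forall>j<n. C' i j = C (\<tau> i) (\<tau> j))))
       \<and> ((\<exists>\<alpha>. isometric_isomorphism n F (hardy_algebra n E F) m F' (hardy_algebra m E' F') \<alpha>
              \<and> wstar_bicontinuous n F (hardy_algebra n E F) m F' (hardy_algebra m E' F') \<alpha>)
            \<longrightarrow> n = m \<and> (\<exists>\<tau>. \<tau> permutes {..<n} \<and> (\<forall>i<n. \<forall>j<n. C' i j = C (\<tau> i) (\<tau> j))))"
proof -
  note n = assms(3) and m = assms(4)
    and F = assms(5)[unfolded E_def] and F' = assms(6)[unfolded E'_def]
  obtain U V where U: "fock_coordinates n C F U V" using fock_coordinates_exist[OF n F] by blast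
  obtain U' V' where U': "fock_coordinates m C' F' U' V'" using fock_coordinates_exist[OF m F'] by blast
  interpret B: fock_coordinates n C F U V by (rule U)
  interpret B': fock_coordinates m C' F' U' V' by (rule U')
  show ?thesis
    unfolding E_def E'_def
  proof (intro conjI[where P="_ \<longrightarrow> _"] impI; elim exE conjE)
    fix \<alpha> assume iso: "isometric_isomorphism n F B.TA m F' B'.TA \<alpha>"
    have ops: "S + T \<in> B.TA \<and> S \<circ> T \<in> B.TA \<and> op_scale n F c T \<in> B.TA" if "S \<in> B.TA" "T \<in> B.TA" for S T c
      using that B.closed_subalgebra_tensor_algebra unfolding closed_subalgebra_def by blast
    have iso': "isometric_isomorphism m F' B'.TA n F B.TA (inv_into B.TA \<alpha>)"
      by (rule isometric_isomorphism_inverse[OF iso]) (rule ops)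
    from tensor_algebra_vertex_map[OF n m F F' iso] tensor_algebra_vertex_map[OF m n F' F iso']
    show "n = m \<and> (\<exists>\<tau>. \<tau> permutes {..<n} \<and> (\<forall>i<n. \<forall>j<n. C' i j = C (\<tau> i) (\<tau> j)))"
      by (elim exE conjE) (rule mutually_dominated_matrices)
  next
    fix \<alpha>
    let ?H = "hardy_algebra n (matrix_corr n C) F" and ?H' = "hardy_algebra m (matrix_corr m C') F'"
    let ?W = "subtopology (wstar_topology n F) ?H" and ?W' = "subtopology (wstar_topology m F') ?H'"
    assume iso: "isometric_isomorphism n F ?H m F' ?H' \<alpha>" and bi: "wstar_bicontinuous n F ?H m F' ?H' \<alpha>"
    have ops: "S + T \<in> ?H \<and> S \<circ> T \<in> ?H \<and> op_scale n F c T \<in> ?H" if "S \<in> ?H" "T \<in> ?H" for S T c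
      using B.wstar_closure_subalgebra[OF B.closed_subalgebra_tensor_algebra] that
      unfolding hardy_algebra_def by blast
    have top: "topspace ?W = ?H" "topspace ?W' = ?H'"
      using B.hardy_algebra_triangular B.triangular_adjointable
        B'.hardy_algebra_triangular B'.triangular_adjointable
      by (auto simp: B.topspace_wstar B'.topspace_wstar)
    \<comment> \<open>The continuous inverse has to be identified with
      \<open>inv_into ?H \<alpha>\<close>, the map that is shown to be an isometric
      isomorphism.\<close>
    obtain \<beta> where \<beta>: "homeomorphic_maps ?W ?W' \<alpha> \<beta>"
      using bi unfolding wstar_bicontinuous_def homeomorphic_map_maps by blast
    hence cont: "continuous_map ?W ?W' \<alpha>" "continuous_map ?W' ?W \<beta>"
      unfolding homeomorphic_maps_def by blast+
    have "inv_into ?H \<alpha> T = \<beta> T" if T: "T \<in> ?H'" for T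
    proof -
      have "\<beta> T \<in> ?H" using continuous_map_image_subset_topspace[OF cont(2)] T unfolding top by blast
      moreover have "\<alpha> (\<beta> T) = T" using \<beta> T top unfolding homeomorphic_maps_def by metis
      moreover have "inj_on \<alpha> ?H" using iso unfolding isometric_isomorphism_def bij_betw_def by blast
      ultimately show ?thesis by (metis inv_into_f_f)
    qed
    hence cont': "continuous_map ?W' ?W (inv_into ?H \<alpha>)"
      by (intro continuous_map_eq[OF cont(2)]) (simp only: top)
    have iso': "isometric_isomorphism m F' ?H' n F ?H (inv_into ?H \<alpha>)"
      by (rule isometric_isomorphism_inverse[OF iso]) (rule ops)
    from hardy_algebra_vertex_map[OF n m F F' iso cont(1)] hardy_algebra_vertex_map[OF m n F' F iso' cont']
    show "n = m \<and> (\<exists>\<tau>. \<tau> permutes {..<n} \<and> (\<forall>i<n. \<forall>j<n. C' i j = C (\<tau> i) (\<tau> j)))"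
      by (elim exE conjE) (rule mutually_dominated_matrices)
  qed
qed

end
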